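(* Let $(b,c)$ be a connected canonically compactifiable weighted graph over $X$ and $m:X\to(0,\infty)$. Let $Q$ be a closed nonnegative quadratic form on $\ell^2(X,m)$ with domain $D(Q)$ satisfying $C_c(X)\subseteq D(Q)\subseteq\widetilde D\cap\ell^2(X,m)$ and $Q(u)=\widetilde Q(u)$ for $u\in D(Q)$, and let $L$ be the associated nonnegative selfadjoint operator. Then for all $t>0$ and $\alpha>0$, the operators $e^{-tL}$ and $(L+\alpha)^{-1}$ are bounded operators from $\ell^2(X,m)$ to $\ell^\infty(X)$. If, additionally, $m(X)<\infty$, then $e^{-tL}$ ($t>0$) and $(L+\alpha)^{-1}$ ($\alpha>0$) are trace class operators on $\ell^2(X,m)$; in particular $L$ has purely discrete spectrum.
   Context: Let $X$ be a countably infinite set. A weighted graph $(b,c)$ over $X$ consists of a symmetric $b:X\times X\to[0,\infty)$ with $b(x,x)=0$ and $\sum_{y}b(x,y)<\infty$ for all $x$, and $c:X\to[0,\infty)$; connected means any two distinct vertices are joined by a finite path of pairwise distinct vertices with consecutive ones satisfying $b>0$. Let $\widetilde Q(f)=\frac12\sum_{x,y}b(x,y)|f(x)-f(y)|^2+\sum_x c(x)|f(x)|^2$ and $\widetilde D=\{f:X\to\mathbb C:\widetilde Q(f)<\infty\}$; the graph is canonically compactifiable if $\widetilde D\subseteq\ell^\infty(X)$. $\ell^2(X,m)$ is the Hilbert space with inner product $\langle u,v\rangle=\sum_x\overline{u(x)}v(x)m(x)$, $m(X)=\sum_x m(x)$, and $C_c(X)$ denotes finitely supported functions. *)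

theory Defs
  imports "HOL-Analysis.Analysis"
begin

definition weighted_graph :: "('a \<Rightarrow> 'a \<Rightarrow> real) \<Rightarrow> ('a \<Rightarrow> real) \<Rightarrow> bool" where
  "weighted_graph b c \<longleftrightarrow>
     (\<forall>x y. b x y = b y x) \<and> (\<forall>x. b x x = 0) \<and> (\<forall>x y. b x y \<ge> 0) \<and>
     (\<forall>x. (\<lambda>y. b x y) summable_on UNIV) \<and> (\<forall>x. c x \<ge> 0)"

definition graph_connected :: "('a \<Rightarrow> 'a \<Rightarrow> real) \<Rightarrow> bool" where
  "graph_connected b \<longleftrightarrow>
     (\<forall>x y. x \<noteq> y \<longrightarrow> (\<exists>ps. ps \<noteq> [] \<and> distinct ps \<and> hd ps = x \<and> last ps = y \<and>
        (\<forall>i. Suc i < length ps \<longrightarrow> b (ps ! i) (ps ! Suc i) > 0)))"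

definition Dtilde :: "('a \<Rightarrow> 'a \<Rightarrow> real) \<Rightarrow> ('a \<Rightarrow> real) \<Rightarrow> ('a \<Rightarrow> complex) set" where
  "Dtilde b c = {f. (\<lambda>(x,y). b x y * (cmod (f x - f y))\<^sup>2) summable_on UNIV \<and>
                    (\<lambda>x. c x * (cmod (f x))\<^sup>2) summable_on UNIV}"

definition Qtilde :: "('a \<Rightarrow> 'a \<Rightarrow> real) \<Rightarrow> ('a \<Rightarrow> real) \<Rightarrow> ('a \<Rightarrow> complex) \<Rightarrow> real" where
  "Qtilde b c f = 1/2 * (\<Sum>\<^sub>\<infinity>(x,y). b x y * (cmod (f x - f y))\<^sup>2) + (\<Sum>\<^sub>\<infinity>x. c x * (cmod (f x))\<^sup>2)"

definition linfty :: "('a \<Rightarrow> complex) set" where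
  "linfty = {f. \<exists>C. \<forall>x. cmod (f x) \<le> C}"

definition canonically_compactifiable :: "('a \<Rightarrow> 'a \<Rightarrow> real) \<Rightarrow> ('a \<Rightarrow> real) \<Rightarrow> bool" where
  "canonically_compactifiable b c \<longleftrightarrow> Dtilde b c \<subseteq> linfty"

definition Cc :: "('a \<Rightarrow> complex) set" where
  "Cc = {f. finite {x. f x \<noteq> 0}}"

definition l2 :: "('a \<Rightarrow> real) \<Rightarrow> ('a \<Rightarrow> complex) set" where
  "l2 m = {f. (\<lambda>x. (cmod (f x))\<^sup>2 * m x) summable_on UNIV}"

definition l2norm :: "('a \<Rightarrow> real) \<Rightarrow> ('a \<Rightarrow> complex) \<Rightarrow> real" where
  "l2norm m f = sqrt (\<Sum>\<^sub>\<infinity>x. (cmod (f x))\<^sup>2 * m x)"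

definition l2inner :: "('a \<Rightarrow> real) \<Rightarrow> ('a \<Rightarrow> complex) \<Rightarrow> ('a \<Rightarrow> complex) \<Rightarrow> complex" where
  "l2inner m u v = (\<Sum>\<^sub>\<infinity>x. cnj (u x) * v x * complex_of_real (m x))"

definition subspace_l2 :: "('a \<Rightarrow> real) \<Rightarrow> ('a \<Rightarrow> complex) set \<Rightarrow> bool" where
  "subspace_l2 m D \<longleftrightarrow> D \<subseteq> l2 m \<and> (\<lambda>x. 0) \<in> D \<and>
     (\<forall>u\<in>D. \<forall>v\<in>D. (\<lambda>x. u x + v x) \<in> D) \<and> (\<forall>a. \<forall>u\<in>D. (\<lambda>x. a * u x) \<in> D)"

definition nonneg_quadratic_form ::
  "('a \<Rightarrow> real) \<Rightarrow> ('a \<Rightarrow> complex) set \<Rightarrow> (('a \<Rightarrow> complex) \<Rightarrow> real) \<Rightarrow> bool" where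
  "nonneg_quadratic_form m D Q \<longleftrightarrow> subspace_l2 m D \<and> (\<forall>u\<in>D. Q u \<ge> 0) \<and>
     (\<exists>q. (\<forall>u\<in>D. \<forall>v\<in>D. \<forall>w\<in>D. \<forall>a b.
             q u (\<lambda>x. a * v x + b * w x) = a * q u v + b * q u w \<and>
             q (\<lambda>x. a * v x + b * w x) u = cnj a * q v u + cnj b * q w u) \<and>
          (\<forall>u\<in>D. q u u = complex_of_real (Q u)))"

definition closed_form ::
  "('a \<Rightarrow> real) \<Rightarrow> ('a \<Rightarrow> complex) set \<Rightarrow> (('a \<Rightarrow> complex) \<Rightarrow> real) \<Rightarrow> bool" where
  "closed_form m D Q \<longleftrightarrow> nonneg_quadratic_form m D Q \<and>
     (\<forall>u :: nat \<Rightarrow> 'a \<Rightarrow> complex. (\<forall>n. u n \<in> D) \<and>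
        (\<forall>e>0. \<exists>N. \<forall>n\<ge>N. \<forall>k\<ge>N. Q (\<lambda>x. u n x - u k x) + (l2norm m (\<lambda>x. u n x - u k x))\<^sup>2 < e)
        \<longrightarrow> (\<exists>v\<in>D. (\<lambda>n. Q (\<lambda>x. u n x - v x) + (l2norm m (\<lambda>x. u n x - v x))\<^sup>2) \<longlonglongrightarrow> 0))"

text \<open>Sesquilinear form obtained from \<open>Q\<close> by polarization.\<close>
definition sesq :: "(('a \<Rightarrow> complex) \<Rightarrow> real) \<Rightarrow> ('a \<Rightarrow> complex) \<Rightarrow> ('a \<Rightarrow> complex) \<Rightarrow> complex" where
  "sesq Q u v =
     complex_of_real ((Q (\<lambda>x. u x + v x) - Q (\<lambda>x. u x - v x)) / 4) +
     \<i> * complex_of_real ((Q (\<lambda>x. u x - \<i> * v x) - Q (\<lambda>x. u x + \<i> * v x)) / 4)"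

definition op_dom :: "('a \<Rightarrow> real) \<Rightarrow> ('a \<Rightarrow> complex) set \<Rightarrow> (('a \<Rightarrow> complex) \<Rightarrow> real) \<Rightarrow> ('a \<Rightarrow> complex) set" where
  "op_dom m D Q = {u\<in>D. \<exists>w\<in>l2 m. \<forall>v\<in>D. sesq Q v u = l2inner m v w}"

definition op_L :: "('a \<Rightarrow> real) \<Rightarrow> ('a \<Rightarrow> complex) set \<Rightarrow> (('a \<Rightarrow> complex) \<Rightarrow> real) \<Rightarrow>
    ('a \<Rightarrow> complex) \<Rightarrow> ('a \<Rightarrow> complex)" where
  "op_L m D Q u = (THE w. w \<in> l2 m \<and> (\<forall>v\<in>D. sesq Q v u = l2inner m v w))"

definition resolvent_op :: "('a \<Rightarrow> real) \<Rightarrow> ('a \<Rightarrow> complex) set \<Rightarrow> (('a \<Rightarrow> complex) \<Rightarrow> real) \<Rightarrow> real \<Rightarrow>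
    ('a \<Rightarrow> complex) \<Rightarrow> ('a \<Rightarrow> complex)" where
  "resolvent_op m D Q \<alpha> f =
     (THE u. u \<in> op_dom m D Q \<and> (\<lambda>x. op_L m D Q u x + complex_of_real \<alpha> * u x) = f)"

text \<open>Semigroup \<open>e\<^sup>-\<^sup>t\<^sup>L\<close>: \<open>e\<^sup>-\<^sup>t\<^sup>L f = u(t)\<close> where \<open>u\<close> is the (unique) solution of the abstract
  Cauchy problem \<open>u' = -L u\<close> on \<open>(0,\<infinity>)\<close>, \<open>u(0) = f\<close> (i.e. the \<open>C\<^sub>0\<close>-semigroup generated by \<open>-L\<close>).\<close>
definition heat_solution :: "('a \<Rightarrow> real) \<Rightarrow> ('a \<Rightarrow> complex) set \<Rightarrow> (('a \<Rightarrow> complex) \<Rightarrow> real) \<Rightarrow>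
    ('a \<Rightarrow> complex) \<Rightarrow> (real \<Rightarrow> 'a \<Rightarrow> complex) \<Rightarrow> bool" where
  "heat_solution m D Q f u \<longleftrightarrow>
     u 0 = f \<and> (\<forall>s>0. u s \<in> op_dom m D Q) \<and>
     ((\<lambda>s. l2norm m (\<lambda>x. u s x - f x)) \<longlongrightarrow> 0) (at_right 0) \<and>
     (\<forall>s>0. ((\<lambda>r. l2norm m (\<lambda>x. (u r x - u s x) / complex_of_real (r - s) + op_L m D Q (u s) x))
               \<longlongrightarrow> 0) (at s))"

definition heat_op :: "('a \<Rightarrow> real) \<Rightarrow> ('a \<Rightarrow> complex) set \<Rightarrow> (('a \<Rightarrow> complex) \<Rightarrow> real) \<Rightarrow> real \<Rightarrow>
    ('a \<Rightarrow> complex) \<Rightarrow> ('a \<Rightarrow> complex)" where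
  "heat_op m D Q t f = (THE g. \<exists>u. heat_solution m D Q f u \<and> g = u t)"

definition bounded_l2_linfty :: "('a \<Rightarrow> real) \<Rightarrow> (('a \<Rightarrow> complex) \<Rightarrow> ('a \<Rightarrow> complex)) \<Rightarrow> bool" where
  "bounded_l2_linfty m T \<longleftrightarrow>
     (\<forall>f\<in>l2 m. \<forall>g\<in>l2 m. \<forall>a b. T (\<lambda>x. a * f x + b * g x) = (\<lambda>x. a * T f x + b * T g x)) \<and>
     (\<exists>C. \<forall>f\<in>l2 m. \<forall>x. cmod (T f x) \<le> C * l2norm m f)"

definition bounded_op :: "('a \<Rightarrow> real) \<Rightarrow> (('a \<Rightarrow> complex) \<Rightarrow> ('a \<Rightarrow> complex)) \<Rightarrow> bool" where
  "bounded_op m T \<longleftrightarrow> (\<forall>f\<in>l2 m. T f \<in> l2 m) \<and>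
     (\<forall>f\<in>l2 m. \<forall>g\<in>l2 m. \<forall>a b. T (\<lambda>x. a * f x + b * g x) = (\<lambda>x. a * T f x + b * T g x)) \<and>
     (\<exists>C. \<forall>f\<in>l2 m. l2norm m (T f) \<le> C * l2norm m f)"

text \<open>\<open>|T| = (T\<^sup>*T)\<^sup>1\<^sup>/\<^sup>2\<close>: the unique positive bounded operator \<open>S\<close> with \<open>S\<^sup>2 = T\<^sup>*T\<close>, i.e.
  \<open>\<langle>Sf,Sg\<rangle> = \<langle>Tf,Tg\<rangle>\<close> (normalized to \<open>0\<close> outside \<open>\<ell>\<^sup>2\<close>).\<close>
definition abs_op :: "('a \<Rightarrow> real) \<Rightarrow> (('a \<Rightarrow> complex) \<Rightarrow> ('a \<Rightarrow> complex)) \<Rightarrow>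
    (('a \<Rightarrow> complex) \<Rightarrow> ('a \<Rightarrow> complex))" where
  "abs_op m T = (THE S. bounded_op m S \<and> (\<forall>f. f \<notin> l2 m \<longrightarrow> S f = (\<lambda>x. 0)) \<and>
       (\<forall>f\<in>l2 m. Im (l2inner m f (S f)) = 0 \<and> Re (l2inner m f (S f)) \<ge> 0) \<and>
       (\<forall>f\<in>l2 m. \<forall>g\<in>l2 m. l2inner m (S f) (S g) = l2inner m (T f) (T g)))"

definition onb :: "('a \<Rightarrow> real) \<Rightarrow> 'a \<Rightarrow> ('a \<Rightarrow> complex)" where
  "onb m x = (\<lambda>y. if y = x then complex_of_real (1 / sqrt (m x)) else 0)"

definition trace_class :: "('a \<Rightarrow> real) \<Rightarrow> (('a \<Rightarrow> complex) \<Rightarrow> ('a \<Rightarrow> complex)) \<Rightarrow> bool" where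
  "trace_class m T \<longleftrightarrow> bounded_op m T \<and>
     (\<lambda>x. Re (l2inner m (onb m x) (abs_op m T (onb m x)))) summable_on UNIV"

definition op_resolvent_set :: "('a \<Rightarrow> real) \<Rightarrow> ('a \<Rightarrow> complex) set \<Rightarrow> (('a \<Rightarrow> complex) \<Rightarrow> real) \<Rightarrow> complex set" where
  "op_resolvent_set m D Q = {z.
     (\<forall>f\<in>l2 m. \<exists>u\<in>op_dom m D Q. (\<lambda>x. op_L m D Q u x - z * u x) = f) \<and>
     (\<exists>C. \<forall>u\<in>op_dom m D Q. l2norm m u \<le> C * l2norm m (\<lambda>x. op_L m D Q u x - z * u x))}"

definition op_spectrum :: "('a \<Rightarrow> real) \<Rightarrow> ('a \<Rightarrow> complex) set \<Rightarrow> (('a \<Rightarrow> complex) \<Rightarrow> real) \<Rightarrow> complex set" where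
  "op_spectrum m D Q = - op_resolvent_set m D Q"

definition purely_discrete_spectrum :: "('a \<Rightarrow> real) \<Rightarrow> ('a \<Rightarrow> complex) set \<Rightarrow> (('a \<Rightarrow> complex) \<Rightarrow> real) \<Rightarrow> bool" where
  "purely_discrete_spectrum m D Q \<longleftrightarrow>
     (\<forall>z\<in>op_spectrum m D Q.
        (\<exists>e>0. \<forall>\<mu>\<in>op_spectrum m D Q. cmod (\<mu> - z) < e \<longrightarrow> \<mu> = z) \<and>
        (\<exists>u\<in>op_dom m D Q. u \<noteq> (\<lambda>x. 0) \<and> op_L m D Q u = (\<lambda>x. z * u x)) \<and>
        (\<exists>B. finite B \<and> (\<forall>u\<in>op_dom m D Q. op_L m D Q u = (\<lambda>x. z * u x) \<longrightarrow>
              (\<exists>k. u = (\<lambda>x. \<Sum>v\<in>B. k v * v x)))))"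

end

theory Submission
  imports Defs "HOL-Computational_Algebra.Polynomial" "HOL-Complex_Analysis.Great_Picard"
begin

text \<open>Canonical compactifiability upgrades itself to \<open>\<parallel>u\<parallel>\<^sub>\<infinity>\<^sup>2 \<le> B (Q(u) + \<parallel>u\<parallel>\<^sup>2)\<close> on the form domain.
  Since \<open>Q(R h) + \<parallel>R h\<parallel>\<^sup>2 = \<langle>R h, h\<rangle>\<close> for \<open>R = (L + 1)\<^sup>-\<^sup>1\<close>, every operator \<open>R k(R)\<close> with \<open>k\<close> continuous
  on \<open>[0,1]\<close> maps \<open>\<ell>\<^sup>2\<close> boundedly to \<open>\<ell>\<^sup>\<infinity>\<close>; both \<open>(L + \<alpha>)\<^sup>-\<^sup>1\<close> and \<open>e\<^sup>-\<^sup>t\<^sup>L\<close> have this shape. The same bound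
  applied to \<open>h = \<delta>\<^sub>x\<close> gives \<open>\<langle>R e\<^sub>x, e\<^sub>x\<rangle> \<le> B m(x)\<close>, which is the trace estimate when \<open>m(X)\<close> is finite; and for
  finite \<open>m(X)\<close> it makes \<open>R\<close> compact and bounds the number of orthonormal eigenvectors of \<open>R\<close> with
  eigenvalue at least \<open>\<rho>\<close> by \<open>2 B m(X) / \<rho>\<close>. The functional calculus \<open>k(R)\<close> for \<open>0 \<le> R \<le> 1\<close> needs only
  Bernstein polynomials, as \<open>R\<^sup>i (1 - R)\<^sup>j \<ge> 0\<close>.\<close>

section \<open>Continuous functional calculus for \<open>0 \<le> R \<le> 1\<close>\<close>

text \<open>The operators \<open>op_L\<close>, \<open>resolvent_op\<close> and
  \<open>heat_op\<close> are given by descriptions, so nothing can be computed until existence and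
  uniqueness are settled. The single bounded operator R settles them all: the domain of L is the
  range of R, and L (R h) = h - R h. A statement about L thereby becomes one about functions on
  [0,1] with x = 1 / (1 + \<lambda>), and the unbounded end of the spectrum sits at x = 0. This is
  where the analysis lies: g(R) maps into ell^infinity because g(x) is x times a continuous k(x), so
  that the sup bound for R y can be applied to y = k(R) h. For k \<ge> 0 bounded by M the same
  factorisation gives 0 \<le> g(R) \<le> M R, hence trace class from the diagonal of R alone. The
  operator theory is carried out over the reals, with the real part of the inner product; imaginary
  parts are recovered afterwards because multiplication by \<i> commutes with R.\<close>

definition poly_op :: "('h::real_vector \<Rightarrow> 'h) \<Rightarrow> real poly \<Rightarrow> 'h \<Rightarrow> 'h" where
  "poly_op R p f = fold_coeffs (\<lambda>a g. a *\<^sub>R f + R g) p 0"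

lemma poly_op_0 [simp]: "poly_op R 0 f = 0"
  by (simp add: poly_op_def)

lemma poly_op_pCons:
  assumes "linear R"
  shows "poly_op R (pCons a p) f = a *\<^sub>R f + R (poly_op R p f)"
\<comment> \<open>\<open>fold_coeffs\<close> skips a zero coefficient in front of the zero
  polynomial, so this case rests on R 0 = 0.\<close>
proof (cases "a = 0 \<and> p = 0")
  case True
  then show ?thesis using linear_0[OF assms] by simp
next
  case False
  then show ?thesis by (auto simp: poly_op_def)
qed

lemma poly_op_linear: "linear R \<Longrightarrow> linear (poly_op R p)"
proof (induction p)
  case 0
  then show ?case by (intro linearI) auto
next
  case (pCons a p)
  interpret R: linear R by fact
  interpret P: linear "poly_op R p" using pCons by simp
  show ?case
    by (intro linearI) (simp_all add: poly_op_pCons[OF pCons.prems] P.add R.add P.scale R.scale scaleR_add_right)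
qed

lemma poly_op_add:
  assumes "linear R"
  shows "poly_op R (p + q) f = poly_op R p f + poly_op R q f"
  by (induction p q rule: poly_induct2)
     (simp_all add: poly_op_pCons[OF assms] linear_add[OF assms] scaleR_add_left)

lemma poly_op_smult:
  assumes "linear R"
  shows "poly_op R (smult a p) f = a *\<^sub>R poly_op R p f"
  by (induction p) (simp_all add: poly_op_pCons[OF assms] linear_scale[OF assms] scaleR_add_right)

lemma poly_op_diff:
  assumes "linear R"
  shows "poly_op R (p - q) f = poly_op R p f - poly_op R q f"
  using poly_op_add[OF assms, of p "smult (-1) q" f] poly_op_smult[OF assms, of "-1" q f] by simp

lemma poly_op_sum:
  assumes "linear R"
  shows "poly_op R (\<Sum>i\<in>A. p i) f = (\<Sum>i\<in>A. poly_op R (p i) f)"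
  by (induction A rule: infinite_finite_induct) (simp_all add: poly_op_add[OF assms])

lemma poly_op_mult:
  assumes "linear R"
  shows "poly_op R (p * q) f = poly_op R p (poly_op R q f)"
proof (induction p)
  case 0
  then show ?case by simp
next
  case (pCons a p)
  then show ?case
    by (simp add: mult_pCons_left poly_op_add[OF assms] poly_op_smult[OF assms] poly_op_pCons[OF assms])
qed

lemma poly_op_const [simp]:
  assumes "linear R"
  shows "poly_op R [:a:] f = a *\<^sub>R f" "poly_op R 1 f = f"
  using poly_op_pCons[OF assms, of a 0 f] poly_op_pCons[OF assms, of 1 0 f] linear_0[OF assms]
  by (simp_all add: one_pCons)

lemma poly_op_X [simp]:
  assumes "linear R"
  shows "poly_op R [:0, 1:] f = R f"
  using assms by (simp add: poly_op_pCons linear_0)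

lemma poly_op_commute:
  assumes "linear R" "linear J" "\<And>f. J (R f) = R (J f)"
  shows "J (poly_op R p f) = poly_op R p (J f)"
  by (induction p)
     (simp_all add: poly_op_pCons[OF assms(1)] linear_0[OF assms(2)] linear_add[OF assms(2)]
        linear_scale[OF assms(2)] assms(3))

text \<open>Lets one polynomial in S^2 = T^2 be read as a polynomial in S and as one in T, as the
  uniqueness of square roots requires.\<close>

lemma poly_op_square:
  assumes "linear R"
  shows "poly_op R (pcompose p [:0, 0, 1:]) f = poly_op (\<lambda>h. R (R h)) p f"
proof (induction p)
  case 0
  then show ?case by simp
next
  case (pCons a p)
  have RR: "linear (\<lambda>h. R (R h))"
    using linear_compose[OF assms assms] by (simp add: o_def)
  have "poly_op R [:0,0,1:] g = R (R g)" for g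
    using assms by (simp add: poly_op_pCons linear_0)
  then show ?case
    unfolding pcompose_pCons poly_op_add[OF assms] poly_op_mult[OF assms] poly_op_pCons[OF RR]
    using pCons.IH assms by simp
qed

section \<open>Monomials in the Bernstein basis\<close>

lemma smult_sum_right: "smult a (\<Sum>i\<in>A. p i) = (\<Sum>i\<in>A. smult a (p i))"
  by (induction A rule: infinite_finite_induct) (simp_all add: smult_add_right)

text \<open>Multiply x^j by (x + (1 - x))^(n - j) = 1 and expand. The coefficient C(n-j, k-j) is
  rewritten as C(n,k) C(k,j) / C(n,j), because the quotient C(k,j) / C(n,j) is what approximates
  (k/n)^j.\<close>

lemma monom_eq_sum_bernstein:
  assumes "j \<le> n"
  shows "[:0, 1:] ^ j = (\<Sum>k\<le>n. smult (real (n choose k) * (real (k choose j) / real (n choose j)))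
            ([:0, 1:] ^ k * [:1, -1:] ^ (n - k)) :: real poly)"
proof -
  let ?X = "[:0, 1:] :: real poly" and ?Y = "[:1, -1:] :: real poly"
  have XY: "?X + ?Y = 1" by (simp add: one_pCons)
  have "?X ^ j = ?X ^ j * (?X + ?Y) ^ (n - j)" by (simp only: XY power_one mult_1_right)
  also have "\<dots> = (\<Sum>i\<le>n - j. of_nat (n - j choose i) * ?X ^ (j + i) * ?Y ^ (n - j - i))"
    unfolding binomial_ring sum_distrib_left power_add by (simp only: mult_ac)
  also have "\<dots> = (\<Sum>k=j..n. of_nat (n - j choose (k - j)) * ?X ^ k * ?Y ^ (n - k))"
    by (rule sum.reindex_bij_witness[of _ "\<lambda>k. k - j" "\<lambda>i. j + i"]) (use assms in auto)
  also have "\<dots> = (\<Sum>k=j..n. smult (real (n choose k) * (real (k choose j) / real (n choose j)))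
            (?X ^ k * ?Y ^ (n - k)))"
  proof (rule sum.cong[OF refl])
    fix k assume k: "k \<in> {j..n}"
    have "real (n choose k) * real (k choose j) = real (n choose j) * real (n - j choose (k - j))"
      using choose_mult[of j k n] k unfolding of_nat_mult[symmetric] by simp
    moreover have "real (n choose j) > 0" using assms by simp
    ultimately have "real (n choose k) * (real (k choose j) / real (n choose j)) = real (n - j choose (k - j))"
      by (simp add: field_simps)
    then show "of_nat (n - j choose (k - j)) * ?X ^ k * ?Y ^ (n - k) =
        smult (real (n choose k) * (real (k choose j) / real (n choose j))) (?X ^ k * ?Y ^ (n - k))"
      by (simp add: of_nat_poly mult.assoc)
  qed
  also have "\<dots> = (\<Sum>k\<le>n. smult (real (n choose k) * (real (k choose j) / real (n choose j)))
            (?X ^ k * ?Y ^ (n - k)))"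
    by (rule sum.mono_neutral_left) (auto simp: binomial_eq_0)
  finally show ?thesis .
qed

text \<open>The quotient is the product over i < j of (k - i) / (n - i). Each factor is within d /
  (n - d) of k / n, and two products of factors of modulus at most 1 differ by at most the sum of
  the factorwise differences.\<close>

lemma choose_ratio_approx:
  assumes "j \<le> d" "2 * d < n" "k \<le> n"
  shows "\<bar>real (k choose j) / real (n choose j) - (real k / real n) ^ j\<bar> \<le> real d * (real d / real (n - d))"
proof -
  have fr: "real (N choose j) = (\<Prod>i<j. real N - real i) / fact j" for N
    by (simp add: binomial_gbinomial gbinomial_prod_rev lessThan_atLeast0)
  have "real (k choose j) / real (n choose j) = (\<Prod>i<j. (real k - real i) / (real n - real i))"
    by (simp add: fr prod_dividef)
  moreover have "(real k / real n) ^ j = (\<Prod>i<j. real k / real n)" by simp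
  ultimately have "\<bar>real (k choose j) / real (n choose j) - (real k / real n) ^ j\<bar>
      = norm ((\<Prod>i<j. (real k - real i) / (real n - real i)) - (\<Prod>i<j. real k / real n))"
    by simp
  also have "\<dots> \<le> (\<Sum>i<j. norm ((real k - real i) / (real n - real i) - real k / real n))"
  proof (rule norm_prod_diff)
    fix i assume "i \<in> {..<j}"
    then have i: "i < d" using assms by auto
    \<comment> \<open>The numerator is negative for k < i; the assumption 2 * d < n bounds its
      modulus in that case too.\<close>
    have "\<bar>real k - real i\<bar> \<le> real n - real i" using i assms by linarith
    then show "norm ((real k - real i) / (real n - real i)) \<le> 1"
      using i assms by (simp add: divide_le_eq)
    show "norm (real k / real n) \<le> 1" using assms by (simp add: divide_le_eq)
  qed
  also have "\<dots> \<le> (\<Sum>i<j. real d / real (n - d))"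
  proof (rule sum_mono)
    fix i assume "i \<in> {..<j}"
    then have i: "i < d" using assms by auto
    then have pos: "real n > 0" "real n - real i > 0" "real (n - d) > 0" "real (n - d) \<le> real n - real i"
      using assms by linarith+
    have "(real k - real i) / (real n - real i) - real k / real n = - (real i * (real n - real k) / real n / (real n - real i))"
      using pos by (simp add: field_simps)
    also have "norm \<dots> = real i * ((real n - real k) / real n) / (real n - real i)"
      using pos assms by (simp add: abs_mult)
    also have "\<dots> \<le> real d * 1 / real (n - d)"
      using pos assms i by (intro frac_le mult_mono) (auto simp: divide_le_eq)
    finally show "norm ((real k - real i) / (real n - real i) - real k / real n) \<le> real d / real (n - d)" by simp
  qed
  also have "\<dots> \<le> real d * (real d / real (n - d))"
    using assms by (simp add: mult_right_mono divide_right_mono)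
  finally show ?thesis .
qed

text \<open>Spectrum in [0,1], expressed by quadratic forms only; boundedness comes out later, from
  \<open>poly_op_norm_le\<close>. The scalars are real: on \<open>lsq\<close> the inner product is
  the real part of the complex one.\<close>

locale unit_selfadjoint =
  fixes R :: "'h::{real_inner,complete_space} \<Rightarrow> 'h"
  assumes lin: "linear R"
    and sym: "R f \<bullet> g = f \<bullet> R g"
    and nonneg: "0 \<le> R f \<bullet> f"
    and le_id: "R f \<bullet> f \<le> f \<bullet> f"
begin

lemma poly_op_sym: "poly_op R p f \<bullet> g = f \<bullet> poly_op R p g"
proof (induction p arbitrary: f g)
  case (pCons a p)
  then show ?case
    using poly_op_commute[OF lin lin refl, of p g]
    by (simp add: poly_op_pCons[OF lin] inner_add_left inner_add_right sym)
qed simp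

text \<open>Even powers are moved to both sides of the inner product, which leaves exponents 0 or 1.
  The mixed case X Y has no evident sign, but X + Y = 1 turns it into Y^2 X + X^2 Y.\<close>

lemma bernstein_nonneg: "0 \<le> poly_op R ([:0, 1:] ^ k * [:1, -1:] ^ l) f \<bullet> f"
proof -
  let ?X = "[:0, 1:] :: real poly" and ?Y = "[:1, -1:] :: real poly"
  have X: "poly_op R ?X g \<bullet> g \<ge> 0" for g using nonneg lin by simp
  have Y: "poly_op R ?Y g \<bullet> g \<ge> 0" for g
    using le_id[of g] lin by (simp add: poly_op_pCons linear_0 linear_neg inner_diff_left)
  have sq: "poly_op R (q * q * w) g \<bullet> g = poly_op R w (poly_op R q g) \<bullet> poly_op R q g" for q w g
    using lin by (metis poly_op_mult poly_op_sym mult.commute)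
  have XY: "poly_op R (?X * ?Y) g \<bullet> g \<ge> 0" for g
  proof -
    have eq: "?X * ?Y = ?Y * ?Y * ?X + ?X * ?X * ?Y" by simp
    show ?thesis
      unfolding eq using X Y lin by (simp only: poly_op_add inner_add_left sq) auto
  qed
  define q where "q = ?X ^ (k div 2) * ?Y ^ (l div 2)"
  have e: "?X ^ k = ?X ^ (k div 2) * ?X ^ (k div 2) * ?X ^ (k mod 2)"
    "?Y ^ l = ?Y ^ (l div 2) * ?Y ^ (l div 2) * ?Y ^ (l mod 2)"
    by (simp_all only: power_add[symmetric]) (simp_all add: mult_2[symmetric])
  have "?X ^ k * ?Y ^ l = q * q * (?X ^ (k mod 2) * ?Y ^ (l mod 2))"
    by (subst e(1), subst e(2)) (simp only: q_def mult_ac)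
  moreover have "poly_op R (?X ^ (k mod 2) * ?Y ^ (l mod 2)) g \<bullet> g \<ge> 0" for g
  proof -
    have "k mod 2 = 0 \<or> k mod 2 = 1" "l mod 2 = 0 \<or> l mod 2 = 1" by auto
    then show ?thesis using X[of g] Y[of g] XY[of g] lin by (elim disjE) simp_all
  qed
  ultimately show ?thesis by (simp only: sq)
qed

text \<open>Writing \<open>p\<close> in the Bernstein basis of degree \<open>n\<close>, its coefficients converge uniformly to
  the values \<open>p (k/n)\<close>, and each basis polynomial is a nonnegative operator.\<close>

lemma poly_op_nonneg:
  assumes "\<And>x. 0 \<le> x \<Longrightarrow> x \<le> 1 \<Longrightarrow> 0 \<le> poly p x"
  shows "0 \<le> poly_op R p f \<bullet> f"
proof -
  define d where "d = degree p"
  define A where "A = (\<Sum>j\<le>d. \<bar>coeff p j\<bar>)"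
  define B where "B n k = ([:0, 1:] ^ k * [:1, -1:] ^ (n - k) :: real poly)" for n k
  define c where "c n k = (\<Sum>j\<le>d. coeff p j * (real (k choose j) / real (n choose j)))" for n k
  have p_eq: "p = (\<Sum>k\<le>n. smult (real (n choose k) * c n k) (B n k))" if n: "2 * d < n" for n
  proof -
    have "p = (\<Sum>j\<le>d. smult (coeff p j) ([:0, 1:] ^ j))"
      unfolding d_def by (subst poly_as_sum_of_monoms[symmetric]) (simp add: monom_altdef)
    also have "\<dots> = (\<Sum>j\<le>d. \<Sum>k\<le>n. smult (coeff p j * (real (n choose k) * (real (k choose j) / real (n choose j)))) (B n k))"
    proof (rule sum.cong[OF refl])
      fix j assume "j \<in> {..d}"
      then have "j \<le> n" using n by auto
      show "smult (coeff p j) ([:0, 1:] ^ j) = (\<Sum>k\<le>n. smult (coeff p j * (real (n choose k) * (real (k choose j) / real (n choose j)))) (B n k))"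
        unfolding monom_eq_sum_bernstein[OF \<open>j \<le> n\<close>] B_def by (simp add: smult_sum_right)
    qed
    also have "\<dots> = (\<Sum>k\<le>n. smult (real (n choose k) * c n k) (B n k))"
      by (subst sum.swap) (simp add: c_def sum_distrib_left smult_sum mult_ac flip: sum_divide_distrib)
    finally show ?thesis .
  qed
  have one_eq: "1 = (\<Sum>k\<le>n. smult (real (n choose k)) (B n k))" for n
    using monom_eq_sum_bernstein[of 0 n] by (simp add: B_def)
  have c_ge: "c n k \<ge> - (A * (real d * (real d / real (n - d))))" if n: "2 * d < n" and k: "k \<le> n" for n k
  proof -
    have "poly p (real k / real n) - c n k = (\<Sum>j\<le>d. coeff p j * ((real k / real n) ^ j - real (k choose j) / real (n choose j)))"
      by (simp add: poly_altdef d_def c_def sum_subtractf right_diff_distrib)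
    also have "\<dots> \<le> (\<Sum>j\<le>d. \<bar>coeff p j\<bar> * (real d * (real d / real (n - d))))"
    proof (rule sum_mono)
      fix j assume j: "j \<in> {..d}"
      have "\<bar>(real k / real n) ^ j - real (k choose j) / real (n choose j)\<bar> \<le> real d * (real d / real (n - d))"
        using choose_ratio_approx[of j d n k] j n k by (auto simp: abs_minus_commute)
      then have "\<bar>coeff p j * ((real k / real n) ^ j - real (k choose j) / real (n choose j))\<bar> \<le> \<bar>coeff p j\<bar> * (real d * (real d / real (n - d)))"
        unfolding abs_mult by (rule mult_left_mono) simp
      then show "coeff p j * ((real k / real n) ^ j - real (k choose j) / real (n choose j)) \<le> \<bar>coeff p j\<bar> * (real d * (real d / real (n - d)))"
        by (rule order_trans[OF abs_ge_self])
    qed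
    also have "\<dots> = A * (real d * (real d / real (n - d)))"
      by (simp only: A_def sum_distrib_right)
    finally have "poly p (real k / real n) - c n k \<le> A * (real d * (real d / real (n - d)))" .
    moreover have "0 \<le> poly p (real k / real n)" using k n by (intro assms) (auto simp: divide_le_eq)
    moreover have "- z \<le> y" if "x - y \<le> z" "0 \<le> x" for x y z :: real using that by linarith
    ultimately show ?thesis by blast
  qed
  \<comment> \<open>The weighted Bernstein polynomials sum to 1 (\<open>one_eq\<close>), so
    replacing all coefficients by a common lower bound leaves that bound times |f|^2.\<close>
  have bound: "poly_op R p f \<bullet> f \<ge> - (A * (real d * (real d / real (n - d)))) * (f \<bullet> f)" if n: "2 * d < n" for n
  proof -
    let ?e = "- (A * (real d * (real d / real (n - d))))"
    have "f \<bullet> f = poly_op R 1 f \<bullet> f" using lin by simp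
    also have "\<dots> = (\<Sum>k\<le>n. real (n choose k) * (poly_op R (B n k) f \<bullet> f))"
      by (subst one_eq[of n]) (simp add: poly_op_sum[OF lin] poly_op_smult[OF lin] inner_sum_left)
    finally have "?e * (f \<bullet> f) = (\<Sum>k\<le>n. (real (n choose k) * ?e) * (poly_op R (B n k) f \<bullet> f))"
      by (simp add: sum_distrib_left mult_ac)
    also have "\<dots> \<le> (\<Sum>k\<le>n. (real (n choose k) * c n k) * (poly_op R (B n k) f \<bullet> f))"
      using c_ge[OF n] bernstein_nonneg by (intro sum_mono mult_right_mono mult_left_mono) (auto simp: B_def)
    also have "\<dots> = poly_op R p f \<bullet> f"
      by (subst p_eq[OF n]) (simp add: poly_op_sum[OF lin] poly_op_smult[OF lin] inner_sum_left)
    finally show ?thesis .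
  qed
  have lim: "(\<lambda>n. - (A * (real d * (real d / real (n - d)))) * (f \<bullet> f)) \<longlonglongrightarrow> - (A * (real d * 0)) * (f \<bullet> f)"
  proof -
    have "(\<lambda>n. real d / real n) \<longlonglongrightarrow> 0" by (rule lim_const_over_n)
    then have "(\<lambda>n. real d / real (n - d)) \<longlonglongrightarrow> 0"
      by (rule filterlim_compose) (rule filterlim_minus_const_nat_at_top)
    then show ?thesis by (intro tendsto_intros)
  qed
  have "eventually (\<lambda>n. - (A * (real d * (real d / real (n - d)))) * (f \<bullet> f) \<le> poly_op R p f \<bullet> f) sequentially"
    using eventually_gt_at_top[of "2 * d"] by eventually_elim (rule bound)
  from tendsto_upperbound[OF lim this] show ?thesis by simp
qed

text \<open>Positivity of M^2 - p^2 at R, combined with the symmetry of p(R).\<close>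

lemma poly_op_norm_le:
  assumes "\<And>x. 0 \<le> x \<Longrightarrow> x \<le> 1 \<Longrightarrow> \<bar>poly p x\<bar> \<le> M"
  shows "norm (poly_op R p f) \<le> M * norm f"
proof -
  have M: "M \<ge> 0" using assms[of 0] by linarith
  have "0 \<le> poly_op R ([:M\<^sup>2:] - p * p) f \<bullet> f"
  proof (rule poly_op_nonneg)
    fix x :: real assume "0 \<le> x" "x \<le> 1"
    then have "\<bar>poly p x\<bar>\<^sup>2 \<le> M\<^sup>2" by (intro power_mono assms) auto
    then show "0 \<le> poly ([:M\<^sup>2:] - p * p) x" by (simp add: power2_eq_square)
  qed
  also have "\<dots> = M\<^sup>2 * (norm f)\<^sup>2 - (norm (poly_op R p f))\<^sup>2"
    using lin by (simp add: poly_op_diff inner_diff_left poly_op_mult poly_op_sym power2_norm_eq_inner)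
  finally have "(norm (poly_op R p f))\<^sup>2 \<le> (M * norm f)\<^sup>2" by (simp add: power_mult_distrib)
  then show ?thesis using M by (simp add: power2_le_iff_abs_le)
qed

lemma norm_le: "norm (R f) \<le> norm f"
  using poly_op_norm_le[of "[:0,1:]" 1 f] lin by simp

lemma bounded_linear: "bounded_linear R"
  using lin norm_le by (intro bounded_linear_intro[of R 1]) (auto simp: linear_add linear_scale)

end

section \<open>From polynomials to continuous functions\<close>

lemma poly_approx_on_unit:
  fixes g :: "real \<Rightarrow> real"
  assumes "continuous_on {0..1} g" "e > 0"
  shows "\<exists>p. \<forall>x\<in>{0..1}. \<bar>poly p x - g x\<bar> < e"
proof -
  obtain h where h: "real_polynomial_function h" "\<And>x. x \<in> {0..1} \<Longrightarrow> \<bar>g x - h x\<bar> < e"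
    using Stone_Weierstrass_real_polynomial_function[OF compact_Icc assms] by blast
  obtain a n where "h = (\<lambda>x. \<Sum>i\<le>n. a i * x ^ i)"
    using h(1) real_polynomial_function_iff_sum[of h] by auto
  then have "poly (\<Sum>i\<le>n. monom (a i) i) x = h x" for x by (simp add: poly_sum poly_monom)
  then show ?thesis using h(2) by (metis abs_minus_commute)
qed

lemma continuous_on_unit_bounded:
  fixes g :: "real \<Rightarrow> real"
  assumes "continuous_on {0..1} g"
  shows "\<exists>M. \<forall>x\<in>{0..1}. \<bar>g x\<bar> \<le> M"
  using compact_imp_bounded[OF compact_continuous_image[OF assms compact_Icc]] by (auto simp: bounded_iff)

text \<open>For continuous g and R as in \<open>unit_selfadjoint\<close>, the choice of approximants
  is immaterial: by \<open>op_fun_approx\<close> every polynomial close to g gives a vector close to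
  this limit.\<close>

definition op_fun :: "('h::{real_inner,complete_space} \<Rightarrow> 'h) \<Rightarrow> (real \<Rightarrow> real) \<Rightarrow> 'h \<Rightarrow> 'h" where
  "op_fun R g f = lim (\<lambda>n. poly_op R (SOME p. \<forall>x\<in>{0..1}. \<bar>poly p x - g x\<bar> < 1 / real (Suc n)) f)"

context unit_selfadjoint
begin

text \<open>Two polynomials close to g on [0,1] are close to each other there, so
  \<open>poly_op_norm_le\<close> makes the chosen sequence Cauchy, and the error bound survives the
  limit.\<close>

lemma op_fun_approx:
  assumes g: "continuous_on {0..1} g" and p: "\<And>x. x \<in> {0..1} \<Longrightarrow> \<bar>poly p x - g x\<bar> \<le> e"
  shows "norm (poly_op R p f - op_fun R g f) \<le> e * norm f"
proof -
  define P where "P n = (SOME p. \<forall>x\<in>{0..1}. \<bar>poly p x - g x\<bar> < 1 / real (Suc n))" for n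
  have P: "\<bar>poly (P n) x - g x\<bar> < 1 / real (Suc n)" if "x \<in> {0..1}" for n x
    using someI_ex[OF poly_approx_on_unit[OF g, of "1 / real (Suc n)"]] that unfolding P_def by auto
  have diff: "norm (poly_op R q f - poly_op R (P n) f) \<le> (d + 1 / real (Suc n)) * norm f"
    if "\<And>x. x \<in> {0..1} \<Longrightarrow> \<bar>poly q x - g x\<bar> \<le> d" for q d n
  proof -
    have "\<bar>poly (q - P n) x\<bar> \<le> d + 1 / real (Suc n)" if "0 \<le> x" "x \<le> 1" for x
      using P[of x n] \<open>\<And>x. x \<in> {0..1} \<Longrightarrow> \<bar>poly q x - g x\<bar> \<le> d\<close>[of x] that by simp
    then show ?thesis
      using poly_op_norm_le[of "q - P n" _ f] by (simp add: poly_op_diff[OF lin])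
  qed
  have "Cauchy (\<lambda>n. poly_op R (P n) f)"
  proof (rule CauchyI)
    fix \<epsilon> :: real assume \<epsilon>: "\<epsilon> > 0"
    obtain N where N: "1 / real (Suc N) < \<epsilon> / (2 * (norm f + 1))"
      using \<epsilon> nat_approx_posE[of "\<epsilon> / (2 * (norm f + 1))"] by (auto simp: add_nonneg_pos)
    show "\<exists>M. \<forall>m\<ge>M. \<forall>n\<ge>M. norm (poly_op R (P m) f - poly_op R (P n) f) < \<epsilon>"
    proof (intro exI[of _ N] allI impI)
      fix m n assume mn: "m \<ge> N" "n \<ge> N"
      have "norm (poly_op R (P m) f - poly_op R (P n) f) \<le> (1 / real (Suc m) + 1 / real (Suc n)) * norm f"
        by (rule diff) (use P in \<open>force intro: less_imp_le\<close>)
      also have "\<dots> \<le> (1 / real (Suc N) + 1 / real (Suc N)) * (norm f + 1)"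
        using mn by (intro mult_mono add_mono frac_le) auto
      also have "\<dots> = 2 * (norm f + 1) * (1 / real (Suc N))" by simp
      also have "\<dots> < 2 * (norm f + 1) * (\<epsilon> / (2 * (norm f + 1)))"
        by (intro mult_strict_left_mono N) (auto simp: add_nonneg_pos)
      also have "\<dots> = \<epsilon>" by (simp add: add_nonneg_eq_0_iff)
      finally show "norm (poly_op R (P m) f - poly_op R (P n) f) < \<epsilon>" .
    qed
  qed
  then have lim: "(\<lambda>n. poly_op R (P n) f) \<longlonglongrightarrow> op_fun R g f"
    unfolding op_fun_def P_def[symmetric] by (simp add: Cauchy_convergent_iff convergent_LIMSEQ_iff)
  have "(\<lambda>n. norm (poly_op R p f - poly_op R (P n) f)) \<longlonglongrightarrow> norm (poly_op R p f - op_fun R g f)"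
    by (intro tendsto_intros lim)
  moreover have "(\<lambda>n. (e + 1 / real (Suc n)) * norm f) \<longlonglongrightarrow> (e + 0) * norm f"
    by (intro tendsto_intros LIMSEQ_inverse_real_of_nat[unfolded inverse_eq_divide])
  ultimately show ?thesis
    using diff[OF p] by (auto intro!: LIMSEQ_le)
qed

lemma op_fun_eqI:
  assumes g: "continuous_on {0..1} g"
    and "\<And>e. e > 0 \<Longrightarrow> \<exists>p. (\<forall>x\<in>{0..1}. \<bar>poly p x - g x\<bar> \<le> e) \<and> norm (poly_op R p f - h) \<le> K * e"
  shows "op_fun R g f = h"
proof (rule ccontr)
  assume neq: "op_fun R g f \<noteq> h"
  define K' where "K' = norm f + \<bar>K\<bar> + 1"
  have K': "K' > 0" by (simp add: K'_def add_nonneg_pos)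
  define e where "e = norm (op_fun R g f - h) / (2 * K')"
  have e: "e > 0" using neq K' by (simp add: e_def)
  obtain p where p: "\<forall>x\<in>{0..1}. \<bar>poly p x - g x\<bar> \<le> e" "norm (poly_op R p f - h) \<le> K * e"
    using assms(2)[OF e] by blast
  have "norm (op_fun R g f - h) \<le> norm (poly_op R p f - op_fun R g f) + norm (poly_op R p f - h)"
    by (metis norm_minus_commute norm_triangle_sub add.commute diff_add_cancel norm_diff_triangle_ineq norm_triangle_le_diff norm_diff_triangle_le order_refl)
  also have "\<dots> \<le> e * norm f + K * e" using op_fun_approx[OF g, of p e f] p by auto
  also have "\<dots> \<le> e * K'"
  proof -
    have "K * e \<le> \<bar>K\<bar> * e" using e by (intro mult_right_mono) auto
    moreover have "e * K' = e * norm f + \<bar>K\<bar> * e + e" by (simp add: K'_def algebra_simps)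
    ultimately show ?thesis using e by linarith
  qed
  also have "\<dots> < 2 * K' * e" using e K' by simp
  also have "\<dots> = norm (op_fun R g f - h)" using K' by (simp add: e_def)
  finally show False by simp
qed

lemma op_fun_poly: "op_fun R (poly p) f = poly_op R p f"
  by (rule op_fun_eqI[where K = 0]) (auto intro!: continuous_intros exI[of _ p])

lemma op_fun_seq:
  assumes g: "continuous_on {0..1} g"
  obtains p where "\<And>f. (\<lambda>n. poly_op R (p n) f) \<longlonglongrightarrow> op_fun R g f"
    "\<And>n x. x \<in> {0..1} \<Longrightarrow> \<bar>poly (p n) x - g x\<bar> \<le> 1 / real (Suc n)"
proof -
  have "\<exists>p. \<forall>x\<in>{0..1}. \<bar>poly p x - g x\<bar> < 1 / real (Suc n)" for n
    by (rule poly_approx_on_unit[OF g]) simp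
  then obtain p where p: "\<And>n x. x \<in> {0..1} \<Longrightarrow> \<bar>poly (p n) x - g x\<bar> < 1 / real (Suc n)" by metis
  show thesis
  proof (rule that[of p])
    fix f :: 'h
    have "(\<lambda>n. 1 / real (Suc n) * norm f) \<longlonglongrightarrow> 0 * norm f"
      by (intro tendsto_intros LIMSEQ_inverse_real_of_nat[unfolded inverse_eq_divide])
    then have lim: "(\<lambda>n. 1 / real (Suc n) * norm f) \<longlonglongrightarrow> 0" by (simp only: mult_zero_left)
    have "(\<lambda>n. poly_op R (p n) f - op_fun R g f) \<longlonglongrightarrow> 0"
      by (rule Lim_null_comparison[OF _ lim], rule always_eventually, rule allI, rule op_fun_approx[OF g])
         (use p in \<open>auto intro: less_imp_le\<close>)
    then show "(\<lambda>n. poly_op R (p n) f) \<longlonglongrightarrow> op_fun R g f" by (simp add: LIM_zero_iff)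
  qed (use p in \<open>auto intro: less_imp_le\<close>)
qed

lemma op_fun_linear:
  assumes "continuous_on {0..1} g"
  shows "linear (op_fun R g)"
proof -
  obtain p where p: "\<And>f. (\<lambda>n. poly_op R (p n) f) \<longlonglongrightarrow> op_fun R g f"
    using op_fun_seq[OF assms] by metis
  show ?thesis
  proof (rule linearI)
    fix f h and a :: real
    have "(\<lambda>n. poly_op R (p n) (f + h)) \<longlonglongrightarrow> op_fun R g f + op_fun R g h"
      by (simp add: linear_add[OF poly_op_linear[OF lin]]) (intro tendsto_intros p)
    then show "op_fun R g (f + h) = op_fun R g f + op_fun R g h" using p LIMSEQ_unique by blast
    have "(\<lambda>n. poly_op R (p n) (a *\<^sub>R f)) \<longlonglongrightarrow> a *\<^sub>R op_fun R g f"
      by (simp add: linear_scale[OF poly_op_linear[OF lin]]) (intro tendsto_intros p)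
    then show "op_fun R g (a *\<^sub>R f) = a *\<^sub>R op_fun R g f" using p LIMSEQ_unique by blast
  qed
qed

lemma op_fun_sym:
  assumes "continuous_on {0..1} g"
  shows "op_fun R g f \<bullet> h = f \<bullet> op_fun R g h"
proof -
  obtain p where p: "\<And>f. (\<lambda>n. poly_op R (p n) f) \<longlonglongrightarrow> op_fun R g f"
    using op_fun_seq[OF assms] by metis
  have "(\<lambda>n. poly_op R (p n) f \<bullet> h) \<longlonglongrightarrow> op_fun R g f \<bullet> h" by (intro tendsto_intros p)
  moreover have "(\<lambda>n. poly_op R (p n) f \<bullet> h) \<longlonglongrightarrow> f \<bullet> op_fun R g h"
    unfolding poly_op_sym by (intro tendsto_intros p)
  ultimately show ?thesis by (rule LIMSEQ_unique)
qed

lemma op_fun_nonneg: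
  assumes g: "continuous_on {0..1} g" and nn: "\<And>x. x \<in> {0..1} \<Longrightarrow> 0 \<le> g x"
  shows "0 \<le> op_fun R g f \<bullet> f"
proof -
  obtain p where p: "\<And>f. (\<lambda>n. poly_op R (p n) f) \<longlonglongrightarrow> op_fun R g f"
    "\<And>n x. x \<in> {0..1} \<Longrightarrow> \<bar>poly (p n) x - g x\<bar> \<le> 1 / real (Suc n)"
    using op_fun_seq[OF g] by metis
  have "0 \<le> poly_op R (p n + [:1 / real (Suc n):]) f \<bullet> f" for n
  proof (rule poly_op_nonneg)
    fix x :: real assume "0 \<le> x" "x \<le> 1"
    then show "0 \<le> poly (p n + [:1 / real (Suc n):]) x" using p(2)[of x n] nn[of x] by simp
  qed
  then have "0 \<le> poly_op R (p n) f \<bullet> f + 1 / real (Suc n) * (f \<bullet> f)" for n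
    using lin by (simp add: poly_op_add inner_add_left)
  moreover have "(\<lambda>n. poly_op R (p n) f \<bullet> f + 1 / real (Suc n) * (f \<bullet> f)) \<longlonglongrightarrow> op_fun R g f \<bullet> f + 0 * (f \<bullet> f)"
    by (intro tendsto_intros p LIMSEQ_inverse_real_of_nat[unfolded inverse_eq_divide])
  ultimately have "0 \<le> op_fun R g f \<bullet> f + 0 * (f \<bullet> f)"
    by (intro LIMSEQ_le_const) auto
  then show ?thesis by simp
qed

lemma op_fun_norm_le:
  assumes g: "continuous_on {0..1} g" and M: "\<And>x. x \<in> {0..1} \<Longrightarrow> \<bar>g x\<bar> \<le> M"
  shows "norm (op_fun R g f) \<le> M * norm f"
proof -
  obtain p where p: "\<And>f. (\<lambda>n. poly_op R (p n) f) \<longlonglongrightarrow> op_fun R g f"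
    "\<And>n x. x \<in> {0..1} \<Longrightarrow> \<bar>poly (p n) x - g x\<bar> \<le> 1 / real (Suc n)"
    using op_fun_seq[OF g] by metis
  have "norm (poly_op R (p n) f) \<le> (M + 1 / real (Suc n)) * norm f" for n
  proof (rule poly_op_norm_le)
    fix x :: real assume "0 \<le> x" "x \<le> 1"
    then show "\<bar>poly (p n) x\<bar> \<le> M + 1 / real (Suc n)" using p(2)[of x n] M[of x] by simp
  qed
  moreover have "(\<lambda>n. (M + 1 / real (Suc n)) * norm f) \<longlonglongrightarrow> (M + 0) * norm f"
    by (intro tendsto_intros LIMSEQ_inverse_real_of_nat[unfolded inverse_eq_divide])
  moreover have "(\<lambda>n. norm (poly_op R (p n) f)) \<longlonglongrightarrow> norm (op_fun R g f)" by (intro tendsto_intros p)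
  ultimately show ?thesis by (auto intro!: LIMSEQ_le)
qed

lemma op_fun_cong:
  assumes "\<And>x. x \<in> {0..1} \<Longrightarrow> g x = k x"
  shows "op_fun R g f = op_fun R k f"
proof -
  have "(\<forall>x\<in>{0..1}. \<bar>poly p x - g x\<bar> < d) = (\<forall>x\<in>{0..1}. \<bar>poly p x - k x\<bar> < d)" for p and d :: real
    using assms by auto
  then show ?thesis by (simp add: op_fun_def)
qed

lemma op_fun_add:
  assumes "continuous_on {0..1} g" "continuous_on {0..1} k"
  shows "op_fun R (\<lambda>x. g x + k x) f = op_fun R g f + op_fun R k f"
proof (rule op_fun_eqI[where K = "norm f"])
  fix e :: real assume e: "e > 0"
  obtain p q where pq: "\<forall>x\<in>{0..1}. \<bar>poly p x - g x\<bar> < e / 2" "\<forall>x\<in>{0..1}. \<bar>poly q x - k x\<bar> < e / 2"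
    using poly_approx_on_unit[OF assms(1), of "e/2"] poly_approx_on_unit[OF assms(2), of "e/2"] e by auto
  have "\<bar>poly (p + q) x - (g x + k x)\<bar> \<le> e" if "x \<in> {0..1}" for x
  proof -
    have "\<bar>poly p x - g x\<bar> < e / 2" "\<bar>poly q x - k x\<bar> < e / 2" using pq that by auto
    then show ?thesis unfolding poly_add abs_le_iff abs_less_iff by linarith
  qed
  moreover have "norm (poly_op R (p + q) f - (op_fun R g f + op_fun R k f)) \<le> norm f * e"
  proof -
    have "norm (poly_op R (p + q) f - (op_fun R g f + op_fun R k f))
       \<le> norm (poly_op R p f - op_fun R g f) + norm (poly_op R q f - op_fun R k f)"
      unfolding poly_op_add[OF lin] by (rule norm_diff_triangle_ineq)
    also have "\<dots> \<le> e / 2 * norm f + e / 2 * norm f"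
      using pq by (intro add_mono op_fun_approx assms) (auto intro: less_imp_le)
    finally show ?thesis by (simp add: algebra_simps)
  qed
  ultimately show "\<exists>p. (\<forall>x\<in>{0..1}. \<bar>poly p x - (g x + k x)\<bar> \<le> e) \<and> norm (poly_op R p f - (op_fun R g f + op_fun R k f)) \<le> norm f * e"
    by blast
qed (intro continuous_intros assms)

text \<open>The products p_n q_n approximate g k uniformly, and p_n(R) has norm at most G + 1 for
  every n, so q_n(R) f may be replaced by its limit inside p_n(R).\<close>

lemma op_fun_mult:
  assumes g: "continuous_on {0..1} g" and k: "continuous_on {0..1} k"
  shows "op_fun R (\<lambda>x. g x * k x) f = op_fun R g (op_fun R k f)"
proof -
  obtain p q where
    p: "\<And>f. (\<lambda>n. poly_op R (p n) f) \<longlonglongrightarrow> op_fun R g f"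
       "\<And>n x. x \<in> {0..1} \<Longrightarrow> \<bar>poly (p n) x - g x\<bar> \<le> 1 / real (Suc n)" and
    q: "\<And>f. (\<lambda>n. poly_op R (q n) f) \<longlonglongrightarrow> op_fun R k f"
       "\<And>n x. x \<in> {0..1} \<Longrightarrow> \<bar>poly (q n) x - k x\<bar> \<le> 1 / real (Suc n)"
    using op_fun_seq[OF g] op_fun_seq[OF k] by metis
  obtain G where G: "\<And>x. x \<in> {0..1} \<Longrightarrow> \<bar>g x\<bar> \<le> G"
    using continuous_on_unit_bounded[OF g] by metis
  obtain L where L: "\<And>x. x \<in> {0..1} \<Longrightarrow> \<bar>k x\<bar> \<le> L"
    using continuous_on_unit_bounded[OF k] by metis
  have gk: "continuous_on {0..1} (\<lambda>x. g x * k x)" by (intro continuous_intros assms)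
  have lim0: "(\<lambda>n. 1 / real (Suc n)) \<longlonglongrightarrow> 0" by (intro LIMSEQ_inverse_real_of_nat[unfolded inverse_eq_divide])
  define \<delta> where "\<delta> n = 1 / real (Suc n) * (L + 1 / real (Suc n)) + G * (1 / real (Suc n))" for n
  have \<delta>: "\<delta> \<longlonglongrightarrow> 0 * (L + 0) + G * 0" unfolding \<delta>_def by (intro tendsto_intros lim0)
  have "norm (poly_op R (p n * q n) f - op_fun R (\<lambda>x. g x * k x) f) \<le> \<delta> n * norm f" for n
  proof (rule op_fun_approx[OF gk])
    fix x :: real assume x: "x \<in> {0..1}"
    have "poly (p n * q n) x - g x * k x = (poly (p n) x - g x) * poly (q n) x + g x * (poly (q n) x - k x)"
      by (simp add: algebra_simps)
    also have "\<bar>\<dots>\<bar> \<le> \<bar>poly (p n) x - g x\<bar> * \<bar>poly (q n) x\<bar> + \<bar>g x\<bar> * \<bar>poly (q n) x - k x\<bar>"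
      by (metis abs_mult abs_triangle_ineq)
    also have "\<dots> \<le> \<delta> n"
      unfolding \<delta>_def using p(2)[OF x, of n] q(2)[OF x, of n] G[OF x] L[OF x]
      by (intro add_mono mult_mono) auto
    finally show "\<bar>poly (p n * q n) x - g x * k x\<bar> \<le> \<delta> n" .
  qed
  moreover have "(\<lambda>n. \<delta> n * norm f) \<longlonglongrightarrow> 0"
    using tendsto_mult_right[OF \<delta>, of "norm f"] by simp
  ultimately have "(\<lambda>n. poly_op R (p n * q n) f - op_fun R (\<lambda>x. g x * k x) f) \<longlonglongrightarrow> 0"
    by (auto intro!: Lim_null_comparison[where g = "\<lambda>n. \<delta> n * norm f"])
  then have 1: "(\<lambda>n. poly_op R (p n) (poly_op R (q n) f)) \<longlonglongrightarrow> op_fun R (\<lambda>x. g x * k x) f"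
    by (simp add: LIM_zero_iff poly_op_mult[OF lin])
  have "norm (poly_op R (p n) h) \<le> (G + 1) * norm h" for n h
  proof (rule poly_op_norm_le)
    fix x :: real assume x: "0 \<le> x" "x \<le> 1"
    have "1 / real (Suc n) \<le> 1" by simp
    moreover have "\<bar>poly (p n) x - g x\<bar> \<le> 1 / real (Suc n)" "\<bar>g x\<bar> \<le> G"
      using p(2)[of x n] G[of x] x by auto
    ultimately show "\<bar>poly (p n) x\<bar> \<le> G + 1" by linarith
  qed
  then have "norm (poly_op R (p n) (poly_op R (q n) f - op_fun R k f)) \<le> (G + 1) * norm (poly_op R (q n) f - op_fun R k f)" for n
    by blast
  moreover have "(\<lambda>n. (G + 1) * norm (poly_op R (q n) f - op_fun R k f)) \<longlonglongrightarrow> (G + 1) * norm (op_fun R k f - op_fun R k f)"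
    by (intro tendsto_intros q)
  ultimately have "(\<lambda>n. poly_op R (p n) (poly_op R (q n) f - op_fun R k f)) \<longlonglongrightarrow> 0"
    by (auto intro!: Lim_null_comparison[where g = "\<lambda>n. (G + 1) * norm (poly_op R (q n) f - op_fun R k f)"])
  from tendsto_add[OF this p(1)[of "op_fun R k f"]]
  have "(\<lambda>n. poly_op R (p n) (poly_op R (q n) f)) \<longlonglongrightarrow> op_fun R g (op_fun R k f)"
    by (simp add: linear_diff[OF poly_op_linear[OF lin]])
  with 1 show ?thesis by (rule LIMSEQ_unique)
qed

lemma op_fun_scale:
  assumes "continuous_on {0..1} g"
  shows "op_fun R (\<lambda>x. a * g x) f = a *\<^sub>R op_fun R g f"
  using op_fun_mult[of "poly [:a:]" g f] assms op_fun_poly[of "[:a:]"] lin by simp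

lemma op_fun_diff:
  assumes "continuous_on {0..1} g" "continuous_on {0..1} k"
  shows "op_fun R (\<lambda>x. g x - k x) f = op_fun R g f - op_fun R k f"
  using op_fun_add[of g "\<lambda>x. - 1 * k x" f] op_fun_scale[of k "-1" f] assms
  by (simp add: continuous_on_minus)

lemma op_fun_id: "op_fun R (\<lambda>x. x) f = R f"
  using op_fun_poly[of "[:0,1:]" f] lin by (simp add: cong: op_fun_cong)

lemma op_fun_one: "op_fun R (\<lambda>x. 1) f = f"
  using op_fun_poly[of 1 f] lin by (simp add: cong: op_fun_cong)

text \<open>Used with J multiplication by a complex number: this restores the complex linearity that
  the real calculus cannot see.\<close>

lemma op_fun_commute:
  assumes g: "continuous_on {0..1} g" and J: "bounded_linear J" "\<And>f. J (R f) = R (J f)"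
  shows "J (op_fun R g f) = op_fun R g (J f)"
proof -
  obtain p where p: "\<And>f. (\<lambda>n. poly_op R (p n) f) \<longlonglongrightarrow> op_fun R g f"
    using op_fun_seq[OF g] by metis
  have "(\<lambda>n. J (poly_op R (p n) f)) \<longlonglongrightarrow> J (op_fun R g f)"
    by (rule bounded_linear.tendsto[OF J(1) p])
  then have "(\<lambda>n. poly_op R (p n) (J f)) \<longlonglongrightarrow> J (op_fun R g f)"
    using poly_op_commute[OF lin bounded_linear.linear[OF J(1)] J(2)] by simp
  then show ?thesis using p LIMSEQ_unique by blast
qed

end

section \<open>Closed forms, square roots and normal operators on real Hilbert spaces\<close>

lemma quadratic_nonneg_imp_discriminant:
  fixes a b c :: real
  assumes "\<And>t. 0 \<le> c + 2 * t * b + t\<^sup>2 * a"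
  shows "b\<^sup>2 \<le> a * c"
proof (cases "a = 0")
  case True
  have "b = 0"
  proof (rule ccontr)
    assume "b \<noteq> 0"
    then show False using assms[of "- (c + 1) / (2 * b)"] True by (simp add: field_simps)
  qed
  then show ?thesis using True by simp
next
  case False
  have "a > 0"
  proof (rule ccontr)
    assume "\<not> a > 0"
    then have a: "a < 0" using False by simp
    define t where "t = 1 + (\<bar>c\<bar> + 2 * \<bar>b\<bar>) / - a"
    have t: "t \<ge> 1" "- a * t \<ge> - a + \<bar>c\<bar> + 2 * \<bar>b\<bar>" using a by (simp_all add: t_def field_simps)
    have "- a * t * t \<ge> (- a + \<bar>c\<bar> + 2 * \<bar>b\<bar>) * t" using t by (intro mult_right_mono) auto
    moreover have "(- a + \<bar>c\<bar>) * t \<ge> (- a + \<bar>c\<bar>) * 1" using t a by (intro mult_left_mono) auto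
    moreover have "\<bar>b\<bar> * t \<ge> b * t" using t by (intro mult_right_mono) auto
    ultimately have "c + 2 * t * b + t\<^sup>2 * a < 0"
      using a by (simp add: algebra_simps power2_eq_square)
    then show False using assms[of t] by simp
  qed
  then show ?thesis using assms[of "- b / a"] by (simp add: field_simps power2_eq_square)
qed

lemma tendsto_of_square_bound:
  fixes x d :: "nat \<Rightarrow> real"
  assumes "\<And>n. (x n - l)\<^sup>2 \<le> d n" "d \<longlonglongrightarrow> 0"
  shows "x \<longlonglongrightarrow> l"
proof -
  have "(\<lambda>n. (x n - l)\<^sup>2) \<longlonglongrightarrow> 0"
    by (rule tendsto_sandwich[OF _ _ tendsto_const assms(2)]) (use assms(1) in auto)
  then show ?thesis by (simp add: LIM_zero_iff)
qed

text \<open>Minimise J u = q u u + |u|^2 - 2 <f, u>. A minimising sequence is Cauchy in the form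
  norm by the parallelogram law, closedness supplies its limit, and the limit solves the
  Euler-Lagrange equation. With q = 0 on a closed subspace the statement becomes orthogonal
  projection.\<close>

lemma closed_form_riesz:
  fixes D :: "'h::real_inner set" and q :: "'h \<Rightarrow> 'h \<Rightarrow> real"
  assumes D: "subspace D"
    and q_add: "\<And>u v w. u \<in> D \<Longrightarrow> v \<in> D \<Longrightarrow> w \<in> D \<Longrightarrow> q (u + v) w = q u w + q v w"
    and q_scale: "\<And>a u v. u \<in> D \<Longrightarrow> v \<in> D \<Longrightarrow> q (a *\<^sub>R u) v = a * q u v"
    and q_sym: "\<And>u v. u \<in> D \<Longrightarrow> v \<in> D \<Longrightarrow> q u v = q v u"
    and q_nonneg: "\<And>u. u \<in> D \<Longrightarrow> 0 \<le> q u u"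
    and closed: "\<And>u :: nat \<Rightarrow> 'h. (\<And>n. u n \<in> D) \<Longrightarrow>
      (\<And>e. e > 0 \<Longrightarrow> \<exists>N. \<forall>n\<ge>N. \<forall>k\<ge>N. q (u n - u k) (u n - u k) + (norm (u n - u k))\<^sup>2 < e) \<Longrightarrow>
      \<exists>v\<in>D. (\<lambda>n. q (u n - v) (u n - v) + (norm (u n - v))\<^sup>2) \<longlonglongrightarrow> 0"
  shows "\<exists>u\<in>D. \<forall>v\<in>D. q u v + u \<bullet> v = f \<bullet> v"
proof -
  define p where "p u v = q u v + u \<bullet> v" for u v
  have DI: "0 \<in> D" "\<And>u v. u \<in> D \<Longrightarrow> v \<in> D \<Longrightarrow> u + v \<in> D" "\<And>a u. u \<in> D \<Longrightarrow> a *\<^sub>R u \<in> D"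
    "\<And>u v. u \<in> D \<Longrightarrow> v \<in> D \<Longrightarrow> u - v \<in> D"
    using D by (auto simp: subspace_0 subspace_add subspace_scale subspace_diff)
  have p_add: "p (u + v) w = p u w + p v w" if "u \<in> D" "v \<in> D" "w \<in> D" for u v w
    using q_add[OF that] by (simp add: p_def inner_add_left)
  have p_scale: "p (a *\<^sub>R u) v = a * p u v" if "u \<in> D" "v \<in> D" for a u v
    using q_scale[OF that] by (simp add: p_def algebra_simps)
  have p_sym: "p u v = p v u" if "u \<in> D" "v \<in> D" for u v
    using q_sym[OF that] by (simp add: p_def inner_commute)
  have p_nonneg: "0 \<le> p u u" if "u \<in> D" for u using q_nonneg[OF that] by (simp add: p_def)
  have p_diff: "p (u - v) w = p u w - p v w" if "u \<in> D" "v \<in> D" "w \<in> D" for u v w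
    using p_add[of u "-1 *\<^sub>R v" w] p_scale[of v w "-1"] that DI(3)[of v "-1"] by simp
  have p_exp: "p (u + t *\<^sub>R w) (u + t *\<^sub>R w) = p u u + 2 * t * p u w + t\<^sup>2 * p w w" if "u \<in> D" "w \<in> D" for u w t
    using that DI p_sym[of u "u + t *\<^sub>R w"] p_sym[of w "u + t *\<^sub>R w"] p_sym[of u w]
    by (simp add: p_add p_scale power2_eq_square algebra_simps)
  have p_cs: "(p u w)\<^sup>2 \<le> p w w * p u u" if "u \<in> D" "w \<in> D" for u w
    using that p_nonneg DI by (intro quadratic_nonneg_imp_discriminant) (simp add: p_exp[symmetric])
  define J where "J u = p u u - 2 * (f \<bullet> u)" for u
  define I where "I = (INF u\<in>D. J u)"
  have J_ge: "J u \<ge> - (f \<bullet> f)" if "u \<in> D" for u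
  proof -
    have "0 \<le> (u - f) \<bullet> (u - f)" by simp
    then show ?thesis using q_nonneg[OF that] by (simp add: J_def p_def algebra_simps inner_commute)
  qed
  then have bdd: "bdd_below (J ` D)" by (auto intro!: bdd_belowI2)
  have I_le: "I \<le> J u" if "u \<in> D" for u unfolding I_def using bdd that by (rule cINF_lower)
  have "\<exists>u\<in>D. J u < I + 1 / real (Suc n)" for n
    using cInf_lessD[of "J ` D" "I + 1 / real (Suc n)"] DI(1) unfolding I_def by auto
  then obtain u where u: "\<And>n. u n \<in> D" "\<And>n. J (u n) < I + 1 / real (Suc n)" by metis
  \<comment> \<open>Parallelogram law at the midpoint \<open>w\<close>: the linear terms cancel in 2
    J(u_n) + 2 J(u_k) - 4 J(w), and J(w) is at least the infimum.\<close>
  have pd: "p (u n - u k) (u n - u k) \<le> 2 * (1 / real (Suc n)) + 2 * (1 / real (Suc k))" for n k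
  proof -
    define w where "w = (1/2) *\<^sub>R (u n + u k)"
    have uu: "p (u n + u k) (u n + u k) = p (u n) (u n) + 2 * p (u n) (u k) + p (u k) (u k)"
      using p_exp[of "u n" "u k" 1] u by simp
    have ud: "p (u n - u k) (u n - u k) = p (u n) (u n) - 2 * p (u n) (u k) + p (u k) (u k)"
      using p_exp[of "u n" "u k" "-1"] u by simp
    have s: "u n + u k \<in> D" "w \<in> D" using u DI by (auto simp: w_def)
    have "p w w = (1/4) * p (u n + u k) (u n + u k)"
    proof -
      have "p w w = (1/2) * p (u n + u k) w" unfolding w_def using s by (intro p_scale) (auto simp: w_def)
      also have "p (u n + u k) w = p w (u n + u k)" using s by (rule p_sym)
      also have "\<dots> = (1/2) * p (u n + u k) (u n + u k)" unfolding w_def using s by (intro p_scale)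
      finally show ?thesis by simp
    qed
    then have "J w = (1/4) * (p (u n) (u n) + 2 * p (u n) (u k) + p (u k) (u k)) - (f \<bullet> u n + f \<bullet> u k)"
      unfolding J_def uu by (simp add: w_def inner_add_right field_simps)
    then have "p (u n - u k) (u n - u k) = 2 * J (u n) + 2 * J (u k) - 4 * J w"
      unfolding ud J_def[of "u n"] J_def[of "u k"] by (simp add: algebra_simps)
    then show ?thesis using u(2)[of n] u(2)[of k] I_le[OF s(2)] by linarith
  qed
  have p_eq: "q v v + (norm v)\<^sup>2 = p v v" for v by (simp add: p_def power2_norm_eq_inner)
  obtain v where v: "v \<in> D" "(\<lambda>n. p (u n - v) (u n - v)) \<longlonglongrightarrow> 0"
  proof -
    have "\<exists>v\<in>D. (\<lambda>n. q (u n - v) (u n - v) + (norm (u n - v))\<^sup>2) \<longlonglongrightarrow> 0"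
    proof (rule closed)
      fix e :: real assume "e > 0"
      then obtain N where N: "1 / real (Suc N) < e / 4" using nat_approx_posE[of "e / 4"] by auto
      show "\<exists>N. \<forall>n\<ge>N. \<forall>k\<ge>N. q (u n - u k) (u n - u k) + (norm (u n - u k))\<^sup>2 < e"
      proof (intro exI[of _ N] allI impI)
        fix n k assume "n \<ge> N" "k \<ge> N"
        then have "1 / real (Suc n) \<le> 1 / real (Suc N)" "1 / real (Suc k) \<le> 1 / real (Suc N)"
          by (auto intro!: divide_left_mono)
        then show "q (u n - u k) (u n - u k) + (norm (u n - u k))\<^sup>2 < e"
          unfolding p_eq using pd[of n k] N by linarith
      qed
    qed (rule u)
    then show ?thesis using that unfolding p_eq by blast
  qed
  have "p v w = f \<bullet> w" if w: "w \<in> D" for w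
  proof -
    \<comment> \<open>Moving u_n along \<open>w\<close> lowers J by less than 1 / (n + 1), so a
      quadratic in t is nonnegative; its discriminant bounds the defect in the Euler-Lagrange
      equation.\<close>
    have "(p (u n) w - f \<bullet> w)\<^sup>2 \<le> p w w * (1 / real (Suc n))" for n
    proof (rule quadratic_nonneg_imp_discriminant)
      fix t
      have "I \<le> J (u n + t *\<^sub>R w)" using u w DI by (intro I_le) auto
      also have "\<dots> = J (u n) + 2 * t * (p (u n) w - f \<bullet> w) + t\<^sup>2 * p w w"
        unfolding J_def p_exp[OF u(1) w] by (simp add: algebra_simps)
      finally show "0 \<le> 1 / real (Suc n) + 2 * t * (p (u n) w - f \<bullet> w) + t\<^sup>2 * p w w"
        using u(2)[of n] by linarith
    qed
    moreover have "(\<lambda>n. p w w * (1 / real (Suc n))) \<longlonglongrightarrow> p w w * 0"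
      by (intro tendsto_intros LIMSEQ_inverse_real_of_nat[unfolded inverse_eq_divide])
    ultimately have 1: "(\<lambda>n. p (u n) w) \<longlonglongrightarrow> f \<bullet> w"
      unfolding mult_zero_right by (rule tendsto_of_square_bound)
    have "(p (u n) w - p v w)\<^sup>2 \<le> p w w * p (u n - v) (u n - v)" for n
      using p_cs[of "u n - v" w] p_diff[of "u n" v w] u v w DI by simp
    moreover have "(\<lambda>n. p w w * p (u n - v) (u n - v)) \<longlonglongrightarrow> p w w * 0"
      by (intro tendsto_intros v)
    ultimately have "(\<lambda>n. p (u n) w) \<longlonglongrightarrow> p v w"
      unfolding mult_zero_right by (rule tendsto_of_square_bound)
    with 1 show ?thesis using LIMSEQ_unique by blast
  qed
  then show ?thesis using v(1) unfolding p_def by blast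
qed

text \<open>If u is the projection of f onto the closure of the range, then f - u is orthogonal to
  the range, and symmetry gives R (f - u) = 0. Serves the continuity of the heat flow at time
  0.\<close>

lemma injective_symmetric_dense_range:
  fixes R :: "'h::{real_inner,complete_space} \<Rightarrow> 'h"
  assumes R: "linear R" "\<And>f g. R f \<bullet> g = f \<bullet> R g" "\<And>f. R f = 0 \<Longrightarrow> f = 0"
  shows "closure (range R) = UNIV"
proof -
  have "f \<in> closure (range R)" for f
  proof -
    let ?C = "closure (range R)"
    have sub: "subspace ?C"
    proof (rule subspaceI)
      show "0 \<in> ?C" using closure_subset linear_0[OF R(1)] by (metis rangeI subsetD)
      show "x + y \<in> ?C" if xy: "x \<in> ?C" "y \<in> ?C" for x y
      proof -
        obtain u where u: "\<forall>n. u n \<in> range R" "u \<longlonglongrightarrow> x"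
          using xy(1) unfolding closure_sequential by blast
        obtain v where v: "\<forall>n. v n \<in> range R" "v \<longlonglongrightarrow> y"
          using xy(2) unfolding closure_sequential by blast
        have "u n + v n \<in> range R" for n
          using u(1) v(1) by (intro subspace_add[OF linear_subspace_image[OF R(1) subspace_UNIV]]) auto
        then show ?thesis
          unfolding closure_sequential using tendsto_add[OF u(2) v(2)]
          by (intro exI[of _ "\<lambda>n. u n + v n"] conjI allI)
      qed
      show "a *\<^sub>R x \<in> ?C" if x: "x \<in> ?C" for a x
      proof -
        obtain u where u: "\<forall>n. u n \<in> range R" "u \<longlonglongrightarrow> x"
          using x unfolding closure_sequential by blast
        have "a *\<^sub>R u n \<in> range R" for n
          using u(1) by (intro subspace_scale[OF linear_subspace_image[OF R(1) subspace_UNIV]]) auto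
        then show ?thesis
          unfolding closure_sequential using tendsto_scaleR[OF tendsto_const u(2), of a]
          by (intro exI[of _ "\<lambda>n. a *\<^sub>R u n"] conjI allI)
      qed
    qed
    have "\<exists>u\<in>?C. \<forall>v\<in>?C. 0 + u \<bullet> v = f \<bullet> v"
    proof (rule closed_form_riesz[OF sub, where q = "\<lambda>_ _. 0"])
      fix u :: "nat \<Rightarrow> 'h"
      assume u: "\<And>n. u n \<in> ?C"
        and cau: "\<And>e. e > 0 \<Longrightarrow> \<exists>N. \<forall>n\<ge>N. \<forall>k\<ge>N. 0 + (norm (u n - u k))\<^sup>2 < e"
      have "Cauchy u"
      proof (rule CauchyI)
        fix e :: real assume "e > 0"
        then obtain N where "\<forall>n\<ge>N. \<forall>k\<ge>N. (norm (u n - u k))\<^sup>2 < e\<^sup>2" using cau[of "e\<^sup>2"] by auto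
        then show "\<exists>M. \<forall>m\<ge>M. \<forall>n\<ge>M. norm (u m - u n) < e"
          using \<open>e > 0\<close> by (metis power_less_imp_less_base less_imp_le)
      qed
      then obtain v where v: "u \<longlonglongrightarrow> v" by (auto simp: Cauchy_convergent_iff convergent_def)
      then have "v \<in> ?C" using closed_sequentially[of ?C u v] u by blast
      moreover have "(\<lambda>n. 0 + (norm (u n - v))\<^sup>2) \<longlonglongrightarrow> 0 + (norm (v - v))\<^sup>2" by (intro tendsto_intros v)
      ultimately show "\<exists>v\<in>?C. (\<lambda>n. 0 + (norm (u n - v))\<^sup>2) \<longlonglongrightarrow> 0" by auto
    qed auto
    then obtain u where u: "u \<in> ?C" "\<And>v. v \<in> ?C \<Longrightarrow> u \<bullet> v = f \<bullet> v" by auto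
    have "R (f - u) \<bullet> g = 0" for g
    proof -
      have "R g \<in> ?C" using closure_subset[of "range R"] by (rule subsetD) simp
      then show ?thesis using u(2)[of "R g"] by (simp add: R(2) inner_diff_left)
    qed
    then have "R (f - u) = 0" using inner_eq_zero_iff by blast
    then have "f = u" using R(3)[of "f - u"] by simp
    then show ?thesis using u by simp
  qed
  then show ?thesis by auto
qed

text \<open>If \<open>p\<close> approximates \<open>sqrt\<close> uniformly on \<open>[0,1]\<close>, then \<open>p(S\<^sup>2) = p(T\<^sup>2)\<close> is close to both \<open>S\<close> and \<open>T\<close>.\<close>

lemma nonneg_sqrt_unique:
  fixes S T :: "'h::{real_inner,complete_space} \<Rightarrow> 'h"
  assumes S: "bounded_linear S" "\<And>f g. S f \<bullet> g = f \<bullet> S g" "\<And>f. 0 \<le> S f \<bullet> f"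
    and T: "bounded_linear T" "\<And>f g. T f \<bullet> g = f \<bullet> T g" "\<And>f. 0 \<le> T f \<bullet> f"
    and eq: "\<And>f. S (S f) = T (T f)"
  shows "S = T"
proof -
  obtain K1 where K1: "\<And>f. norm (S f) \<le> norm f * K1" using bounded_linear.bounded[OF S(1)] by blast
  obtain K2 where K2: "\<And>f. norm (T f) \<le> norm f * K2" using bounded_linear.bounded[OF T(1)] by blast
  \<comment> \<open>One common bound scales both operators into the unit interval and keeps their
    squares equal.\<close>
  define K where "K = max 1 (max K1 K2)"
  have K: "K > 0" "norm (S f) \<le> K * norm f" "norm (T f) \<le> K * norm f" for f
    using order_trans[OF K1[of f] mult_left_mono[of K1 K "norm f"]]
      order_trans[OF K2[of f] mult_left_mono[of K2 K "norm f"]] by (auto simp: K_def mult.commute)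
  have scaled: "unit_selfadjoint (\<lambda>f. (1 / K) *\<^sub>R A f)"
    if A: "bounded_linear A" "\<And>f g. A f \<bullet> g = f \<bullet> A g" "\<And>f. 0 \<le> A f \<bullet> f" "\<And>f. norm (A f) \<le> K * norm f"
    for A :: "'h \<Rightarrow> 'h"
  proof (rule unit_selfadjoint.intro)
    show "linear (\<lambda>f. (1 / K) *\<^sub>R A f)"
      by (rule bounded_linear.linear[OF bounded_linear_compose[OF bounded_linear_scaleR_right A(1)]])
    fix f
    have "A f \<bullet> f \<le> norm (A f) * norm f" by (rule norm_cauchy_schwarz)
    also have "\<dots> \<le> K * norm f * norm f" by (intro mult_right_mono A) auto
    finally have "A f \<bullet> f \<le> K * (f \<bullet> f)" by (simp add: mult.assoc power2_norm_eq_inner flip: power2_eq_square)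
    then show "((1 / K) *\<^sub>R A f) \<bullet> f \<le> f \<bullet> f" using K(1) by (simp add: field_simps)
  qed (use A K(1) in simp_all)
  define S' where "S' = (\<lambda>f. (1 / K) *\<^sub>R S f)"
  define T' where "T' = (\<lambda>f. (1 / K) *\<^sub>R T f)"
  interpret S': unit_selfadjoint S' unfolding S'_def by (rule scaled) (use S K in auto)
  interpret T': unit_selfadjoint T' unfolding T'_def by (rule scaled) (use T K in auto)
  have sq: "(\<lambda>f. S' (S' f)) = (\<lambda>f. T' (T' f))"
    unfolding S'_def T'_def using eq
    by (simp add: linear_scale[OF bounded_linear.linear[OF S(1)]] linear_scale[OF bounded_linear.linear[OF T(1)]])
  have "S' f = T' f" for f
  proof (rule ccontr)
    assume ne: "S' f \<noteq> T' f"
    define e where "e = norm (S' f - T' f) / (4 * (norm f + 1))"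
    have e: "e > 0" using ne by (simp add: e_def add_nonneg_pos)
    obtain p where p: "\<forall>x\<in>{0..1}. \<bar>poly p x - sqrt x\<bar> < e"
      using poly_approx_on_unit[OF continuous_on_real_sqrt[OF continuous_on_id] e] by blast
    let ?p = "pcompose p [:0, 0, 1:]"
    have b: "\<bar>poly (?p - [:0, 1:]) x\<bar> \<le> e" if "0 \<le> x" "x \<le> 1" for x
      using bspec[OF p, of "x * x"] that by (simp add: poly_pcompose mult_le_one real_sqrt_mult_self abs_of_nonneg less_imp_le)
    have "norm (poly_op S' ?p f - S' f) \<le> e * norm f"
      using S'.poly_op_norm_le[OF b, of f] by (simp add: poly_op_diff[OF S'.lin] S'.lin)
    moreover have "norm (poly_op T' ?p f - T' f) \<le> e * norm f"
      using T'.poly_op_norm_le[OF b, of f] by (simp add: poly_op_diff[OF T'.lin] T'.lin)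
    moreover have "poly_op S' ?p f = poly_op T' ?p f"
      using sq by (simp add: poly_op_square[OF S'.lin] poly_op_square[OF T'.lin])
    ultimately have "norm (S' f - T' f) \<le> 2 * e * norm f"
      using norm_triangle_ineq4[of "poly_op T' ?p f - T' f" "poly_op T' ?p f - S' f"] by simp
    also have "\<dots> < 4 * e * (norm f + 1)" using e by (simp add: distrib_left add_nonneg_pos)
    also have "\<dots> = norm (S' f - T' f)"
      using add_nonneg_pos[of "norm f" 1] by (simp add: e_def del: distrib_left_numeral)
    finally show False by simp
  qed
  then show ?thesis using K(1) by (auto simp: S'_def T'_def)
qed

text \<open>\<open>T T\<^sup>*\<close> is bounded below by \<open>c\<^sup>2\<close>, so \<open>f \<mapsto> f - \<epsilon> T T\<^sup>* f\<close> is a contraction for small \<open>\<epsilon>\<close>.\<close>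

lemma normal_bounded_below_surj:
  fixes T A :: "'h::{real_inner,complete_space} \<Rightarrow> 'h"
  assumes T: "bounded_linear T" and A: "bounded_linear A"
    and adj: "\<And>f g. T f \<bullet> g = f \<bullet> A g" and comm: "\<And>f. T (A f) = A (T f)"
    and c: "c > 0" "\<And>f. c * norm f \<le> norm (T f)"
  shows "surj T"
proof -
  have TA: "bounded_linear (\<lambda>f. T (A f))" by (rule bounded_linear_compose[OF T A])
  then interpret TA: bounded_linear "\<lambda>f. T (A f)" .
  obtain K where K: "K > 0" "\<And>f. norm (T (A f)) \<le> norm f * K" using TA.pos_bounded by blast
  \<comment> \<open>Normality transfers the lower bound from T to its adjoint, hence to the
    quadratic form of T A.\<close>
  have nA: "norm (A f) = norm (T f)" for f
  proof -
    have "A f \<bullet> A f = T f \<bullet> T f" using adj[of "A f" f] adj[of f "T f"] comm[of f] by (simp add: inner_commute)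
    then show ?thesis by (simp add: norm_eq_sqrt_inner)
  qed
  have ge: "c\<^sup>2 * (norm f)\<^sup>2 \<le> T (A f) \<bullet> f" for f
  proof -
    have "T (A f) \<bullet> f = (norm (A f))\<^sup>2" using adj[of "A f" f] by (simp add: power2_norm_eq_inner)
    moreover have "(c * norm f)\<^sup>2 \<le> (norm (T f))\<^sup>2" using c by (intro power_mono) auto
    ultimately show ?thesis using nA[of f] by (simp add: power_mult_distrib)
  qed
  \<comment> \<open>This choice makes \<epsilon>^2 K^2 = \<epsilon> c^2: the quadratic term of |f -
    \<epsilon> T A f|^2 uses up at most half of the linear gain, which leaves the factor 1 - c^2
    \<epsilon>.\<close>
  define \<epsilon> where "\<epsilon> = c\<^sup>2 / K\<^sup>2"
  have \<epsilon>: "\<epsilon> > 0" using c K by (simp add: \<epsilon>_def)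
  \<comment> \<open>The maximum with 0 keeps the square root meaningful without comparing c^2 with
    K.\<close>
  define r where "r = max 0 (1 - c\<^sup>2 * \<epsilon>)"
  have r: "0 \<le> sqrt r" "sqrt r < 1" using c \<epsilon> by (auto simp: r_def)
  have contr: "norm (f - \<epsilon> *\<^sub>R T (A f)) \<le> sqrt r * norm f" for f
  proof -
    have "(norm (T (A f)))\<^sup>2 \<le> (norm f * K)\<^sup>2" by (intro power_mono K) auto
    then have "\<epsilon>\<^sup>2 * (norm (T (A f)))\<^sup>2 \<le> \<epsilon>\<^sup>2 * (norm f * K)\<^sup>2" by (intro mult_left_mono) auto
    also have "\<dots> = \<epsilon> * c\<^sup>2 * (norm f)\<^sup>2" using K by (simp add: \<epsilon>_def power2_eq_square field_simps)
    finally have 1: "\<epsilon>\<^sup>2 * (norm (T (A f)))\<^sup>2 \<le> \<epsilon> * c\<^sup>2 * (norm f)\<^sup>2" .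
    have "(norm (f - \<epsilon> *\<^sub>R T (A f)))\<^sup>2 = (norm f)\<^sup>2 - 2 * \<epsilon> * (T (A f) \<bullet> f) + \<epsilon>\<^sup>2 * (norm (T (A f)))\<^sup>2"
      unfolding power2_norm_eq_inner by (simp add: inner_diff_left inner_diff_right inner_commute power2_eq_square algebra_simps)
    also have "\<dots> \<le> (norm f)\<^sup>2 - 2 * \<epsilon> * (c\<^sup>2 * (norm f)\<^sup>2) + \<epsilon> * c\<^sup>2 * (norm f)\<^sup>2"
      using 1 mult_left_mono[OF ge[of f], of "2 * \<epsilon>"] \<epsilon> by linarith
    also have "\<dots> = (1 - c\<^sup>2 * \<epsilon>) * (norm f)\<^sup>2" by (simp add: algebra_simps)
    also have "\<dots> \<le> r * (norm f)\<^sup>2" by (intro mult_right_mono) (auto simp: r_def)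
    also have "\<dots> = (sqrt r * norm f)\<^sup>2" using r by (simp add: power_mult_distrib)
    finally show ?thesis using r by (simp add: power2_le_iff_abs_le)
  qed
  have "\<exists>x. T x = h" for h
  proof -
    \<comment> \<open>Fixed points of this contraction are exactly the solutions of T (A f) =
      h.\<close>
    have "\<exists>!f. f - \<epsilon> *\<^sub>R T (A f) + \<epsilon> *\<^sub>R h = f"
    proof (rule banach_fix_type[OF r], intro allI)
      fix x y
      show "dist (x - \<epsilon> *\<^sub>R T (A x) + \<epsilon> *\<^sub>R h) (y - \<epsilon> *\<^sub>R T (A y) + \<epsilon> *\<^sub>R h) \<le> sqrt r * dist x y"
        using contr[of "x - y"] by (simp add: dist_norm TA.diff scaleR_diff_right algebra_simps)
    qed
    then obtain f where "\<epsilon> *\<^sub>R T (A f) = \<epsilon> *\<^sub>R h" by (auto simp: algebra_simps)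
    then have "T (A f) = h" using \<epsilon> by simp
    then show ?thesis by blast
  qed
  then show ?thesis by (metis surj_def)
qed

section \<open>Complex square-summable functions\<close>

text \<open>The weight is absorbed into the coordinates, so that one type serves all \<open>\<ell>\<^sup>2(X,m)\<close>. It carries only
  the real part of the complex inner product; complex scalars act through \<open>cscale\<close>.\<close>

lemma summable_on_le:
  fixes f g :: "'a \<Rightarrow> real"
  assumes "g summable_on A" "\<And>x. x \<in> A \<Longrightarrow> \<bar>f x\<bar> \<le> g x"
  shows "f summable_on A"
  by (rule abs_summable_summable, rule Infinite_Sum.abs_summable_on_comparison_test') (use assms in auto)

lemma summable_on_finite_bound:
  fixes f :: "'a \<Rightarrow> real"
  assumes "\<And>x. 0 \<le> f x" "\<And>F. finite F \<Longrightarrow> sum f F \<le> B"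
  shows "f summable_on UNIV" "infsum f UNIV \<le> B"
proof -
  show 1: "f summable_on UNIV"
    by (rule nonneg_bdd_above_summable_on) (use assms in \<open>auto intro!: bdd_aboveI2[where M = B]\<close>)
  show "infsum f UNIV \<le> B"
    by (rule infsum_le_finite_sums[OF 1]) (use assms in auto)
qed

definition square_summable :: "('a \<Rightarrow> complex) \<Rightarrow> bool" where
  "square_summable f \<longleftrightarrow> (\<lambda>x. (cmod (f x))\<^sup>2) summable_on UNIV"

lemma square_summable_prod:
  assumes "square_summable f" "square_summable g"
  shows "(\<lambda>x. cnj (f x) * g x) summable_on UNIV" "(\<lambda>x. Re (cnj (f x) * g x)) summable_on UNIV"
proof -
  have s: "(\<lambda>x. (cmod (f x))\<^sup>2 + (cmod (g x))\<^sup>2) summable_on UNIV"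
    using assms unfolding square_summable_def by (rule summable_on_add)
  have le: "cmod (cnj (f x) * g x) \<le> (cmod (f x))\<^sup>2 + (cmod (g x))\<^sup>2" for x
    using sum_squares_bound[of "cmod (f x)" "cmod (g x)"] mult_nonneg_nonneg[OF norm_ge_zero norm_ge_zero, of "f x" "g x"]
    unfolding norm_mult complex_mod_cnj by linarith
  have "(\<lambda>x. norm (cnj (f x) * g x)) summable_on UNIV"
    by (rule summable_on_le[OF s]) (use le in auto)
  then show "(\<lambda>x. cnj (f x) * g x) summable_on UNIV" by (rule abs_summable_summable)
  then show "(\<lambda>x. Re (cnj (f x) * g x)) summable_on UNIV" by (rule summable_on_Re)
qed

lemma square_summable_add:
  assumes "square_summable f" "square_summable g"
  shows "square_summable (\<lambda>x. f x + g x)"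
proof -
  have s: "(\<lambda>x. 2 * (cmod (f x))\<^sup>2 + 2 * (cmod (g x))\<^sup>2) summable_on UNIV"
    using assms unfolding square_summable_def by (intro summable_on_add summable_on_cmult_right)
  have "(cmod (f x + g x))\<^sup>2 \<le> 2 * (cmod (f x))\<^sup>2 + 2 * (cmod (g x))\<^sup>2" for x
  proof -
    have "(cmod (f x + g x))\<^sup>2 \<le> (cmod (f x) + cmod (g x))\<^sup>2" by (intro power_mono norm_triangle_ineq) auto
    also have "\<dots> \<le> 2 * (cmod (f x))\<^sup>2 + 2 * (cmod (g x))\<^sup>2"
      using sum_squares_bound[of "cmod (f x)" "cmod (g x)"] by (simp add: power2_sum)
    finally show ?thesis .
  qed
  then show ?thesis unfolding square_summable_def by (intro summable_on_le[OF s]) auto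
qed

lemma square_summable_scale: "square_summable f \<Longrightarrow> square_summable (\<lambda>x. a * f x)"
  unfolding square_summable_def norm_mult power_mult_distrib by (rule summable_on_cmult_right)

text \<open>A type of its own, so that inner product and completeness become class instances, as
  \<open>unit_selfadjoint\<close> and the fixed point theorem demand.\<close>

typedef 'a lsq = "{f :: 'a \<Rightarrow> complex. square_summable f}"
  morphisms coord Abs_lsq
  by (rule exI[of _ "\<lambda>x. 0"]) (simp add: square_summable_def)

lemma coord_summable [simp]: "square_summable (coord h)"
  using coord[of h] by simp

lemma coord_Abs [simp]: "square_summable f \<Longrightarrow> coord (Abs_lsq f) = f"
  by (simp add: Abs_lsq_inverse)

lemma lsq_eqI: "(\<And>x. coord h x = coord k x) \<Longrightarrow> h = k"
  by (simp add: coord_inject[symmetric] ext)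

definition cscale :: "complex \<Rightarrow> 'a lsq \<Rightarrow> 'a lsq" where
  "cscale a h = Abs_lsq (\<lambda>x. a * coord h x)"

lemma coord_cscale [simp]: "coord (cscale a h) x = a * coord h x"
  by (simp add: cscale_def square_summable_scale)

instantiation lsq :: (type) real_vector
begin

definition "0 = Abs_lsq (\<lambda>x. 0)"
definition "h + k = Abs_lsq (\<lambda>x. coord h x + coord k x)"
definition "r *\<^sub>R h = cscale (complex_of_real r) h"
definition "- h = cscale (-1) h"
definition "h - k = h + - (k :: 'a lsq)"

lemma coord_zero [simp]: "coord 0 x = 0"
  by (simp add: zero_lsq_def square_summable_def)

lemma coord_add [simp]: "coord (h + k) x = coord h x + coord k x"
  by (simp add: plus_lsq_def square_summable_add)

lemma coord_scaleR [simp]: "coord (r *\<^sub>R h) x = complex_of_real r * coord h x"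
  by (simp add: scaleR_lsq_def)

lemma coord_uminus [simp]: "coord (- h) x = - coord h x"
  by (simp add: uminus_lsq_def)

lemma coord_diff [simp]: "coord (h - k) x = coord h x - coord k x"
  by (simp add: minus_lsq_def)

instance
  by standard (auto intro!: lsq_eqI simp: algebra_simps)

end

instantiation lsq :: (type) real_inner
begin

definition "inner h k = (\<Sum>\<^sub>\<infinity>x. Re (cnj (coord h x) * coord k x))"
definition "norm h = sqrt (inner h (h :: 'a lsq))"
definition "sgn h = h /\<^sub>R norm (h :: 'a lsq)"
definition "dist h k = norm (h - k :: 'a lsq)"
definition [code del]: "(uniformity :: ('a lsq \<times> 'a lsq) filter) = (INF e\<in>{0 <..}. principal {(x, y). dist x y < e})"
definition [code del]: "open (U :: 'a lsq set) \<longleftrightarrow> (\<forall>x\<in>U. eventually (\<lambda>(x', y). x' = x \<longrightarrow> y \<in> U) uniformity)"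

lemma inner_lsq_self: "inner h h = (\<Sum>\<^sub>\<infinity>x. (cmod (coord h x))\<^sup>2)"
  unfolding inner_lsq_def by (rule infsum_cong) (simp only: cmod_power2, simp add: power2_eq_square)

instance
proof
  fix x y z :: "'a lsq" and r :: real
  show "dist x y = norm (x - y)" by (rule dist_lsq_def)
  show "sgn x = x /\<^sub>R norm x" by (rule sgn_lsq_def)
  show "uniformity = (INF e\<in>{0 <..}. principal {(x, y :: 'a lsq). dist x y < e})" by (rule uniformity_lsq_def)
  show "open U \<longleftrightarrow> (\<forall>x\<in>U. eventually (\<lambda>(x', y). x' = x \<longrightarrow> y \<in> U) uniformity)" for U :: "'a lsq set"
    by (rule open_lsq_def)
  show "norm x = sqrt (inner x x)" by (rule norm_lsq_def)
  show "inner x y = inner y x" unfolding inner_lsq_def by (rule infsum_cong) simp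
  show "inner (x + y) z = inner x z + inner y z"
    unfolding inner_lsq_def
    by (subst infsum_add[OF square_summable_prod(2) square_summable_prod(2), symmetric])
       (auto intro!: infsum_cong simp: algebra_simps)
  show "inner (r *\<^sub>R x) y = r * inner x y"
    unfolding inner_lsq_def
    by (subst infsum_cmult_right[OF square_summable_prod(2), symmetric])
       (auto intro!: infsum_cong simp: algebra_simps)
  show "0 \<le> inner x x" unfolding inner_lsq_self by (rule infsum_nonneg) simp
  show "inner x x = 0 \<longleftrightarrow> x = 0"
  proof
    assume "inner x x = 0"
    then have "(cmod (coord x a))\<^sup>2 = 0" for a
      unfolding inner_lsq_self
      by (intro nonneg_infsum_le_0D[where A = UNIV]) (use coord_summable[of x] in \<open>auto simp: square_summable_def\<close>)
    then show "x = 0" by (intro lsq_eqI) simp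
  qed (simp add: inner_lsq_self)
qed

end

lemma norm_lsq_sq: "(norm h)\<^sup>2 = (\<Sum>\<^sub>\<infinity>x. (cmod (coord h x))\<^sup>2)"
  by (simp add: power2_norm_eq_inner inner_lsq_self)

lemma sum_coord_le: "finite F \<Longrightarrow> (\<Sum>x\<in>F. (cmod (coord h x))\<^sup>2) \<le> (norm h)\<^sup>2"
  unfolding norm_lsq_sq
  by (rule finite_sum_le_infsum) (use coord_summable[of h] in \<open>auto simp: square_summable_def\<close>)

lemma coord_le: "cmod (coord h x) \<le> norm h"
proof -
  have "(cmod (coord h x))\<^sup>2 \<le> (norm h)\<^sup>2" using sum_coord_le[of "{x}" h] by simp
  then show ?thesis by (simp add: power2_le_iff_abs_le)
qed

lemma norm_lsq_leI:
  assumes "\<And>F. finite F \<Longrightarrow> (\<Sum>x\<in>F. (cmod (coord h x))\<^sup>2) \<le> B\<^sup>2" "B \<ge> 0"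
  shows "norm h \<le> B"
proof -
  have "(norm h)\<^sup>2 \<le> B\<^sup>2"
    unfolding norm_lsq_sq by (rule summable_on_finite_bound(2)) (use assms in auto)
  then show ?thesis using assms(2) by (simp add: power2_le_iff_abs_le)
qed

instance lsq :: (type) complete_space
proof
  fix X :: "nat \<Rightarrow> 'a lsq"
  assume X: "Cauchy X"
  have "Cauchy (\<lambda>n. coord (X n) x)" for x
  proof (rule CauchyI)
    fix e :: real assume "e > 0"
    then obtain N where N: "\<forall>m\<ge>N. \<forall>n\<ge>N. norm (X m - X n) < e" using CauchyD[OF X] by blast
    show "\<exists>M. \<forall>m\<ge>M. \<forall>n\<ge>M. norm (coord (X m) x - coord (X n) x) < e"
    proof (intro exI[of _ N] allI impI)
      fix m n assume "m \<ge> N" "n \<ge> N"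
      then show "norm (coord (X m) x - coord (X n) x) < e"
        using N coord_le[of "X m - X n" x] by (auto intro: le_less_trans)
    qed
  qed
  then obtain l where l: "\<And>x. (\<lambda>n. coord (X n) x) \<longlonglongrightarrow> l x"
    unfolding Cauchy_convergent_iff convergent_def by metis
  \<comment> \<open>Stated for finite F because there the limit in k can be taken termwise; a bound
    uniform in F is then a norm bound.\<close>
  have fin: "\<exists>N. \<forall>n\<ge>N. \<forall>F. finite F \<longrightarrow> (\<Sum>x\<in>F. (cmod (coord (X n) x - l x))\<^sup>2) \<le> e\<^sup>2" if e: "e > 0" for e
  proof -
    obtain N where N: "\<forall>m\<ge>N. \<forall>n\<ge>N. norm (X m - X n) < e" using CauchyD[OF X e] by blast
    show ?thesis
    proof (intro exI[of _ N] allI impI)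
      fix n and F :: "'a set" assume n: "n \<ge> N" and F: "finite F"
      have "(\<lambda>k. \<Sum>x\<in>F. (cmod (coord (X n) x - coord (X k) x))\<^sup>2) \<longlonglongrightarrow> (\<Sum>x\<in>F. (cmod (coord (X n) x - l x))\<^sup>2)"
        by (intro tendsto_intros l)
      moreover have "eventually (\<lambda>k. (\<Sum>x\<in>F. (cmod (coord (X n) x - coord (X k) x))\<^sup>2) \<le> e\<^sup>2) sequentially"
        using eventually_ge_at_top[of N]
      proof eventually_elim
        case (elim k)
        have "(\<Sum>x\<in>F. (cmod (coord (X n) x - coord (X k) x))\<^sup>2) \<le> (norm (X n - X k))\<^sup>2"
          using sum_coord_le[OF F, of "X n - X k"] by simp
        also have "\<dots> \<le> e\<^sup>2" using N n elim by (intro power_mono) (auto intro: less_imp_le)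
        finally show ?case .
      qed
      ultimately show "(\<Sum>x\<in>F. (cmod (coord (X n) x - l x))\<^sup>2) \<le> e\<^sup>2"
        by (rule tendsto_upperbound) simp
    qed
  qed
  obtain N where N: "\<And>F. finite F \<Longrightarrow> (\<Sum>x\<in>F. (cmod (coord (X N) x - l x))\<^sup>2) \<le> 1\<^sup>2" using fin[of 1] by auto
  then have "square_summable (\<lambda>x. coord (X N) x - l x)"
    unfolding square_summable_def by (intro summable_on_finite_bound[where B = "1\<^sup>2"]) auto
  then have "square_summable (\<lambda>x. coord (X N) x + (-1) * (coord (X N) x - l x))"
    by (intro square_summable_add square_summable_scale coord_summable)
  then have l2: "square_summable l" by simp
  have "X \<longlonglongrightarrow> Abs_lsq l"
  proof (rule LIMSEQ_I)
    fix e :: real assume e: "e > 0"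
    obtain N where N: "\<And>n F. n \<ge> N \<Longrightarrow> finite F \<Longrightarrow> (\<Sum>x\<in>F. (cmod (coord (X n) x - l x))\<^sup>2) \<le> (e/2)\<^sup>2"
      using fin[of "e/2"] e by auto
    have "norm (X n - Abs_lsq l) \<le> e / 2" if "n \<ge> N" for n
      by (rule norm_lsq_leI) (use N[OF that] e l2 in auto)
    then show "\<exists>N. \<forall>n\<ge>N. norm (X n - Abs_lsq l) < e" using e by (intro exI[of _ N]) force
  qed
  then show "convergent X" by (auto simp: convergent_def)
qed

lemma inner_cscale: "cscale a h \<bullet> k = h \<bullet> cscale (cnj a) k"
  unfolding inner_lsq_def by (rule infsum_cong) (simp add: algebra_simps)

lemma cscale_add [simp]: "cscale a (h + k) = cscale a h + cscale a k"
  by (rule lsq_eqI) (simp add: algebra_simps)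

lemma cscale_diff [simp]: "cscale a (h - k) = cscale a h - cscale a k"
  by (rule lsq_eqI) (simp add: algebra_simps)

lemma cscale_scaleR [simp]: "cscale a (r *\<^sub>R h) = r *\<^sub>R cscale a h"
  by (rule lsq_eqI) (simp add: algebra_simps)

lemma cscale_cscale [simp]: "cscale a (cscale b h) = cscale (a * b) h"
  by (rule lsq_eqI) (simp add: algebra_simps)

lemma cscale_of_real [simp]: "cscale (complex_of_real r) h = r *\<^sub>R h"
  by (rule lsq_eqI) simp

lemma cscale_one [simp]: "cscale 1 h = h" "cscale (- 1) h = - h" "cscale 0 h = 0" "cscale a 0 = 0"
  by (auto intro: lsq_eqI)

lemma norm_cscale [simp]: "norm (cscale a h) = cmod a * norm h"
proof -
  have "(norm (cscale a h))\<^sup>2 = (cmod a * norm h)\<^sup>2"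
    unfolding norm_lsq_sq power_mult_distrib
    by (subst infsum_cmult_right[symmetric])
       (use coord_summable[of h] in \<open>auto simp: norm_mult power_mult_distrib square_summable_def\<close>)
  then show ?thesis by (simp add: power2_eq_iff_nonneg)
qed

lemma bounded_linear_cscale: "bounded_linear (cscale a)"
  by (rule bounded_linear_intro[of _ "cmod a"]) auto

text \<open>Unit vector in unweighted coordinates; under \<open>of_lsq m\<close> it becomes the
  normalised \<open>onb m x\<close>, not the indicator of x.\<close>

definition delta :: "'a \<Rightarrow> 'a lsq" where
  "delta x = Abs_lsq (\<lambda>y. if y = x then 1 else 0)"

lemma square_summable_finite_support:
  assumes "finite {x. f x \<noteq> 0}"
  shows "square_summable f"
proof -
  have "(\<lambda>x. (cmod (f x))\<^sup>2) summable_on {x. f x \<noteq> 0}" using assms by (rule summable_on_finite)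
  also have "?this \<longleftrightarrow> square_summable f"
    unfolding square_summable_def by (rule summable_on_cong_neutral) auto
  finally show ?thesis .
qed

lemma coord_delta: "coord (delta x) y = (if y = x then 1 else 0)"
  unfolding delta_def by (subst coord_Abs) (auto intro!: square_summable_finite_support)

lemma inner_delta: "delta x \<bullet> h = Re (coord h x)"
proof -
  have "delta x \<bullet> h = (\<Sum>\<^sub>\<infinity>y\<in>{x}. Re (cnj (coord (delta x) y) * coord h y))"
    unfolding inner_lsq_def by (rule infsum_cong_neutral) (auto simp: coord_delta)
  then show ?thesis by (simp add: coord_delta)
qed

text \<open>For m > 0, the unitary map from unweighted coordinates onto ell^2(X,m).\<close>

definition of_lsq :: "('a \<Rightarrow> real) \<Rightarrow> 'a lsq \<Rightarrow> 'a \<Rightarrow> complex" where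
  "of_lsq m h = (\<lambda>x. coord h x / complex_of_real (sqrt (m x)))"

context
  fixes m :: "'a \<Rightarrow> real"
  assumes m: "\<And>x. m x > 0"
begin

lemma of_lsq_norm_term: "(cmod (of_lsq m h x))\<^sup>2 * m x = (cmod (coord h x))\<^sup>2"
  using m[of x] by (simp add: of_lsq_def norm_divide power_divide)

lemma of_lsq_in_l2 [simp]: "of_lsq m h \<in> l2 m"
  using coord_summable[of h] by (simp add: l2_def of_lsq_norm_term square_summable_def)

lemma l2_imp_of_lsq:
  assumes "f \<in> l2 m"
  obtains h where "f = of_lsq m h"
proof
  have "square_summable (\<lambda>x. f x * complex_of_real (sqrt (m x)))"
    using assms m by (simp add: l2_def square_summable_def norm_mult power_mult_distrib less_imp_le)
  moreover have "sqrt (m x) \<noteq> 0" for x using m[of x] by simp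
  ultimately show "f = of_lsq m (Abs_lsq (\<lambda>x. f x * complex_of_real (sqrt (m x))))"
    by (auto simp: of_lsq_def)
qed

lemma of_lsq_inj: "of_lsq m h = of_lsq m k \<longleftrightarrow> h = k"
proof
  assume eq: "of_lsq m h = of_lsq m k"
  show "h = k"
  proof (rule lsq_eqI)
    fix x
    show "coord h x = coord k x" using fun_cong[OF eq, of x] m[of x] by (simp add: of_lsq_def)
  qed
qed simp

lemma l2norm_of_lsq [simp]: "l2norm m (of_lsq m h) = norm h"
  unfolding l2norm_def of_lsq_norm_term by (simp flip: norm_lsq_sq)

text \<open>The imaginary part of <h, k> is minus the real part of <h, \<i> k>, so the real inner
  product and multiplication by \<i> determine the complex one.\<close>

lemma l2inner_of_lsq: "l2inner m (of_lsq m h) (of_lsq m k) = Complex (h \<bullet> k) (- (h \<bullet> cscale \<i> k))"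
proof -
  have "l2inner m (of_lsq m h) (of_lsq m k) = (\<Sum>\<^sub>\<infinity>x. cnj (coord h x) * coord k x)"
    unfolding l2inner_def
  proof (rule infsum_cong)
    fix x
    have "complex_of_real (sqrt (m x)) * complex_of_real (sqrt (m x)) = complex_of_real (m x)"
      using m[of x] unfolding of_real_mult[symmetric] by simp
    moreover have "complex_of_real (sqrt (m x)) \<noteq> 0" using m[of x] by simp
    ultimately show "cnj (of_lsq m h x) * of_lsq m k x * complex_of_real (m x) = cnj (coord h x) * coord k x"
      unfolding of_lsq_def by (simp add: field_simps)
  qed
  moreover have s: "(\<lambda>x. cnj (coord h x) * coord k x) summable_on UNIV" by (intro square_summable_prod) auto
  moreover have "- (h \<bullet> cscale \<i> k) = Im (\<Sum>\<^sub>\<infinity>x. cnj (coord h x) * coord k x)"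
    unfolding infsum_Im[OF s, symmetric] inner_lsq_def infsum_uminus[symmetric] by (rule infsum_cong) simp
  ultimately show ?thesis
    by (intro complex_eqI) (simp_all only: inner_lsq_def infsum_Re complex.sel)
qed

lemma of_lsq_zero [simp]: "of_lsq m 0 = (\<lambda>x. 0)"
  and of_lsq_add: "of_lsq m (h + k) = (\<lambda>x. of_lsq m h x + of_lsq m k x)"
  and of_lsq_diff: "of_lsq m (h - k) = (\<lambda>x. of_lsq m h x - of_lsq m k x)"
  and of_lsq_cscale: "of_lsq m (cscale a h) = (\<lambda>x. a * of_lsq m h x)"
  and of_lsq_scaleR: "of_lsq m (r *\<^sub>R h) = (\<lambda>x. complex_of_real r * of_lsq m h x)"
  by (auto simp: of_lsq_def add_divide_distrib diff_divide_distrib)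

lemma of_lsq_delta: "of_lsq m (delta x) = onb m x"
  using m by (auto simp: of_lsq_def onb_def coord_delta)

end

section \<open>The sup bound on canonically compactifiable graphs\<close>

text \<open>Energies enter the later arguments through finite partial sums, which can be exchanged
  with series; the factor 2 undoes the 1/2 in front of the double sum.\<close>

lemma Dtilde_energy_bounds:
  assumes "weighted_graph b c" "f \<in> Dtilde b c"
  shows "0 \<le> Qtilde b c f"
    and "finite F \<Longrightarrow> (\<Sum>(x, y)\<in>F. b x y * (cmod (f x - f y))\<^sup>2) \<le> 2 * Qtilde b c f"
    and "finite A \<Longrightarrow> (\<Sum>x\<in>A. c x * (cmod (f x))\<^sup>2) \<le> Qtilde b c f"
proof -
  have bc: "b x y \<ge> 0" "c x \<ge> 0" for x y using assms(1) by (auto simp: weighted_graph_def)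
  let ?B = "\<Sum>\<^sub>\<infinity>(x,y). b x y * (cmod (f x - f y))\<^sup>2" and ?C = "\<Sum>\<^sub>\<infinity>x. c x * (cmod (f x))\<^sup>2"
  have s: "(\<lambda>(x,y). b x y * (cmod (f x - f y))\<^sup>2) summable_on UNIV" "(\<lambda>x. c x * (cmod (f x))\<^sup>2) summable_on UNIV"
    using assms(2) by (auto simp: Dtilde_def)
  have nn: "?B \<ge> 0" "?C \<ge> 0" using bc by (auto intro!: infsum_nonneg simp: case_prod_beta)
  have Q: "2 * Qtilde b c f = ?B + 2 * ?C" by (simp add: Qtilde_def)
  show "0 \<le> Qtilde b c f" using Q nn by linarith
  show "(\<Sum>(x, y)\<in>F. b x y * (cmod (f x - f y))\<^sup>2) \<le> 2 * Qtilde b c f" if "finite F"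
  proof -
    have "(\<Sum>(x, y)\<in>F. b x y * (cmod (f x - f y))\<^sup>2) \<le> ?B"
      by (rule finite_sum_le_infsum[OF s(1) that]) (use bc in auto)
    then show ?thesis using Q nn by linarith
  qed
  show "(\<Sum>x\<in>A. c x * (cmod (f x))\<^sup>2) \<le> Qtilde b c f" if "finite A"
  proof -
    have "(\<Sum>x\<in>A. c x * (cmod (f x))\<^sup>2) \<le> ?C"
      by (rule finite_sum_le_infsum[OF s(2) that]) (use bc in auto)
    then show ?thesis using Q nn by linarith
  qed
qed

text \<open>Triangle inequality along a path, where an edge of weight b contributes at most sqrt (2
  / b) times the root of the energy. The constant depends on the two vertices, so connectedness
  alone gives no sup bound.\<close>

lemma connected_diff_bound:
  assumes g: "weighted_graph b c" and conn: "graph_connected b"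
  shows "\<exists>K. \<forall>f\<in>Dtilde b c. cmod (f x - f y) \<le> K * sqrt (Qtilde b c f)"
proof (cases "x = y")
  case True
  then show ?thesis by (intro exI[of _ 0]) simp
next
  case False
  obtain ps where ps: "ps \<noteq> []" "hd ps = x" "last ps = y" "\<forall>i. Suc i < length ps \<longrightarrow> b (ps ! i) (ps ! Suc i) > 0"
    using conn False unfolding graph_connected_def by blast
  have edge: "cmod (f u - f v) \<le> sqrt (2 / b u v) * sqrt (Qtilde b c f)" if "b u v > 0" "f \<in> Dtilde b c" for f u v
  proof -
    have "b u v * (cmod (f u - f v))\<^sup>2 \<le> 2 * Qtilde b c f"
      using Dtilde_energy_bounds(2)[OF g that(2), of "{(u, v)}"] by simp
    then have "(cmod (f u - f v))\<^sup>2 \<le> 2 / b u v * Qtilde b c f" using that(1) by (simp add: field_simps)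
    then have "cmod (f u - f v) \<le> sqrt (2 / b u v * Qtilde b c f)" by (rule real_le_rsqrt)
    then show ?thesis by (simp only: real_sqrt_mult)
  qed
  have "\<exists>K. \<forall>f\<in>Dtilde b c. cmod (f (ps ! 0) - f (ps ! i)) \<le> K * sqrt (Qtilde b c f)" if "i < length ps" for i
    using that
  proof (induction i)
    case 0
    then show ?case by (intro exI[of _ 0]) simp
  next
    case (Suc i)
    then obtain K where K: "\<forall>f\<in>Dtilde b c. cmod (f (ps ! 0) - f (ps ! i)) \<le> K * sqrt (Qtilde b c f)" by auto
    let ?L = "sqrt (2 / b (ps ! i) (ps ! Suc i))"
    show ?case
    proof (intro exI[of _ "K + ?L"] ballI)
      fix f assume f: "f \<in> Dtilde b c"
      have "cmod (f (ps ! 0) - f (ps ! Suc i)) \<le> cmod (f (ps ! 0) - f (ps ! i)) + cmod (f (ps ! i) - f (ps ! Suc i))"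
        by (rule norm_diff_triangle_le[OF order_refl order_refl])
      also have "\<dots> \<le> K * sqrt (Qtilde b c f) + ?L * sqrt (Qtilde b c f)"
        using K f edge[of "ps ! i" "ps ! Suc i" f] ps(4) Suc.prems by (intro add_mono) auto
      finally show "cmod (f (ps ! 0) - f (ps ! Suc i)) \<le> (K + ?L) * sqrt (Qtilde b c f)"
        by (simp add: distrib_right)
    qed
  qed
  from this[of "length ps - 1"] show ?thesis using ps by (simp add: hd_conv_nth last_conv_nth)
qed

text \<open>|sup u - sup v| is at most sup |u_n - v_n|, and each square is at most the sum of all.
  The weight stays in the statement because for w = 0 summability says nothing about the
  differences.\<close>

lemma weighted_sq_diff_SUP_le:
  fixes u v :: "nat \<Rightarrow> real"
  assumes w: "w \<ge> 0" and bdd: "bdd_above (range u)" "bdd_above (range v)"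
    and s: "summable (\<lambda>n. w * (u n - v n)\<^sup>2)"
  shows "w * ((SUP n. u n) - (SUP n. v n))\<^sup>2 \<le> (\<Sum>n. w * (u n - v n)\<^sup>2)"
proof (cases "w = 0")
  case True
  then show ?thesis by simp
next
  case False
  then have w: "w > 0" using w by simp
  define T where "T = (\<Sum>n. w * (u n - v n)\<^sup>2) / w"
  have "w * (u n - v n)\<^sup>2 \<le> w * T" for n
    using sum_le_suminf[OF s, of "{n}"] w by (simp add: T_def)
  then have "(u n - v n)\<^sup>2 \<le> T" for n using w by simp
  then have le: "\<bar>u n - v n\<bar> \<le> sqrt T" for n by (intro real_le_rsqrt) simp
  have "u n \<le> (SUP n. v n) + sqrt T" for n
    using cSUP_upper[OF UNIV_I bdd(2), of n] le[of n] by linarith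
  then have 1: "(SUP n. u n) \<le> (SUP n. v n) + sqrt T" by (intro cSUP_least) auto
  have "v n \<le> (SUP n. u n) + sqrt T" for n
    using cSUP_upper[OF UNIV_I bdd(1), of n] le[of n] by linarith
  then have 2: "(SUP n. v n) \<le> (SUP n. u n) + sqrt T" by (intro cSUP_least) auto
  have T: "T \<ge> 0" using \<open>(u 0 - v 0)\<^sup>2 \<le> T\<close> zero_le_power2 order_trans by blast
  have "((SUP n. u n) - (SUP n. v n))\<^sup>2 \<le> (sqrt T)\<^sup>2"
    using 1 2 by (intro abs_le_square_iff[THEN iffD1]) (simp add: T)
  then have "w * ((SUP n. u n) - (SUP n. v n))\<^sup>2 \<le> w * T" using w T by simp
  then show ?thesis using w by (simp add: T_def)
qed

text \<open>If the bound fails, rescaled violating functions \<open>g\<^sub>n \<ge> 0\<close> have energy at most \<open>4\<^sup>-\<^sup>n\<close> but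
  suprema beyond \<open>2\<^sup>n\<close>; the energy of their pointwise supremum is at most the sum of the energies,
  so the supremum is an unbounded element of \<open>Dtilde\<close>.\<close>

lemma canonically_compactifiable_sup_bound:
  assumes g: "weighted_graph b c" and conn: "graph_connected b" and cc: "canonically_compactifiable b c"
  shows "\<exists>C. \<forall>f\<in>Dtilde b c. \<forall>x. (cmod (f x))\<^sup>2 \<le> C * (Qtilde b c f + (cmod (f a))\<^sup>2)"
proof (rule ccontr)
  assume "\<not> ?thesis"
  \<comment> \<open>Why 4^n: one factor 2^n is spent on making the energies summable, the other
    makes the supremum unbounded.\<close>
  then have "\<exists>f x. f \<in> Dtilde b c \<and> (cmod (f x))\<^sup>2 > (4 ^ n)\<^sup>2 * (Qtilde b c f + (cmod (f a))\<^sup>2)" for n :: nat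
    by (metis not_le)
  then obtain f z where f: "\<And>n. f n \<in> Dtilde b c"
    and z: "\<And>n. (cmod (f n (z n)))\<^sup>2 > (4 ^ n)\<^sup>2 * (Qtilde b c (f n) + (cmod (f n a))\<^sup>2)"
    by metis
  have bc: "b x y \<ge> 0" "c x \<ge> 0" for x y using g by (auto simp: weighted_graph_def)
  have "\<exists>K. \<forall>f\<in>Dtilde b c. cmod (f x - f a) \<le> K * sqrt (Qtilde b c f)" for x
    by (rule connected_diff_bound[OF g conn])
  then obtain K where K: "\<And>x f. f \<in> Dtilde b c \<Longrightarrow> cmod (f x - f a) \<le> K x * sqrt (Qtilde b c f)" by metis
  define N where "N n = sqrt (Qtilde b c (f n) + (cmod (f n a))\<^sup>2)" for n
  have Q0: "Qtilde b c (f n) \<ge> 0" for n using Dtilde_energy_bounds(1)[OF g f] .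
  have N2: "(N n)\<^sup>2 = Qtilde b c (f n) + (cmod (f n a))\<^sup>2" for n unfolding N_def using Q0 by simp
  \<comment> \<open>Otherwise connectedness forces f_n to be constant with value 0 at a, against the
    choice of z_n.\<close>
  have N: "N n > 0" for n
  proof (rule ccontr)
    assume "\<not> N n > 0"
    then have "Qtilde b c (f n) + (cmod (f n a))\<^sup>2 \<le> 0" unfolding N_def by simp
    then have "Qtilde b c (f n) = 0" "(cmod (f n a))\<^sup>2 = 0"
      using Q0[of n] zero_le_power2[of "cmod (f n a)"] by linarith+
    then have "f n (z n) = 0" using K[OF f[of n], of "z n"] by simp
    then have "(4 ^ n)\<^sup>2 * (Qtilde b c (f n) + (cmod (f n a))\<^sup>2) < 0" using z[of n] by simp
    moreover have "0 \<le> (4 ^ n)\<^sup>2 * (Qtilde b c (f n) + (cmod (f n a))\<^sup>2)"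
      using Q0[of n] by (intro mult_nonneg_nonneg add_nonneg_nonneg) auto
    ultimately show False by linarith
  qed
  have N_ge: "sqrt (Qtilde b c (f n)) \<le> N n" "cmod (f n a) \<le> N n" for n
    unfolding N_def using Q0[of n] by (auto intro: real_le_rsqrt)
  define s where "s n = 1 / (2 ^ n * N n)" for n
  have s: "s n > 0" "s n * N n = (1/2) ^ n" "s n * N n \<le> 1" for n
    using N[of n] by (auto simp: s_def power_one_over)
  have s2: "(s n)\<^sup>2 * Qtilde b c (f n) \<le> (1/4) ^ n" for n
  proof -
    have "(s n)\<^sup>2 * Qtilde b c (f n) \<le> (s n)\<^sup>2 * (N n)\<^sup>2" unfolding N2 by (intro mult_left_mono) auto
    also have "\<dots> = ((1/2) ^ n)\<^sup>2" unfolding s(2)[symmetric] by (simp add: power_mult_distrib)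
    finally show ?thesis by (simp add: power2_eq_square flip: power_mult_distrib)
  qed
  \<comment> \<open>Taking the modulus does not increase the energy and yields real functions, which
    have pointwise suprema.\<close>
  define h where "h n x = s n * cmod (f n x)" for n x
  \<comment> \<open>Finiteness of the supremum at each vertex: N n controls the value at the base
    point a, and connectedness the difference to it.\<close>
  have h_le: "h n x \<le> 1 + \<bar>K x\<bar>" for n x
  proof -
    have "cmod (f n x) \<le> cmod (f n a) + cmod (f n x - f n a)" by (rule norm_triangle_sub)
    also have "\<dots> \<le> N n + K x * sqrt (Qtilde b c (f n))" using K[OF f] N_ge by (intro add_mono)
    also have "K x * sqrt (Qtilde b c (f n)) \<le> \<bar>K x\<bar> * N n" using N_ge Q0 by (intro mult_mono) auto
    finally have "cmod (f n x) \<le> (1 + \<bar>K x\<bar>) * N n" by (simp add: distrib_right)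
    then have "h n x \<le> s n * ((1 + \<bar>K x\<bar>) * N n)" unfolding h_def using s(1)[of n] by simp
    also have "\<dots> = (1 + \<bar>K x\<bar>) * (s n * N n)" by simp
    also have "\<dots> \<le> (1 + \<bar>K x\<bar>) * 1" by (intro mult_left_mono s) auto
    finally show ?thesis by simp
  qed
  then have bdd: "bdd_above (range (\<lambda>n. h n x))" for x by (auto intro!: bdd_aboveI2)
  define G where "G x = (SUP n. h n x)" for x
  have geo: "summable (\<lambda>n. (1/4 :: real) ^ n)" by (rule summable_geometric) simp
  have Eb: "(\<Sum>(x, y)\<in>F. b x y * (h n x - h n y)\<^sup>2) \<le> 2 * (1/4) ^ n" if F: "finite F" for n F
  proof -
    have "(\<Sum>(x, y)\<in>F. b x y * (h n x - h n y)\<^sup>2) \<le> (\<Sum>(x, y)\<in>F. (s n)\<^sup>2 * (b x y * (cmod (f n x - f n y))\<^sup>2))"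
    proof (rule sum_mono, clarify)
      fix x y
      have "\<bar>cmod (f n x) - cmod (f n y)\<bar>\<^sup>2 \<le> (cmod (f n x - f n y))\<^sup>2"
        by (intro power_mono norm_triangle_ineq3) auto
      then have "(s n)\<^sup>2 * (b x y * (cmod (f n x) - cmod (f n y))\<^sup>2) \<le> (s n)\<^sup>2 * (b x y * (cmod (f n x - f n y))\<^sup>2)"
        using bc by (intro mult_left_mono) auto
      then show "b x y * (h n x - h n y)\<^sup>2 \<le> (s n)\<^sup>2 * (b x y * (cmod (f n x - f n y))\<^sup>2)"
        by (simp add: h_def power_mult_distrib mult_ac flip: right_diff_distrib)
    qed
    also have "\<dots> = (s n)\<^sup>2 * (\<Sum>(x, y)\<in>F. b x y * (cmod (f n x - f n y))\<^sup>2)"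
      by (simp add: sum_distrib_left case_prod_beta)
    also have "\<dots> \<le> (s n)\<^sup>2 * (2 * Qtilde b c (f n))"
      by (intro mult_left_mono Dtilde_energy_bounds(2)[OF g f F]) auto
    also have "\<dots> \<le> 2 * (1/4) ^ n" using s2[of n] by simp
    finally show ?thesis .
  qed
  \<comment> \<open>The \<open>- 0\<close> matches \<open>weighted_sq_diff_SUP_le\<close> with the
    zero sequence in the place of v.\<close>
  have Ec: "(\<Sum>x\<in>A. c x * (h n x - 0)\<^sup>2) \<le> (1/4) ^ n" if A: "finite A" for n A
  proof -
    have "(\<Sum>x\<in>A. c x * (h n x - 0)\<^sup>2) = (s n)\<^sup>2 * (\<Sum>x\<in>A. c x * (cmod (f n x))\<^sup>2)"
      by (simp add: sum_distrib_left h_def power_mult_distrib mult_ac)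
    also have "\<dots> \<le> (s n)\<^sup>2 * Qtilde b c (f n)"
      by (intro mult_left_mono Dtilde_energy_bounds(3)[OF g f A]) auto
    finally show ?thesis using s2[of n] by simp
  qed
  have sb: "summable (\<lambda>n. b x y * (h n x - h n y)\<^sup>2)" for x y
    by (rule summable_comparison_test[OF _ summable_mult[OF geo, of 2]])
       (use Eb[of "{(x, y)}"] bc in auto)
  have sc: "summable (\<lambda>n. c x * (h n x - 0)\<^sup>2)" for x
    by (rule summable_comparison_test[OF _ geo]) (use Ec[of "{x}"] bc in auto)
  have Gb: "(\<Sum>(x, y)\<in>F. b x y * (G x - G y)\<^sup>2) \<le> (\<Sum>n. 2 * (1/4) ^ n)" if F: "finite F" for F
  proof -
    have "(\<Sum>(x, y)\<in>F. b x y * (G x - G y)\<^sup>2) \<le> (\<Sum>(x, y)\<in>F. \<Sum>n. b x y * (h n x - h n y)\<^sup>2)"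
      unfolding G_def using bc bdd sb by (intro sum_mono) (auto intro!: weighted_sq_diff_SUP_le)
    also have "\<dots> = (\<Sum>n. \<Sum>(x, y)\<in>F. b x y * (h n x - h n y)\<^sup>2)"
      unfolding case_prod_beta by (rule suminf_sum[symmetric]) (rule sb)
    also have "\<dots> \<le> (\<Sum>n. 2 * (1/4) ^ n)"
      by (intro suminf_le Eb F summable_mult geo) (unfold case_prod_beta, intro summable_sum sb)
    finally show ?thesis .
  qed
  have Gc: "(\<Sum>x\<in>A. c x * (G x)\<^sup>2) \<le> (\<Sum>n. (1/4) ^ n)" if A: "finite A" for A
  proof -
    have "(\<Sum>x\<in>A. c x * (G x)\<^sup>2) \<le> (\<Sum>x\<in>A. \<Sum>n. c x * (h n x - 0)\<^sup>2)"
    proof (rule sum_mono)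
      fix x
      show "c x * (G x)\<^sup>2 \<le> (\<Sum>n. c x * (h n x - 0)\<^sup>2)"
        using weighted_sq_diff_SUP_le[of "c x" "\<lambda>n. h n x" "\<lambda>n. 0"] bc bdd[of x] sc[of x] by (simp add: G_def)
    qed
    also have "\<dots> = (\<Sum>n. \<Sum>x\<in>A. c x * (h n x - 0)\<^sup>2)" by (rule suminf_sum[symmetric]) (rule sc)
    also have "\<dots> \<le> (\<Sum>n. (1/4) ^ n)" by (intro suminf_le Ec A geo summable_sum sc)
    finally show ?thesis .
  qed
  have "(\<lambda>x. complex_of_real (G x)) \<in> Dtilde b c"
    unfolding Dtilde_def
  proof (intro CollectI conjI)
    have norm_diff: "cmod (complex_of_real (G x) - complex_of_real (G y)) = \<bar>G x - G y\<bar>" for x y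
      by (metis norm_of_real of_real_diff)
    show "(\<lambda>(x, y). b x y * (cmod (complex_of_real (G x) - complex_of_real (G y)))\<^sup>2) summable_on UNIV"
      unfolding norm_diff power2_abs
      by (rule summable_on_finite_bound(1)[OF _ Gb]) (use bc in auto)
    show "(\<lambda>x. c x * (cmod (complex_of_real (G x)))\<^sup>2) summable_on UNIV"
      unfolding norm_of_real power2_abs
      by (rule summable_on_finite_bound(1)[OF _ Gc]) (use bc in auto)
  qed
  then have "(\<lambda>x. complex_of_real (G x)) \<in> linfty"
    using cc unfolding canonically_compactifiable_def by blast
  then obtain C where C: "\<And>x. \<bar>G x\<bar> \<le> C" by (auto simp: linfty_def)
  obtain n :: nat where n: "C < 2 ^ n" using real_arch_pow[of 2 C] by auto
  have "(4 ^ n * N n)\<^sup>2 < (cmod (f n (z n)))\<^sup>2" using z[of n] by (simp add: power_mult_distrib N2)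
  then have "4 ^ n * N n < cmod (f n (z n))" by (rule power_less_imp_less_base) simp
  then have "s n * (4 ^ n * N n) < h n (z n)" unfolding h_def using s(1)[of n] by simp
  moreover have "s n * (4 ^ n * N n) = 2 ^ n"
  proof -
    have "s n * (4 ^ n * N n) = 4 ^ n * (s n * N n)" by simp
    also have "\<dots> = (4 * (1/2)) ^ n" unfolding s(2) power_mult_distrib ..
    finally show ?thesis by simp
  qed
  moreover have "h n (z n) \<le> G (z n)" unfolding G_def using bdd by (intro cSUP_upper) auto
  ultimately show False using C[of "z n"] n by linarith
qed

section \<open>The operator of a closed form\<close>

lemma nonneg_quadratic_form_lincomb:
  assumes "nonneg_quadratic_form m D Q" "v \<in> D" "w \<in> D"
  shows "(\<lambda>x. a * v x + b * w x) \<in> D"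
proof -
  have "\<forall>u\<in>D. \<forall>v\<in>D. (\<lambda>x. u x + v x) \<in> D" "\<forall>a. \<forall>u\<in>D. (\<lambda>x. a * u x) \<in> D"
    using assms(1) by (simp_all add: nonneg_quadratic_form_def subspace_l2_def)
  then show ?thesis using assms(2,3) by simp
qed

text \<open>Let q witness \<open>nonneg_quadratic_form\<close>. Expanding Q (u + a v) for a = 1, -1,
  \<i>, -\<i> shows that polarization returns q, so \<open>sesq\<close> inherits its rules,
  conjugate linear in the first argument.\<close>

lemma sesq_sesquilinear:
  assumes "nonneg_quadratic_form m D Q" "u \<in> D" "v \<in> D" "w \<in> D"
  shows "sesq Q u (\<lambda>x. \<alpha> * v x + \<beta> * w x) = \<alpha> * sesq Q u v + \<beta> * sesq Q u w"
    and "sesq Q (\<lambda>x. \<alpha> * v x + \<beta> * w x) u = cnj \<alpha> * sesq Q v u + cnj \<beta> * sesq Q w u"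
    and "sesq Q u u = complex_of_real (Q u)"
proof -
  obtain q where q: "\<And>u v w a b. u \<in> D \<Longrightarrow> v \<in> D \<Longrightarrow> w \<in> D \<Longrightarrow>
      q u (\<lambda>x. a * v x + b * w x) = a * q u v + b * q u w"
    "\<And>u v w a b. u \<in> D \<Longrightarrow> v \<in> D \<Longrightarrow> w \<in> D \<Longrightarrow>
      q (\<lambda>x. a * v x + b * w x) u = cnj a * q v u + cnj b * q w u"
    "\<And>u. u \<in> D \<Longrightarrow> q u u = complex_of_real (Q u)"
    using assms(1) unfolding nonneg_quadratic_form_def by blast
  have lc: "(\<lambda>x. a * v x + b * w x) \<in> D" if "v \<in> D" "w \<in> D" for v w a b
    using nonneg_quadratic_form_lincomb[OF assms(1) that] .
  have eq: "sesq Q u v = q u v" if uv: "u \<in> D" "v \<in> D" for u v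
  proof -
    have Q: "complex_of_real (Q (\<lambda>x. u x + a * v x)) = q u u + a * q u v + cnj a * q v u + a * cnj a * q v v" for a
    proof -
      have "complex_of_real (Q (\<lambda>x. 1 * u x + a * v x)) = q (\<lambda>x. 1 * u x + a * v x) (\<lambda>x. 1 * u x + a * v x)"
        using q(3)[OF lc[OF uv, of 1 a]] by simp
      also have "\<dots> = 1 * q (\<lambda>x. 1 * u x + a * v x) u + a * q (\<lambda>x. 1 * u x + a * v x) v"
        by (intro q(1) lc uv)
      also have "q (\<lambda>x. 1 * u x + a * v x) u = cnj 1 * q u u + cnj a * q v u" by (intro q(2) uv)
      also have "q (\<lambda>x. 1 * u x + a * v x) v = cnj 1 * q u v + cnj a * q v v" by (intro q(2) uv)
      finally show ?thesis by (simp add: algebra_simps)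
    qed
    have "complex_of_real (Q (\<lambda>x. u x + v x)) = q u u + q u v + q v u + q v v"
      "complex_of_real (Q (\<lambda>x. u x - v x)) = q u u - q u v - q v u + q v v"
      "complex_of_real (Q (\<lambda>x. u x + \<i> * v x)) = q u u + \<i> * q u v - \<i> * q v u + q v v"
      "complex_of_real (Q (\<lambda>x. u x - \<i> * v x)) = q u u - \<i> * q u v + \<i> * q v u + q v v"
      using Q[of 1] Q[of "-1"] Q[of \<i>] Q[of "- \<i>"] by (simp_all add: algebra_simps)
    note QQ = this
    show ?thesis
      unfolding sesq_def of_real_divide of_real_diff QQ by (simp add: field_simps)
  qed
  show "sesq Q u (\<lambda>x. \<alpha> * v x + \<beta> * w x) = \<alpha> * sesq Q u v + \<beta> * sesq Q u w"
    using assms(2-4) by (simp add: eq q lc)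
  show "sesq Q (\<lambda>x. \<alpha> * v x + \<beta> * w x) u = cnj \<alpha> * sesq Q v u + cnj \<beta> * sesq Q w u"
    using assms(2-4) by (simp add: eq q lc)
  show "sesq Q u u = complex_of_real (Q u)"
    using assms(2) by (simp add: eq q)
qed

locale weighted_closed_form =
  fixes m :: "'a \<Rightarrow> real" and D :: "('a \<Rightarrow> complex) set" and Q :: "('a \<Rightarrow> complex) \<Rightarrow> real"
  assumes m: "\<And>x. m x > 0" and closed: "closed_form m D Q" and Cc_subset: "Cc \<subseteq> D"
begin

abbreviation emb :: "'a lsq \<Rightarrow> 'a \<Rightarrow> complex" where "emb \<equiv> of_lsq m"

lemmas emb_l2 [simp] = of_lsq_in_l2[where m = m, OF m]
  and l2_emb = l2_imp_of_lsq[where m = m, OF m]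
  and emb_inj = of_lsq_inj[where m = m, OF m]
  and l2norm_emb [simp] = l2norm_of_lsq[where m = m, OF m]
  and l2inner_emb = l2inner_of_lsq[where m = m, OF m]
  and emb_zero [simp] = of_lsq_zero[where m = m, OF m]
  and emb_add = of_lsq_add[where m = m, OF m]
  and emb_diff = of_lsq_diff[where m = m, OF m]
  and emb_cscale = of_lsq_cscale[where m = m, OF m]
  and emb_scaleR = of_lsq_scaleR[where m = m, OF m]
  and emb_delta = of_lsq_delta[where m = m, OF m]

lemma nonneg_form: "nonneg_quadratic_form m D Q"
  using closed by (simp add: closed_form_def)

lemma D_l2: "D \<subseteq> l2 m"
  using nonneg_form by (simp add: nonneg_quadratic_form_def subspace_l2_def)

lemma D_emb: "u \<in> D \<Longrightarrow> \<exists>h. u = emb h"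
  using D_l2 l2_emb[of u] by blast

section \<open>The form in unweighted coordinates\<close>

definition dom :: "'a lsq set" where "dom = {h. emb h \<in> D}"

text \<open>Real part only, as \<open>closed_form_riesz\<close> works over the reals;
  \<open>weak_equation_iff\<close> recovers the imaginary part.\<close>

definition ql :: "'a lsq \<Rightarrow> 'a lsq \<Rightarrow> real" where "ql h k = Re (sesq Q (emb h) (emb k))"

lemma emb_lincomb: "emb (cscale a h + cscale b k) = (\<lambda>x. a * emb h x + b * emb k x)"
  by (simp add: emb_add emb_cscale)

lemma dom_lincomb: "h \<in> dom \<Longrightarrow> k \<in> dom \<Longrightarrow> cscale a h + cscale b k \<in> dom"
  unfolding dom_def mem_Collect_eq emb_lincomb by (rule nonneg_quadratic_form_lincomb[OF nonneg_form])

lemma dom_zero: "0 \<in> dom"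
  using nonneg_form by (simp add: dom_def emb_zero nonneg_quadratic_form_def subspace_l2_def)

lemma dom_cscale: "h \<in> dom \<Longrightarrow> cscale a h \<in> dom"
  using dom_lincomb[of h h a 0] by simp

lemma dom_subspace: "subspace dom"
proof (rule subspaceI)
  show "h + k \<in> dom" if "h \<in> dom" "k \<in> dom" for h k
    using dom_lincomb[OF that, of 1 1] by simp
  show "r *\<^sub>R h \<in> dom" if "h \<in> dom" for h r
    using dom_cscale[OF that, of "complex_of_real r"] by simp
qed (rule dom_zero)

lemma delta_dom: "cscale a (delta x) \<in> dom"
proof -
  have "{y. emb (cscale a (delta x)) y \<noteq> 0} \<subseteq> {x}" by (auto simp: of_lsq_def coord_delta split: if_splits)
  then have "emb (cscale a (delta x)) \<in> Cc" unfolding Cc_def by (auto intro: finite_subset)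
  then show ?thesis using Cc_subset by (auto simp: dom_def)
qed

lemma sesq_emb_right:
  assumes "h \<in> dom" "k \<in> dom" "l \<in> dom"
  shows "sesq Q (emb h) (emb (cscale a k + cscale b l)) = a * sesq Q (emb h) (emb k) + b * sesq Q (emb h) (emb l)"
  unfolding emb_lincomb using assms by (intro sesq_sesquilinear(1)[OF nonneg_form]) (auto simp: dom_def)

lemma sesq_emb_left:
  assumes "h \<in> dom" "k \<in> dom" "l \<in> dom"
  shows "sesq Q (emb (cscale a k + cscale b l)) (emb h) = cnj a * sesq Q (emb k) (emb h) + cnj b * sesq Q (emb l) (emb h)"
  unfolding emb_lincomb using assms by (intro sesq_sesquilinear(2)[OF nonneg_form]) (auto simp: dom_def)

lemma ql_self: "h \<in> dom \<Longrightarrow> ql h h = Q (emb h)"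
  using sesq_sesquilinear(3)[OF nonneg_form, of "emb h" "emb h" "emb h"] by (simp add: ql_def dom_def)

lemma ql_nonneg: "h \<in> dom \<Longrightarrow> 0 \<le> ql h h"
  using nonneg_form by (simp add: ql_self) (simp add: dom_def nonneg_quadratic_form_def)

lemma ql_add: "u \<in> dom \<Longrightarrow> v \<in> dom \<Longrightarrow> w \<in> dom \<Longrightarrow> ql (u + v) w = ql u w + ql v w"
  using sesq_emb_left[of w u v 1 1] by (simp add: ql_def)

lemma ql_scale: "u \<in> dom \<Longrightarrow> v \<in> dom \<Longrightarrow> ql (r *\<^sub>R u) v = r * ql u v"
  using sesq_emb_left[of v u u "complex_of_real r" 0] by (simp add: ql_def)

lemma sesq_cscale: "u \<in> dom \<Longrightarrow> v \<in> dom \<Longrightarrow> sesq Q (emb u) (emb (cscale a v)) = a * sesq Q (emb u) (emb v)"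
  using sesq_emb_right[of u v v a 0] by simp

lemma ql_cscale: "u \<in> dom \<Longrightarrow> v \<in> dom \<Longrightarrow> ql (cscale a u) v = ql u (cscale (cnj a) v)"
  using sesq_emb_left[of v u u a 0] by (simp add: ql_def sesq_cscale)

text \<open>The real part of the polarization is (Q (u + v) - Q (u - v)) / 4, and Q is invariant
  under multiplication by -1.\<close>

lemma ql_sym:
  assumes "u \<in> dom" "v \<in> dom"
  shows "ql u v = ql v u"
proof -
  have Q: "ql h k = (Q (emb (h + k)) - Q (emb (h - k))) / 4" for h k
    by (simp add: ql_def sesq_def emb_add emb_diff)
  have d: "u - v \<in> dom" using dom_subspace assms by (rule subspace_diff)
  have "Q (emb (v - u)) = ql (cscale (-1) (u - v)) (cscale (-1) (u - v))"
    by (subst ql_self) (use dom_cscale[OF d, of "-1"] in auto)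
  also have "\<dots> = Q (emb (u - v))" using d dom_cscale[OF d, of "-1"] by (subst ql_cscale) (simp_all add: ql_self)
  finally show ?thesis unfolding Q by (simp add: add.commute)
qed

lemma ql_complete:
  assumes u: "\<And>n :: nat. u n \<in> dom"
    and cau: "\<And>e. e > 0 \<Longrightarrow> \<exists>N. \<forall>n\<ge>N. \<forall>k\<ge>N. ql (u n - u k) (u n - u k) + (norm (u n - u k))\<^sup>2 < e"
  shows "\<exists>v\<in>dom. (\<lambda>n. ql (u n - v) (u n - v) + (norm (u n - v))\<^sup>2) \<longlonglongrightarrow> 0"
proof -
  have e: "Q (\<lambda>x. emb h x - emb k x) + (l2norm m (\<lambda>x. emb h x - emb k x))\<^sup>2 = ql (h - k) (h - k) + (norm (h - k))\<^sup>2"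
    if "h \<in> dom" "k \<in> dom" for h k
    using ql_self[OF subspace_diff[OF dom_subspace that]] unfolding emb_diff[symmetric]
    by (simp add: l2norm_emb)
  have "\<forall>n. emb (u n) \<in> D" using u by (simp add: dom_def)
  moreover have "\<forall>e>0. \<exists>N. \<forall>n\<ge>N. \<forall>k\<ge>N. Q (\<lambda>x. emb (u n) x - emb (u k) x) + (l2norm m (\<lambda>x. emb (u n) x - emb (u k) x))\<^sup>2 < e"
    using cau by (simp add: e u)
  ultimately have "\<exists>w\<in>D. (\<lambda>n. Q (\<lambda>x. emb (u n) x - w x) + (l2norm m (\<lambda>x. emb (u n) x - w x))\<^sup>2) \<longlonglongrightarrow> 0"
    by (rule mp[OF spec[OF conjunct2[OF closed[unfolded closed_form_def]], of "\<lambda>n. emb (u n)"], OF conjI])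
  then obtain w where w: "w \<in> D"
    "(\<lambda>n. Q (\<lambda>x. emb (u n) x - w x) + (l2norm m (\<lambda>x. emb (u n) x - w x))\<^sup>2) \<longlonglongrightarrow> 0"
    by blast
  obtain v where v: "w = emb v" using D_emb[OF w(1)] by blast
  have "v \<in> dom" using w(1) v by (simp add: dom_def)
  then show ?thesis using w(2) unfolding v by (intro bexI[of _ v]) (simp_all add: e u)
qed

text \<open>The resolvent \<open>(L + 1)\<^sup>-\<^sup>1\<close>, transported to \<open>lsq\<close>.\<close>

definition R :: "'a lsq \<Rightarrow> 'a lsq" where
  "R f = (SOME u. u \<in> dom \<and> (\<forall>v\<in>dom. ql u v + u \<bullet> v = f \<bullet> v))"

lemma R_dom: "R f \<in> dom" and R_eq: "v \<in> dom \<Longrightarrow> ql (R f) v + R f \<bullet> v = f \<bullet> v"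
proof -
  have "\<exists>u\<in>dom. \<forall>v\<in>dom. ql u v + u \<bullet> v = f \<bullet> v"
    by (rule closed_form_riesz[OF dom_subspace])
       (use ql_add ql_scale ql_sym ql_nonneg ql_complete in auto)
  then have "\<exists>u. u \<in> dom \<and> (\<forall>v\<in>dom. ql u v + u \<bullet> v = f \<bullet> v)" by blast
  from someI_ex[OF this] have *: "R f \<in> dom \<and> (\<forall>v\<in>dom. ql (R f) v + R f \<bullet> v = f \<bullet> v)"
    unfolding R_def .
  show "R f \<in> dom" using * by blast
  show "v \<in> dom \<Longrightarrow> ql (R f) v + R f \<bullet> v = f \<bullet> v" using * by blast
qed

text \<open>Testing the difference d of two solutions with itself gives q(d,d) + |d|^2 = 0.\<close>

lemma R_eqI:
  assumes u: "u \<in> dom" "\<And>v. v \<in> dom \<Longrightarrow> ql u v + u \<bullet> v = f \<bullet> v"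
  shows "R f = u"
proof -
  let ?d = "R f - u"
  have d: "?d \<in> dom" by (rule subspace_diff[OF dom_subspace R_dom u(1)])
  have "ql (R f) ?d = ql (?d + u) ?d" by simp
  also have "\<dots> = ql ?d ?d + ql u ?d" using d u(1) by (intro ql_add)
  finally have "ql ?d ?d + ?d \<bullet> ?d = 0"
    using R_eq[OF d, of f] u(2)[OF d] by (simp add: inner_diff_left)
  then have "?d \<bullet> ?d = 0" using ql_nonneg[OF d] inner_ge_zero[of ?d] by linarith
  then show ?thesis by simp
qed

lemma R_linear: "linear R"
proof (rule linearI)
  fix f g :: "'a lsq" and r :: real
  show "R (f + g) = R f + R g"
  proof (rule R_eqI)
    show "R f + R g \<in> dom" by (rule subspace_add[OF dom_subspace R_dom R_dom])
    show "ql (R f + R g) v + (R f + R g) \<bullet> v = (f + g) \<bullet> v" if "v \<in> dom" for v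
      using R_eq[OF that, of f] R_eq[OF that, of g] ql_add[OF R_dom R_dom that] by (simp add: inner_add_left)
  qed
  show "R (r *\<^sub>R f) = r *\<^sub>R R f"
  proof (rule R_eqI)
    show "r *\<^sub>R R f \<in> dom" by (rule subspace_scale[OF dom_subspace R_dom])
    show "ql (r *\<^sub>R R f) v + (r *\<^sub>R R f) \<bullet> v = (r *\<^sub>R f) \<bullet> v" if "v \<in> dom" for v
      using R_eq[OF that, of f] ql_scale[OF R_dom that] by (simp flip: distrib_left)
  qed
qed

lemma R_cscale: "cscale a (R f) = R (cscale a f)"
proof (rule R_eqI[symmetric])
  show "cscale a (R f) \<in> dom" by (rule dom_cscale[OF R_dom])
  show "ql (cscale a (R f)) v + cscale a (R f) \<bullet> v = cscale a f \<bullet> v" if "v \<in> dom" for v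
    using R_eq[OF dom_cscale[OF that], of f] by (simp add: ql_cscale[OF R_dom that] inner_cscale)
qed

lemma R_form: "ql (R f) (R f) + (norm (R f))\<^sup>2 = R f \<bullet> f"
  using R_eq[OF R_dom, of f f] by (simp add: power2_norm_eq_inner inner_commute)

text \<open>For symmetry, both sides equal the form inner product of R f and R g. For the order
  bounds, \<open>R_form\<close> gives |R f|^2 \<le> <R f, f>, and Cauchy-Schwarz then yields |R f|
  \<le> |f|.\<close>

sublocale R: unit_selfadjoint R
proof (rule unit_selfadjoint.intro)
  show "linear R" by (rule R_linear)
  fix f g
  show "R f \<bullet> g = f \<bullet> R g"
    using R_eq[OF R_dom, of f g] R_eq[OF R_dom, of g f] ql_sym[OF R_dom R_dom, of f g] by (simp add: inner_commute)
  have n: "(norm (R f))\<^sup>2 \<le> R f \<bullet> f" using R_form[of f] ql_nonneg[OF R_dom, of f] by linarith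
  then show "0 \<le> R f \<bullet> f" using zero_le_power2 order_trans by blast
  have cs: "R f \<bullet> f \<le> norm (R f) * norm f" by (rule norm_cauchy_schwarz)
  have "norm (R f) \<le> norm f"
  proof (cases "norm (R f) = 0")
    case False
    have "norm (R f) * norm (R f) \<le> norm (R f) * norm f" using n cs by (simp add: power2_eq_square)
    then show ?thesis using False by simp
  qed simp
  then have "norm (R f) * norm f \<le> norm f * norm f" by (intro mult_right_mono) auto
  then show "R f \<bullet> f \<le> f \<bullet> f" using cs by (simp add: power2_norm_eq_inner[symmetric] power2_eq_square)
qed

text \<open>If R f = 0, the defining equation makes f orthogonal to the form domain, which contains
  all finitely supported functions; a = 1 and a = \<i> pick out the real and imaginary part of f at
  x. This is what makes \<open>op_L\<close> single-valued.\<close>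

lemma R_inj: "R f = 0 \<Longrightarrow> f = 0"
proof (rule lsq_eqI)
  fix x assume R0: "R f = 0"
  have "f \<bullet> cscale a (delta x) = 0" for a
  proof -
    have "ql (R f) (cscale a (delta x)) = ql (0 *\<^sub>R R f) (cscale a (delta x))" by (simp add: R0)
    also have "\<dots> = 0" by (subst ql_scale[OF R_dom delta_dom]) simp
    finally show ?thesis using R_eq[OF delta_dom, of f a x] R0 by simp
  qed
  then have "Re (cnj a * coord f x) = 0" for a
    using inner_cscale[of a "delta x" f] inner_delta[of x "cscale (cnj a) f"] by (simp add: inner_commute)
  from this[of 1] this[of \<i>] show "coord f x = coord 0 x" by (simp add: complex_eq_iff)
qed

lemma R_inj_eq: "R f = R g \<longleftrightarrow> f = g"
  using R_inj[of "f - g"] linear_diff[OF R_linear, of f g] by auto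

text \<open>The equation L u = w, rewritten as (L + 1) u = w + u. Its real part is the equation that
  defines R; testing with -\<i> v in place of v supplies the imaginary part.\<close>

lemma weak_equation_iff:
  assumes u: "u \<in> dom"
  shows "(\<forall>v\<in>D. sesq Q v (emb u) = l2inner m v (emb w)) \<longleftrightarrow> R (w + u) = u"
proof
  assume eq: "\<forall>v\<in>D. sesq Q v (emb u) = l2inner m v (emb w)"
  show "R (w + u) = u"
  proof (rule R_eqI[OF u])
    fix v assume v: "v \<in> dom"
    then have "sesq Q (emb v) (emb u) = l2inner m (emb v) (emb w)" using eq by (simp add: dom_def)
    then have "ql v u = v \<bullet> w" by (simp add: ql_def l2inner_emb)
    then show "ql u v + u \<bullet> v = (w + u) \<bullet> v" using ql_sym[OF u v] by (simp add: inner_add_left inner_add_right inner_commute)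
  qed
next
  assume eq: "R (w + u) = u"
  have ql: "ql v u = v \<bullet> w" if v: "v \<in> dom" for v
    using R_eq[OF v, of "w + u"] ql_sym[OF u v] unfolding eq
    by (simp add: inner_add_left inner_add_right inner_commute)
  show "\<forall>v\<in>D. sesq Q v (emb u) = l2inner m v (emb w)"
  proof
    fix v' assume "v' \<in> D"
    then obtain v where v': "v' = emb v" and v: "v \<in> dom" using D_emb by (auto simp: dom_def)
    have "Im (sesq Q (emb v) (emb u)) = - Re (\<i> * sesq Q (emb v) (emb u))" by simp
    also have "\<dots> = - ql v (cscale \<i> u)" by (simp add: ql_def sesq_cscale[OF v u])
    also have "\<dots> = - ql (cscale (- \<i>) v) u" by (simp add: ql_cscale[OF v u])
    also have "\<dots> = - (v \<bullet> cscale \<i> w)" by (simp add: ql[OF dom_cscale[OF v]] inner_cscale)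
    finally show "sesq Q v' (emb u) = l2inner m v' (emb w)"
      unfolding v' l2inner_emb using ql[OF v] by (intro complex_eqI) (simp_all add: ql_def)
  qed
qed

section \<open>Domain and action of L through R\<close>

lemma op_dom_R: "emb (R h) \<in> op_dom m D Q"
proof -
  have "\<forall>v\<in>D. sesq Q v (emb (R h)) = l2inner m v (emb (h - R h))"
    by (subst weak_equation_iff[OF R_dom]) simp
  then show ?thesis
    unfolding op_dom_def using R_dom[of h] emb_l2 by (auto simp: dom_def)
qed

text \<open>Uniqueness in the description is the injectivity of R. Together with
  \<open>op_dom_R\<close> and \<open>op_dom_imp_R\<close> this says that L is the inverse of R minus
  the identity, on the range of R.\<close>

lemma op_L_R: "op_L m D Q (emb (R h)) = emb (h - R h)"
  unfolding op_L_def
proof (rule the_equality)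
  show "emb (h - R h) \<in> l2 m \<and> (\<forall>v\<in>D. sesq Q v (emb (R h)) = l2inner m v (emb (h - R h)))"
    by (subst weak_equation_iff[OF R_dom]) (simp add: emb_l2)
  fix w assume w: "w \<in> l2 m \<and> (\<forall>v\<in>D. sesq Q v (emb (R h)) = l2inner m v w)"
  then obtain k where k: "w = emb k" using l2_emb by blast
  then have "R (k + R h) = R h" using w weak_equation_iff[OF R_dom] by blast
  then have "k = h - R h" unfolding R_inj_eq by (simp add: eq_diff_eq)
  then show "w = emb (h - R h)" using k by simp
qed

lemma op_dom_imp_R:
  assumes "u \<in> op_dom m D Q"
  obtains h where "u = emb (R h)"
proof -
  have u: "u \<in> D" using assms by (simp add: op_dom_def)
  obtain w where w: "w \<in> l2 m" "\<forall>v\<in>D. sesq Q v u = l2inner m v w" using assms by (auto simp: op_dom_def)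
  obtain h where h: "u = emb h" using D_emb[OF u] by blast
  obtain k where k: "w = emb k" using l2_emb[OF w(1)] by blast
  have "R (k + h) = h" using weak_equation_iff[of h k] w(2) u by (simp add: dom_def h k)
  then show thesis using that[of "k + h"] h by simp
qed

end

section \<open>Resolvents and the heat semigroup\<close>

text \<open>With \<open>R = (L + 1)\<^sup>-\<^sup>1\<close>, i.e. \<open>x = 1 / (1 + \<lambda>)\<close>, the spectral multiplier of \<open>e\<^sup>-\<^sup>t\<^sup>L\<close> is
  \<open>x * heat_kernel t x\<close>.\<close>

definition heat_kernel :: "real \<Rightarrow> real \<Rightarrow> real" where
  "heat_kernel t x = (if x = 0 then 0 else exp (- t * (1 / x - 1)) / x)"

lemma heat_kernel_nonneg: "0 \<le> x \<Longrightarrow> 0 \<le> heat_kernel t x"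
  by (simp add: heat_kernel_def)

text \<open>The estimate e^y \<ge> y^2 / 2 at y = t / x beats the factor 1 / x and leaves one power
  of x, which gives continuity at 0.\<close>

lemma heat_kernel_le:
  assumes "t > 0" "x \<ge> 0"
  shows "heat_kernel t x \<le> 2 * exp t / t\<^sup>2 * x"
proof (cases "x = 0")
  case False
  then have x: "x > 0" using assms by simp
  have "0 \<le> t / x" using assms by simp
  then have "(t / x)\<^sup>2 / 2 \<le> exp (t / x)"
    using exp_lower_Taylor_quadratic[of "t / x"] by linarith
  then have "exp (- (t / x)) \<le> 2 * x\<^sup>2 / t\<^sup>2"
    using assms x by (simp add: exp_minus field_simps)
  then have "exp t * exp (- (t / x)) / x \<le> exp t * (2 * x\<^sup>2 / t\<^sup>2) / x"
    using x by (intro divide_right_mono mult_left_mono) auto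
  moreover have "heat_kernel t x = exp t * exp (- (t / x)) / x"
    using x by (simp add: heat_kernel_def exp_add[symmetric] right_diff_distrib)
  moreover have "exp t * (2 * x\<^sup>2 / t\<^sup>2) / x = 2 * exp t / t\<^sup>2 * x"
    using x by (simp add: power2_eq_square)
  ultimately show ?thesis by simp
qed (simp add: heat_kernel_def)

lemma continuous_heat_kernel:
  assumes t: "t > 0"
  shows "continuous_on {0..1} (heat_kernel t)"
  unfolding continuous_on_def
proof
  fix x :: real assume x: "x \<in> {0..1}"
  show "(heat_kernel t \<longlongrightarrow> heat_kernel t x) (at x within {0..1})"
  proof (cases "x = 0")
    case True
    have "((\<lambda>y. 2 * exp t / t\<^sup>2 * y) \<longlongrightarrow> 2 * exp t / t\<^sup>2 * 0) (at (0 :: real) within {0..1})"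
      by (intro tendsto_intros)
    then have lim: "((\<lambda>y. 2 * exp t / t\<^sup>2 * y) \<longlongrightarrow> 0) (at (0 :: real) within {0..1})" by (simp only: mult_zero_right)
    have ev: "eventually (\<lambda>y :: real. y \<in> {0..1}) (at 0 within {0..1})"
      by (simp add: eventually_at_filter)
    have "(heat_kernel t \<longlongrightarrow> 0) (at 0 within {0..1})"
    proof (rule tendsto_sandwich[OF _ _ tendsto_const lim])
      show "eventually (\<lambda>y. 0 \<le> heat_kernel t y) (at 0 within {0..1})"
        using ev by eventually_elim (simp add: heat_kernel_nonneg)
      show "eventually (\<lambda>y. heat_kernel t y \<le> 2 * exp t / t\<^sup>2 * y) (at 0 within {0..1})"
        using ev by eventually_elim (rule heat_kernel_le[OF t], simp)
    qed
    then show ?thesis using True by (simp add: heat_kernel_def)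
  next
    case False
    have "((\<lambda>y. exp (- t * (1 / y - 1)) / y) \<longlongrightarrow> exp (- t * (1 / x - 1)) / x) (at x within {0..1})"
      using False by (intro tendsto_intros) auto
    moreover have "eventually (\<lambda>y. y \<noteq> 0) (at x within {0..1})"
      using False by (intro tendsto_imp_eventually_ne[OF tendsto_ident_at])
    then have "eventually (\<lambda>y. exp (- t * (1 / y - 1)) / y = heat_kernel t y) (at x within {0..1})"
      by eventually_elim (simp add: heat_kernel_def)
    ultimately show ?thesis using False by (simp add: heat_kernel_def[of t x] tendsto_cong)
  qed
qed

definition heat_mult :: "real \<Rightarrow> real \<Rightarrow> real" where
  "heat_mult t x = x * heat_kernel t x"

lemma heat_mult_bounds: "t > 0 \<Longrightarrow> x \<in> {0..1} \<Longrightarrow> 0 \<le> heat_mult t x \<and> heat_mult t x \<le> 1"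
  by (auto simp: heat_mult_def heat_kernel_def)

lemma continuous_heat_mult: "t > 0 \<Longrightarrow> continuous_on {0..1} (heat_mult t)"
  unfolding heat_mult_def[abs_def] by (intro continuous_intros continuous_heat_kernel)

lemma exp_second_order: "\<bar>exp z - 1 - z\<bar> \<le> z\<^sup>2 / 2 * exp \<bar>z\<bar>" for z :: real
proof -
  obtain t where t: "\<bar>t\<bar> \<le> \<bar>z\<bar>" "exp z = (\<Sum>m<2. z ^ m / fact m) + exp t / fact 2 * z ^ 2"
    using Maclaurin_exp_le[of z 2] by auto
  have eq: "exp z - 1 - z = z\<^sup>2 / 2 * exp t" using t(2) by (simp add: numeral_2_eq_2)
  have "z\<^sup>2 / 2 * exp t \<le> z\<^sup>2 / 2 * exp \<bar>z\<bar>" using t(1) by (intro mult_left_mono) auto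
  then show ?thesis unfolding eq by (simp add: abs_mult)
qed

text \<open>With l = 1 / x - 1 this is the Taylor remainder of exp (- t l) as a function of t, at t
  = s. The restriction |r - s| \<le> s / 2 preserves the decay exp (- s l / 2), which absorbs l^2
  and makes the bound uniform in x, hence an operator norm bound.\<close>

lemma heat_mult_difference_quotient:
  assumes s: "s > 0" and r: "\<bar>r - s\<bar> \<le> s / 2" "r \<noteq> s" and x: "x \<in> {0..1}"
  shows "\<bar>1 / (r - s) * (heat_mult r x - heat_mult s x) + (1 - x) * heat_kernel s x\<bar> \<le> 4 / s\<^sup>2 * \<bar>r - s\<bar>"
proof (cases "x = 0")
  case True
  then show ?thesis by (simp add: heat_mult_def heat_kernel_def)
next
  case False
  define l where "l = 1 / x - 1"
  define d where "d = r - s"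
  have x0: "x > 0" and l: "l \<ge> 0" using x False by (auto simp: l_def field_simps)
  have d: "d \<noteq> 0" "\<bar>d\<bar> \<le> s / 2" "r = s + d" using r by (auto simp: d_def)
  have mult: "heat_mult t x = exp (- t * l)" for t using False by (simp add: heat_mult_def heat_kernel_def l_def)
  have kern: "(1 - x) * heat_kernel s x = l * exp (- s * l)"
    using x0 by (simp add: heat_kernel_def l_def field_simps)
  have "1 / d * (exp (- (s + d) * l) - exp (- s * l)) + l * exp (- s * l) = exp (- s * l) * (exp (- d * l) - 1 - (- d * l)) / d"
    using d by (simp add: field_simps exp_add[symmetric])
  then have "\<bar>1 / d * (heat_mult r x - heat_mult s x) + (1 - x) * heat_kernel s x\<bar>
      = exp (- s * l) * \<bar>exp (- d * l) - 1 - (- d * l)\<bar> / \<bar>d\<bar>"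
    unfolding mult kern d(3) by (simp add: abs_mult)
  also have "\<dots> \<le> exp (- s * l) * ((- d * l)\<^sup>2 / 2 * exp \<bar>- d * l\<bar>) / \<bar>d\<bar>"
    by (intro divide_right_mono mult_left_mono exp_second_order) auto
  also have "\<dots> = \<bar>d\<bar> * (l\<^sup>2 / 2 * exp (\<bar>d\<bar> * l - s * l))"
  proof -
    have 1: "\<bar>- d * l\<bar> = \<bar>d\<bar> * l" using l by (simp add: abs_mult)
    have 2: "exp (\<bar>d\<bar> * l - s * l) = exp (- s * l) * exp (\<bar>d\<bar> * l)" by (simp add: exp_add[symmetric])
    have 3: "(- d * l)\<^sup>2 = \<bar>d\<bar> * \<bar>d\<bar> * l\<^sup>2" by (simp add: power_mult_distrib power2_eq_square)
    show ?thesis unfolding 1 2 3 using d(1) by (simp add: field_simps del: abs_mult_self_eq)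
  qed
  also have "\<dots> \<le> \<bar>d\<bar> * (l\<^sup>2 / 2 * exp (- (s / 2 * l)))"
  proof -
    have "\<bar>d\<bar> * l \<le> s / 2 * l" using d(2) l by (rule mult_right_mono)
    then show ?thesis by (intro mult_left_mono) (auto simp: field_simps)
  qed
  also have "\<dots> \<le> \<bar>d\<bar> * (4 / s\<^sup>2)"
  proof -
    have "0 \<le> s / 2 * l" using s l by simp
    then have "(s / 2 * l)\<^sup>2 / 2 \<le> exp (s / 2 * l)"
      using exp_lower_Taylor_quadratic[of "s / 2 * l"] by linarith
    then have "l\<^sup>2 / 2 * exp (- (s / 2 * l)) \<le> 4 / s\<^sup>2"
      using s by (simp add: exp_minus field_simps power2_eq_square)
    then show ?thesis by (intro mult_left_mono) auto
  qed
  finally show ?thesis by (simp add: d_def mult.commute)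
qed

text \<open>The multiplier does not tend to 1 uniformly as t tends to 0. The extra factor x, that
  is, restriction to the range of R, compensates: (1 - exp (- t l)) x \<le> t l x = t (1 -
  x).\<close>

lemma heat_mult_near_zero:
  assumes "t > 0" "x \<in> {0..1}"
  shows "\<bar>(heat_mult t x - 1) * x\<bar> \<le> t"
proof (cases "x = 0")
  case False
  then have x: "x > 0" "x \<le> 1" using assms by auto
  define l where "l = 1 / x - 1"
  have "1 - t * l \<le> exp (- t * l)" using exp_ge_add_one_self[of "- t * l"] by simp
  moreover have m: "heat_mult t x = exp (- t * l)" using x by (simp add: heat_mult_def heat_kernel_def l_def)
  ultimately have "(1 - heat_mult t x) * x \<le> (t * l) * x" using x by (intro mult_right_mono) auto
  also have "\<dots> = t * (1 - x)" using x by (simp add: l_def field_simps)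
  also have "\<dots> \<le> t * 1" using x assms by (intro mult_left_mono) auto
  finally have "(1 - heat_mult t x) * x \<le> t" by simp
  moreover have "0 \<le> (1 - heat_mult t x) * x" using heat_mult_bounds[OF assms] x by simp
  ultimately show ?thesis by (simp add: algebra_simps abs_if)
qed (use assms in simp)

context weighted_closed_form
begin

text \<open>With \<lambda> = 1 / x - 1 the multiplier 1 / (\<lambda> + \<alpha>) is x times this
  kernel. The denominator interpolates linearly between 1 at x = 0 and \<alpha> at x = 1, hence its
  sign.\<close>

lemma continuous_resolvent_kernel:
  assumes "\<alpha> > 0"
  shows "continuous_on {0..1} (\<lambda>x :: real. 1 / (1 + (\<alpha> - 1) * x))"
    and "\<And>x :: real. x \<in> {0..1} \<Longrightarrow> 1 + (\<alpha> - 1) * x > 0"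
proof -
  show pos: "1 + (\<alpha> - 1) * x > 0" if "x \<in> {0..1}" for x :: real
  proof (cases "\<alpha> \<ge> 1")
    case True
    then have "(\<alpha> - 1) * x \<ge> 0" using that by simp
    then show ?thesis by linarith
  next
    case False
    then have "(1 - \<alpha>) * x \<le> (1 - \<alpha>) * 1" using that by (intro mult_left_mono) auto
    then show ?thesis using assms by (simp add: algebra_simps)
  qed
  show "continuous_on {0..1} (\<lambda>x. 1 / (1 + (\<alpha> - 1) * x))"
    using pos by (intro continuous_intros) force
qed

lemma op_fun_R_mult:
  assumes "continuous_on {0..1} k"
  shows "op_fun R (\<lambda>x. x * k x) f = R (op_fun R k f)"
  using R.op_fun_mult[OF continuous_on_id assms, of f] by (simp add: R.op_fun_id)

text \<open>L + \<alpha> sends R h to (1 + (\<alpha> - 1) R) h, and the calculus inverts the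
  function 1 + (\<alpha> - 1) x on [0,1].\<close>

lemma resolvent_op_eq:
  assumes \<alpha>: "\<alpha> > 0"
  shows "resolvent_op m D Q \<alpha> (emb f) = emb (op_fun R (\<lambda>x. x * (1 / (1 + (\<alpha> - 1) * x))) f)"
proof -
  let ?k = "\<lambda>x :: real. 1 / (1 + (\<alpha> - 1) * x)" and ?p = "\<lambda>x :: real. 1 + (\<alpha> - 1) * x"
  note k = continuous_resolvent_kernel(1)[OF \<alpha>] and pos = continuous_resolvent_kernel(2)[OF \<alpha>]
  have p: "continuous_on {0..1} ?p" by (intro continuous_intros)
  have Rp: "op_fun R ?p h = h + (\<alpha> - 1) *\<^sub>R R h" for h
    using R.op_fun_add[of "\<lambda>x. 1" "\<lambda>x. (\<alpha> - 1) * x" h] R.op_fun_scale[of "\<lambda>x. x" "\<alpha> - 1" h]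
    by (simp add: continuous_on_id continuous_on_mult R.op_fun_one R.op_fun_id)
  have kp: "op_fun R ?k (op_fun R ?p h) = h" "op_fun R ?p (op_fun R ?k h) = h" for h
  proof -
    have "op_fun R (\<lambda>x. ?k x * ?p x) h = op_fun R (\<lambda>x. 1) h" "op_fun R (\<lambda>x. ?p x * ?k x) h = op_fun R (\<lambda>x. 1) h"
      by (rule R.op_fun_cong, use pos in force)+
    then show "op_fun R ?k (op_fun R ?p h) = h" "op_fun R ?p (op_fun R ?k h) = h"
      using R.op_fun_mult[OF k p, of h] R.op_fun_mult[OF p k, of h] by (simp_all add: R.op_fun_one)
  qed
  have L: "(\<lambda>x. op_L m D Q (emb (R h)) x + complex_of_real \<alpha> * emb (R h) x) = emb (op_fun R ?p h)" for h
  proof -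
    have "(\<lambda>x. op_L m D Q (emb (R h)) x + complex_of_real \<alpha> * emb (R h) x) = emb (h - R h + \<alpha> *\<^sub>R R h)"
      unfolding op_L_R emb_add emb_scaleR ..
    also have "h - R h + \<alpha> *\<^sub>R R h = op_fun R ?p h"
      unfolding Rp scaleR_diff_left by (simp add: algebra_simps)
    finally show ?thesis .
  qed
  show ?thesis
    unfolding resolvent_op_def op_fun_R_mult[OF k]
  proof (rule the_equality)
    show "emb (R (op_fun R ?k f)) \<in> op_dom m D Q \<and>
      (\<lambda>x. op_L m D Q (emb (R (op_fun R ?k f))) x + complex_of_real \<alpha> * emb (R (op_fun R ?k f)) x) = emb f"
      unfolding L kp using op_dom_R by blast
    fix u assume u: "u \<in> op_dom m D Q \<and> (\<lambda>x. op_L m D Q u x + complex_of_real \<alpha> * u x) = emb f"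
    then obtain h where h: "u = emb (R h)" using op_dom_imp_R by blast
    have "op_fun R ?p h = f" using u unfolding h L emb_inj by blast
    then show "u = emb (R (op_fun R ?k f))" using kp(1)[of h] h by simp
  qed
qed

text \<open>Time 0 is set apart because \<open>heat_mult 0\<close> jumps at x = 0, out of reach of
  the continuous calculus.\<close>

definition heat_flow :: "'a lsq \<Rightarrow> real \<Rightarrow> 'a lsq" where
  "heat_flow f s = (if s > 0 then op_fun R (heat_mult s) f else f)"

lemma heat_flow_R: "s > 0 \<Longrightarrow> heat_flow f s = R (op_fun R (heat_kernel s) f)"
  using op_fun_R_mult[OF continuous_heat_kernel, of s f] by (simp add: heat_flow_def heat_mult_def[abs_def])

text \<open>Contractions that converge on a dense subspace: f is replaced by a nearby R h, where
  \<open>heat_mult_near_zero\<close> gives the rate s.\<close>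

lemma heat_flow_tendsto: "(heat_flow f \<longlongrightarrow> f) (at_right 0)"
proof (rule tendstoI)
  fix e :: real assume e: "e > 0"
  have "f \<in> closure (range R)"
    using injective_symmetric_dense_range[OF R_linear R.sym R_inj] by simp
  then obtain h where h: "dist (R h) f < e / 4"
    using e unfolding closure_approachable by (metis rangeE divide_pos_pos zero_less_numeral)
  have pos: "norm h + 1 > 0" by (simp add: add_nonneg_pos)
  have ev: "eventually (\<lambda>s. 0 < s \<and> s < e / (4 * (norm h + 1))) (at_right 0)"
    by (rule eventually_at_rightI[of 0 "e / (4 * (norm h + 1))"]) (use e pos in auto)
  then show "eventually (\<lambda>s. dist (heat_flow f s) f < e) (at_right 0)"
  proof eventually_elim
    case (elim s)
    then have s: "s > 0" by simp
    note c = continuous_heat_mult[OF s]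
    have id: "continuous_on {0..1} (\<lambda>x :: real. x)" by (rule continuous_on_id)
    have lin: "op_fun R (heat_mult s) f - op_fun R (heat_mult s) (R h) = op_fun R (heat_mult s) (f - R h)"
      using linear_diff[OF R.op_fun_linear[OF c]] by simp
    have 1: "norm (op_fun R (heat_mult s) (f - R h)) \<le> 1 * norm (f - R h)"
      by (rule R.op_fun_norm_le[OF c]) (use heat_mult_bounds[OF s] in force)
    have "op_fun R (heat_mult s) (R h) - R h = op_fun R (\<lambda>x. (heat_mult s x - 1) * x) h"
      using R.op_fun_mult[of "\<lambda>x. heat_mult s x - 1" "\<lambda>x. x" h] R.op_fun_diff[of "heat_mult s" "\<lambda>x. 1" "R h"] c id
      by (simp add: R.op_fun_id R.op_fun_one continuous_on_diff)
    also have "norm \<dots> \<le> s * norm h"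
      by (rule R.op_fun_norm_le) (use heat_mult_near_zero[OF s] c id in \<open>auto intro!: continuous_on_mult continuous_on_diff continuous_on_const\<close>)
    finally have 2: "norm (op_fun R (heat_mult s) (R h) - R h) \<le> s * norm h" .
    have "s * norm h \<le> s * (norm h + 1)" using s by simp
    also have "\<dots> < e / 4" using elim pos by (simp add: field_simps)
    finally have 3: "s * norm h < e / 4" .
    have "norm (op_fun R (heat_mult s) f - f)
      = norm (op_fun R (heat_mult s) (f - R h) + (op_fun R (heat_mult s) (R h) - R h) + (R h - f))"
      unfolding lin[symmetric] by simp
    also have "\<dots> \<le> norm (op_fun R (heat_mult s) (f - R h)) + norm (op_fun R (heat_mult s) (R h) - R h) + norm (R h - f)"
      by (intro order_trans[OF norm_triangle_ineq] add_right_mono norm_triangle_ineq)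
    also have "\<dots> < e" using 1 2 3 h e by (simp add: dist_norm norm_minus_commute)
    finally show ?case using s by (simp add: heat_flow_def dist_norm)
  qed
qed

text \<open>The second bracket is L applied to the flow: the flow is R y with y =
  \<open>op_fun R (heat_kernel s) f\<close>, and L (R y) = y - R y. The whole expression is a single
  multiplier, bounded by \<open>heat_mult_difference_quotient\<close>.\<close>

lemma heat_flow_derivative:
  assumes s: "s > 0"
  shows "((\<lambda>r. (1 / (r - s)) *\<^sub>R (heat_flow f r - heat_flow f s) + (op_fun R (heat_kernel s) f - heat_flow f s)) \<longlongrightarrow> 0) (at s)"
proof -
  note ks = continuous_heat_kernel[OF s] and ms = continuous_heat_mult[OF s]
  have psi: "continuous_on {0..1} (\<lambda>x. (1 - x) * heat_kernel s x)" by (intro continuous_intros ks)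
  have gen: "op_fun R (heat_kernel s) f - heat_flow f s = op_fun R (\<lambda>x. (1 - x) * heat_kernel s x) f"
  proof -
    have "op_fun R (\<lambda>x. (1 - x) * heat_kernel s x) f = op_fun R (\<lambda>x. heat_kernel s x - heat_mult s x) f"
      by (rule R.op_fun_cong) (simp add: heat_mult_def algebra_simps)
    then show ?thesis using R.op_fun_diff[OF ks ms, of f] s by (simp add: heat_flow_def)
  qed
  have bound: "norm ((1 / (r - s)) *\<^sub>R (heat_flow f r - heat_flow f s) + (op_fun R (heat_kernel s) f - heat_flow f s))
      \<le> 4 / s\<^sup>2 * \<bar>r - s\<bar> * norm f" if r: "\<bar>r - s\<bar> < s / 2" "r \<noteq> s" for r
  proof -
    have r0: "r > 0" using r s by linarith
    note mr = continuous_heat_mult[OF r0]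
    have d: "continuous_on {0..1} (\<lambda>x. heat_mult r x - heat_mult s x)" by (intro continuous_intros mr ms)
    have sc: "continuous_on {0..1} (\<lambda>x. 1 / (r - s) * (heat_mult r x - heat_mult s x))"
      by (intro continuous_on_mult continuous_on_const d)
    have "(1 / (r - s)) *\<^sub>R (heat_flow f r - heat_flow f s) + (op_fun R (heat_kernel s) f - heat_flow f s)
      = op_fun R (\<lambda>x. 1 / (r - s) * (heat_mult r x - heat_mult s x) + (1 - x) * heat_kernel s x) f"
      unfolding gen R.op_fun_add[OF sc psi] R.op_fun_scale[OF d] R.op_fun_diff[OF mr ms]
      using r0 s by (simp add: heat_flow_def)
    also have "norm \<dots> \<le> 4 / s\<^sup>2 * \<bar>r - s\<bar> * norm f"
      by (rule R.op_fun_norm_le[OF continuous_on_add[OF sc psi]], rule heat_mult_difference_quotient[OF s])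
         (use r in auto)
    finally show ?thesis .
  qed
  have ev: "eventually (\<lambda>r. norm ((1 / (r - s)) *\<^sub>R (heat_flow f r - heat_flow f s) + (op_fun R (heat_kernel s) f - heat_flow f s))
      \<le> 4 / s\<^sup>2 * \<bar>r - s\<bar> * norm f) (at s)"
    unfolding eventually_at using s bound by (intro exI[of _ "s / 2"]) (auto simp: dist_real_def)
  have "((\<lambda>r. 4 / s\<^sup>2 * \<bar>r - s\<bar> * norm f) \<longlongrightarrow> 4 / s\<^sup>2 * \<bar>s - s\<bar> * norm f) (at s)"
    using s by (intro tendsto_intros) auto
  then have lim: "((\<lambda>r. 4 / s\<^sup>2 * \<bar>r - s\<bar> * norm f) \<longlongrightarrow> 0) (at s)" by simp
  show ?thesis by (rule Lim_null_comparison[OF ev lim])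
qed

lemma l2norm_difference_quotient:
  "l2norm m (\<lambda>x. (emb a x - emb b x) / complex_of_real (r - s) + op_L m D Q (emb (R h)) x)
     = norm ((1 / (r - s)) *\<^sub>R (a - b) + (h - R h))"
proof -
  have "(\<lambda>x. (emb a x - emb b x) / complex_of_real (r - s) + op_L m D Q (emb (R h)) x)
     = emb ((1 / (r - s)) *\<^sub>R (a - b) + (h - R h))"
    unfolding op_L_R emb_add[of "(1 / (r - s)) *\<^sub>R (a - b)"] emb_scaleR emb_diff[of a b] by (auto simp: divide_inverse mult.commute)
  then show ?thesis by simp
qed

lemma heat_flow_solution: "heat_solution m D Q (emb f) (\<lambda>s. emb (heat_flow f s))"
  unfolding heat_solution_def
proof (intro conjI allI impI)
  show "emb (heat_flow f 0) = emb f" by (simp add: heat_flow_def)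
  show "emb (heat_flow f s) \<in> op_dom m D Q" if "s > 0" for s
    unfolding heat_flow_R[OF that] by (rule op_dom_R)
  have "((\<lambda>s. norm (heat_flow f s - f)) \<longlongrightarrow> norm (f - f)) (at_right 0)"
    by (intro tendsto_intros heat_flow_tendsto)
  then show "((\<lambda>s. l2norm m (\<lambda>x. emb (heat_flow f s) x - emb f x)) \<longlongrightarrow> 0) (at_right 0)"
    unfolding emb_diff[symmetric] l2norm_emb by simp
  show "((\<lambda>r. l2norm m (\<lambda>x. (emb (heat_flow f r) x - emb (heat_flow f s) x) / complex_of_real (r - s)
      + op_L m D Q (emb (heat_flow f s)) x)) \<longlongrightarrow> 0) (at s)" if s: "s > 0" for s
    using tendsto_norm_zero[OF heat_flow_derivative[OF s, of f]]
    unfolding heat_flow_R[OF s] l2norm_difference_quotient .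
qed

text \<open>Uniqueness by energy: the squared norm of a difference of solutions has derivative \<open>- 2 Q \<le> 0\<close>
  and vanishes at \<open>0+\<close>.\<close>

lemma heat_solution_unique:
  assumes u1: "heat_solution m D Q f u1" and u2: "heat_solution m D Q f u2" and f: "f \<in> l2 m" and t: "t > 0"
  shows "u1 t = u2 t"
proof -
  \<comment> \<open>As the domain of L is the range of R, a solution has the form U = R H in
    coordinates, and the equation reads U' = - (H - U).\<close>
  have sol: "\<exists>U H. (\<forall>s>0. u s = emb (U s) \<and> U s = R (H s) \<and> (U has_vector_derivative - (H s - U s)) (at s))
      \<and> ((\<lambda>s. norm (U s - g)) \<longlongrightarrow> 0) (at_right 0)"
    if u: "heat_solution m D Q (emb g) u" for u g
  proof -
    have "\<forall>s. \<exists>h. s > 0 \<longrightarrow> u s = emb (R h)" using u op_dom_imp_R unfolding heat_solution_def by metis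
    then obtain H where H: "\<And>s. s > 0 \<Longrightarrow> u s = emb (R (H s))" by metis
    define U where "U s = R (H s)" for s
    have U: "u s = emb (U s)" if "s > 0" for s using H that by (simp add: U_def)
    have der: "(U has_vector_derivative - (H s - U s)) (at s)" if s: "s > 0" for s
    proof -
      have "((\<lambda>r. l2norm m (\<lambda>x. (u r x - u s x) / complex_of_real (r - s) + op_L m D Q (u s) x)) \<longlongrightarrow> 0) (at s)"
        using u s unfolding heat_solution_def by blast
      moreover have "eventually (\<lambda>r. l2norm m (\<lambda>x. (u r x - u s x) / complex_of_real (r - s) + op_L m D Q (u s) x)
          = norm ((1 / (r - s)) *\<^sub>R (U r - U s) + (H s - U s))) (at s)"
      proof -
        have "eventually (\<lambda>r. r > 0) (at s)" using s by (intro order_tendstoD(1)[OF tendsto_ident_at])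
        then show ?thesis
        proof eventually_elim
          case (elim r)
          show ?case
            unfolding U[OF elim] U[OF s] using l2norm_difference_quotient[of "U r" "U s" r s "H s"] by (simp add: U_def)
        qed
      qed
      ultimately have 0: "((\<lambda>r. norm ((1 / (r - s)) *\<^sub>R (U r - U s) + (H s - U s))) \<longlongrightarrow> 0) (at s)"
        by (rule Lim_transform_eventually)
      have "norm ((1 / (r - s)) *\<^sub>R (U r - U s) + (H s - U s)) = norm ((U r - U s) - (r - s) *\<^sub>R (- (H s - U s))) / norm (r - s)"
        if "r \<noteq> s" for r
      proof -
        have "(1 / (r - s)) *\<^sub>R (U r - U s) + (H s - U s) = (1 / (r - s)) *\<^sub>R ((U r - U s) - (r - s) *\<^sub>R (- (H s - U s)))"
          using that unfolding scaleR_minus_right diff_minus_eq_add scaleR_add_right by simp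
        then show ?thesis by simp
      qed
      then have "eventually (\<lambda>r. norm ((1 / (r - s)) *\<^sub>R (U r - U s) + (H s - U s))
          = norm ((U r - U s) - (r - s) *\<^sub>R (- (H s - U s))) / norm (r - s)) (at s)"
        unfolding eventually_at_filter by (intro always_eventually) blast
      then have "((\<lambda>r. norm ((U r - U s) - (r - s) *\<^sub>R (- (H s - U s))) / norm (r - s)) \<longlongrightarrow> 0) (at s)"
        by (rule Lim_transform_eventually[OF 0])
      then show ?thesis
        unfolding has_vector_derivative_def has_derivative_iff_norm by (simp add: bounded_linear_scaleR_left)
    qed
    have "((\<lambda>s. l2norm m (\<lambda>x. u s x - emb g x)) \<longlongrightarrow> 0) (at_right 0)"
      using u unfolding heat_solution_def by blast
    moreover have "eventually (\<lambda>s. l2norm m (\<lambda>x. u s x - emb g x) = norm (U s - g)) (at_right 0)"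
      using eventually_at_right_less[of 0]
      by eventually_elim (simp add: U emb_diff[symmetric])
    ultimately have lim: "((\<lambda>s. norm (U s - g)) \<longlongrightarrow> 0) (at_right 0)"
      by (rule Lim_transform_eventually)
    show ?thesis
    proof (rule exI[of _ U], rule exI[of _ H], intro conjI allI impI lim)
      show "U s = R (H s)" for s by (rule U_def)
    qed (rule U der, assumption)+
  qed
  obtain g where g: "f = emb g" using l2_emb[OF f] by blast
  obtain U1 H1 where 1: "\<And>s. s > 0 \<Longrightarrow> u1 s = emb (U1 s)" "\<And>s. s > 0 \<Longrightarrow> U1 s = R (H1 s)"
      "\<And>s. s > 0 \<Longrightarrow> (U1 has_vector_derivative - (H1 s - U1 s)) (at s)" "((\<lambda>s. norm (U1 s - g)) \<longlongrightarrow> 0) (at_right 0)"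
    using sol[OF u1[unfolded g]] by metis
  obtain U2 H2 where 2: "\<And>s. s > 0 \<Longrightarrow> u2 s = emb (U2 s)" "\<And>s. s > 0 \<Longrightarrow> U2 s = R (H2 s)"
      "\<And>s. s > 0 \<Longrightarrow> (U2 has_vector_derivative - (H2 s - U2 s)) (at s)" "((\<lambda>s. norm (U2 s - g)) \<longlongrightarrow> 0) (at_right 0)"
    using sol[OF u2[unfolded g]] by metis
  define W where "W s = U1 s - U2 s" for s
  define E where "E s = W s \<bullet> W s" for s
  have dE: "\<exists>y. (E has_real_derivative y) (at s) \<and> y \<le> 0" if s: "s > 0" for s
  proof -
    let ?h = "H1 s - H2 s"
    have W: "W s = R ?h" unfolding W_def 1(2)[OF s] 2(2)[OF s] by (simp add: linear_diff[OF R_linear])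
    have "(W has_vector_derivative - (H1 s - U1 s) - - (H2 s - U2 s)) (at s)"
      unfolding W_def[abs_def] by (intro has_vector_derivative_diff 1 2 s)
    then have W': "(W has_vector_derivative - (?h - W s)) (at s)" by (simp add: W_def algebra_simps)
    have "((\<lambda>s. W s \<bullet> W s) has_vector_derivative W s \<bullet> - (?h - W s) + - (?h - W s) \<bullet> W s) (at s)"
      by (rule bounded_bilinear.has_vector_derivative[OF bounded_bilinear_inner W' W'])
    then have "(E has_real_derivative (W s \<bullet> - (?h - W s) + - (?h - W s) \<bullet> W s)) (at s)"
      unfolding E_def[abs_def] has_real_derivative_iff_has_vector_derivative .
    \<comment> \<open>By \<open>R_form\<close>, <R h, h - R h> is the value of the form at R h; this
      fixes the sign of the derivative.\<close>
    moreover have "W s \<bullet> - (?h - W s) + - (?h - W s) \<bullet> W s = - 2 * ql (W s) (W s)"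
    proof -
      have "W s \<bullet> (?h - W s) = ql (W s) (W s)"
        using R_form[of ?h] unfolding W[symmetric] by (simp add: inner_diff_right power2_norm_eq_inner)
      then show ?thesis
        unfolding inner_minus_left inner_minus_right inner_commute[of "?h - W s" "W s"] by simp
    qed
    moreover have "ql (W s) (W s) \<ge> 0" unfolding W by (rule ql_nonneg[OF R_dom])
    ultimately show ?thesis by (intro exI[of _ "- 2 * ql (W s) (W s)"]) simp
  qed
  have mono: "E t \<le> E s" if "0 < s" "s \<le> t" for s
    by (rule DERIV_nonpos_imp_nonincreasing[OF that(2)]) (use dE that in auto)
  have "((\<lambda>s. (U1 s - g) - (U2 s - g)) \<longlongrightarrow> 0 - 0) (at_right 0)"
    using 1(4) 2(4) unfolding tendsto_norm_zero_iff by (rule tendsto_diff)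
  then have "(W \<longlongrightarrow> 0) (at_right 0)" by (simp add: W_def[abs_def])
  then have "(E \<longlongrightarrow> (0 :: 'a lsq) \<bullet> 0) (at_right 0)"
    unfolding E_def[abs_def] by (intro tendsto_inner)
  moreover have "eventually (\<lambda>s. E t \<le> E s) (at_right 0)"
    unfolding eventually_at_right[of 0 t, OF t] using t mono by (intro exI[of _ t]) auto
  ultimately have "E t \<le> 0 \<bullet> (0 :: 'a lsq)" by (intro tendsto_lowerbound) auto
  then have "W t \<bullet> W t = 0" using inner_ge_zero[of "W t"] unfolding E_def inner_zero_left by linarith
  then have "W t = 0" by simp
  then show ?thesis using 1(1)[OF t] 2(1)[OF t] by (simp add: W_def)
qed

lemma heat_op_eq:
  assumes "t > 0"
  shows "heat_op m D Q t (emb f) = emb (op_fun R (\<lambda>x. x * heat_kernel t x) f)"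
proof -
  have e: "emb (heat_flow f t) = emb (op_fun R (\<lambda>x. x * heat_kernel t x) f)"
    using assms by (simp add: heat_flow_def heat_mult_def[abs_def])
  show ?thesis
    unfolding heat_op_def e[symmetric]
  proof (rule the_equality)
    show "\<exists>u. heat_solution m D Q (emb f) u \<and> emb (heat_flow f t) = u t"
      using heat_flow_solution by blast
    show "g = emb (heat_flow f t)" if "\<exists>u. heat_solution m D Q (emb f) u \<and> g = u t" for g
      using that heat_solution_unique[OF _ heat_flow_solution emb_l2 assms] by blast
  qed
qed

end

section \<open>Boundedness into \<open>\<ell>\<^sup>\<infinity>\<close> and trace class\<close>

lemma has_sum_sum_finite:
  fixes f :: "'i \<Rightarrow> 'a \<Rightarrow> real"
  assumes "finite I" "\<And>i. i \<in> I \<Longrightarrow> (f i has_sum s i) A"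
  shows "((\<lambda>x. \<Sum>i\<in>I. f i x) has_sum (\<Sum>i\<in>I. s i)) A"
  using assms by (induction I rule: finite_induct) (auto intro!: has_sum_add)

lemma inner_cscale_self: "h \<bullet> cscale a h = Re a * (norm h)\<^sup>2"
proof -
  have "h \<bullet> cscale a h = (\<Sum>\<^sub>\<infinity>x. Re a * (cmod (coord h x))\<^sup>2)"
    unfolding inner_lsq_def
    by (rule infsum_cong) (simp only: cmod_power2, simp add: power2_eq_square algebra_simps)
  also have "\<dots> = Re a * (\<Sum>\<^sub>\<infinity>x. (cmod (coord h x))\<^sup>2)"
    by (rule infsum_cmult_right) (use coord_summable[of h] in \<open>simp add: square_summable_def\<close>)
  finally show ?thesis by (simp add: norm_lsq_sq)
qed

context weighted_closed_form
begin

lemma op_fun_R_cscale: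
  "continuous_on {0..1} g \<Longrightarrow> cscale a (op_fun R g f) = op_fun R g (cscale a f)"
  by (rule R.op_fun_commute[OF _ bounded_linear_cscale R_cscale])

lemma op_fun_bounded_linear:
  assumes g: "continuous_on {0..1} g"
  shows "bounded_linear (op_fun R g)"
proof -
  obtain M where M: "\<And>x. x \<in> {0..1} \<Longrightarrow> \<bar>g x\<bar> \<le> M" using continuous_on_unit_bounded[OF g] by metis
  show ?thesis
    using R.op_fun_linear[OF g] R.op_fun_norm_le[OF g M]
    by (intro bounded_linear_intro[of _ M]) (auto simp: linear_add linear_scale mult.commute)
qed

text \<open>T is known only on ell^2, where it is G seen through the unitary \<open>emb\<close>.
  Real linearity of G together with commutation with complex scalars is complex linearity.\<close>

lemma complex_linear_represented:
  assumes T: "\<And>h. T (emb h) = emb (G h)" and G: "linear G" "\<And>a h. cscale a (G h) = G (cscale a h)"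
    and fg: "f \<in> l2 m" "g \<in> l2 m"
  shows "T (\<lambda>x. a * f x + b * g x) = (\<lambda>x. a * T f x + b * T g x)"
proof -
  obtain h k where hk: "f = emb h" "g = emb k" using fg l2_emb by metis
  have "T (\<lambda>x. a * f x + b * g x) = emb (G (cscale a h + cscale b k))"
    unfolding hk emb_lincomb[symmetric] T ..
  also have "\<dots> = emb (cscale a (G h) + cscale b (G k))" by (simp add: linear_add[OF G(1)] G(2))
  finally show ?thesis unfolding emb_lincomb hk T .
qed

lemma bounded_op_represented:
  assumes T: "\<And>h. T (emb h) = emb (G h)" and G: "bounded_linear G" "\<And>a h. cscale a (G h) = G (cscale a h)"
  shows "bounded_op m T"
  unfolding bounded_op_def
proof (intro conjI ballI allI)
  show "T f \<in> l2 m" if "f \<in> l2 m" for f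
    using l2_emb[OF that] by (metis T emb_l2)
  show "T (\<lambda>x. a * f x + b * g x) = (\<lambda>x. a * T f x + b * T g x)" if "f \<in> l2 m" "g \<in> l2 m" for f g a b
    by (rule complex_linear_represented[OF T bounded_linear.linear[OF G(1)] G(2) that])
  obtain C where C: "\<And>h. norm (G h) \<le> norm h * C" using bounded_linear.bounded[OF G(1)] by blast
  show "\<exists>C. \<forall>f\<in>l2 m. l2norm m (T f) \<le> C * l2norm m f"
  proof (intro exI[of _ C] ballI)
    fix f assume "f \<in> l2 m"
    then obtain h where "f = emb h" using l2_emb by blast
    then show "l2norm m (T f) \<le> C * l2norm m f" using C[of h] by (simp add: T mult.commute)
  qed
qed

lemma bounded_op_imp_represented:
  assumes S: "bounded_op m S"
  obtains G where "\<And>h. S (emb h) = emb (G h)" "bounded_linear G" "\<And>a h. cscale a (G h) = G (cscale a h)"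
proof -
  have "\<exists>k. S (emb h) = emb k" for h
    using S l2_emb unfolding bounded_op_def by (metis emb_l2)
  then obtain G where G: "\<And>h. S (emb h) = emb (G h)" by metis
  have lin: "G (cscale a h + cscale b k) = cscale a (G h) + cscale b (G k)" for a b h k
  proof -
    have "S (\<lambda>x. a * emb h x + b * emb k x) = (\<lambda>x. a * S (emb h) x + b * S (emb k) x)"
      using S emb_l2 unfolding bounded_op_def by blast
    then show ?thesis unfolding emb_lincomb[symmetric] G emb_inj .
  qed
  obtain C where C: "\<forall>f\<in>l2 m. l2norm m (S f) \<le> C * l2norm m f" using S unfolding bounded_op_def by blast
  have "bounded_linear G"
  proof (rule bounded_linear_intro[of _ C])
    show "G (h + k) = G h + G k" for h k using lin[of 1 h 1 k] by simp
    show "G (r *\<^sub>R h) = r *\<^sub>R G h" for r h using lin[of "complex_of_real r" h 0 h] by simp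
    show "norm (G h) \<le> norm h * C" for h using bspec[OF C emb_l2[of h]] by (simp add: G mult.commute)
  qed
  moreover have "cscale a (G h) = G (cscale a h)" for a h using lin[of a h 0 h] by simp
  ultimately show thesis using that G by blast
qed

text \<open>A positive operator is its own absolute value; that the description determines it is the
  uniqueness of nonnegative square roots, applied on \<open>lsq\<close>.\<close>

lemma abs_op_represented:
  assumes T: "\<And>h. T (emb h) = emb (G h)" and G: "bounded_linear G" "\<And>a h. cscale a (G h) = G (cscale a h)"
    and sym: "\<And>f g. G f \<bullet> g = f \<bullet> G g" and nonneg: "\<And>f. 0 \<le> G f \<bullet> f"
  shows "abs_op m T (emb h) = emb (G h)"
proof -
  \<comment> \<open>\<open>abs_op\<close> is normalised to 0 outside ell^2, whereas T may be
    anything there.\<close>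
  define S0 where "S0 f = (if f \<in> l2 m then T f else (\<lambda>x. 0))" for f
  have S0: "S0 (emb h) = emb (G h)" for h by (simp add: S0_def T)
  have "abs_op m T = S0"
    unfolding abs_op_def
  proof (rule the_equality, intro conjI ballI allI impI)
    show "bounded_op m S0" by (rule bounded_op_represented[OF S0 G])
    show "S0 f = (\<lambda>x. 0)" if "f \<notin> l2 m" for f using that by (simp add: S0_def)
    fix f assume "f \<in> l2 m"
    then obtain h where h: "f = emb h" using l2_emb by blast
    have "h \<bullet> cscale \<i> (G h) = - (h \<bullet> cscale \<i> (G h))"
    proof -
      have "h \<bullet> cscale \<i> (G h) = G h \<bullet> cscale \<i> h" unfolding G(2) by (rule sym[symmetric])
      also have "\<dots> = cscale (- \<i>) (G h) \<bullet> h" by (simp add: inner_cscale)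
      also have "cscale (- \<i>) (G h) = - cscale \<i> (G h)" by (rule lsq_eqI) simp
      finally show ?thesis by (simp add: inner_commute)
    qed
    then show "Im (l2inner m f (S0 f)) = 0" by (simp add: h S0 l2inner_emb)
    show "0 \<le> Re (l2inner m f (S0 f))" using nonneg[of h] by (simp add: h S0 l2inner_emb inner_commute)
    show "l2inner m (S0 f) (S0 g) = l2inner m (T f) (T g)" if "g \<in> l2 m" for g
      using that \<open>f \<in> l2 m\<close> by (simp add: S0_def)
  next
    fix S assume S: "bounded_op m S \<and> (\<forall>f. f \<notin> l2 m \<longrightarrow> S f = (\<lambda>x. 0)) \<and>
       (\<forall>f\<in>l2 m. Im (l2inner m f (S f)) = 0 \<and> Re (l2inner m f (S f)) \<ge> 0) \<and>
       (\<forall>f\<in>l2 m. \<forall>g\<in>l2 m. l2inner m (S f) (S g) = l2inner m (T f) (T g))"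
    obtain P where P: "\<And>h. S (emb h) = emb (P h)" "bounded_linear P" "\<And>a h. cscale a (P h) = P (cscale a h)"
      using bounded_op_imp_represented S by metis
    note lP = bounded_linear.linear[OF P(2)]
    have im: "h \<bullet> cscale \<i> (P h) = 0" and re: "0 \<le> P h \<bullet> h" for h
    proof -
      have "Im (l2inner m (emb h) (S (emb h))) = 0 \<and> Re (l2inner m (emb h) (S (emb h))) \<ge> 0"
        using S emb_l2[of h] by blast
      then show "h \<bullet> cscale \<i> (P h) = 0" "0 \<le> P h \<bullet> h" by (simp_all add: P(1) l2inner_emb inner_commute)
    qed
    \<comment> \<open>The definition only makes the diagonal <h, P h> real; polarizing with \<i> h +
      k turns this into symmetry.\<close>
    have "P h \<bullet> k = h \<bullet> P k" for h k
    proof -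
      have "cscale \<i> h \<bullet> cscale \<i> (P k) + k \<bullet> cscale \<i> (P (cscale \<i> h)) = 0"
        using im[of "cscale \<i> h + k"] im[of "cscale \<i> h"] im[of k]
        by (simp add: linear_add[OF lP] inner_add_left inner_add_right)
      then show ?thesis by (simp add: P(3)[symmetric] inner_cscale inner_commute)
    qed
    moreover have "P (P h) = G (G h)" for h
    proof -
      have eq: "P h \<bullet> P k = G h \<bullet> G k" for k
      proof -
        have "l2inner m (S (emb h)) (S (emb k)) = l2inner m (T (emb h)) (T (emb k))" using S emb_l2 by blast
        then show ?thesis by (simp add: P(1) T l2inner_emb)
      qed
      have "(P (P h) - G (G h)) \<bullet> k = 0" for k
        using eq[of k] \<open>\<And>h k. P h \<bullet> k = h \<bullet> P k\<close>[of "P h" k] sym[of "G h" k] by (simp add: inner_diff_left)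
      then have "P (P h) - G (G h) = 0" using inner_eq_zero_iff by blast
      then show ?thesis by simp
    qed
    ultimately have "P = G" using re by (intro nonneg_sqrt_unique[OF P(2) _ _ G(1) sym nonneg])
    show "S = S0"
    proof
      fix f
      show "S f = S0 f"
      proof (cases "f \<in> l2 m")
        case True
        then show ?thesis using l2_emb[OF True] P(1) S0 \<open>P = G\<close> by metis
      next
        case False
        then show ?thesis using S by (simp add: S0_def)
      qed
    qed
  qed
  then show ?thesis by (simp add: S0)
qed

end

locale sup_bounded_form = weighted_closed_form m D Q
  for m :: "'a \<Rightarrow> real" and D Q +
  fixes B :: real
  assumes B_nonneg: "B \<ge> 0"
    and sup_bound: "\<And>u x. u \<in> D \<Longrightarrow> (cmod (u x))\<^sup>2 \<le> B * (Q u + (l2norm m u)\<^sup>2)"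
begin

section \<open>The sup bound applied to R\<close>

lemma emb_R_bound: "(cmod (emb (R h) x))\<^sup>2 \<le> B * (R h \<bullet> h)"
  using sup_bound[of "emb (R h)" x] R_dom[of h] R_form[of h] ql_self[OF R_dom, of h]
  by (simp add: dom_def)

lemma coord_R_bound: "(cmod (coord (R h) x))\<^sup>2 \<le> B * m x * (R h \<bullet> h)"
proof -
  have "(cmod (coord (R h) x))\<^sup>2 = (cmod (emb (R h) x))\<^sup>2 * m x" by (simp add: of_lsq_norm_term[where m = m, OF m])
  also have "\<dots> \<le> B * (R h \<bullet> h) * m x" using m[of x] by (intro mult_right_mono emb_R_bound) auto
  finally show ?thesis by (simp add: mult_ac)
qed

text \<open>By \<open>coord_R_bound\<close> at h = \<open>delta x\<close> the diagonal entry t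
  satisfies t^2 \<le> B m(x) t, and t cancels. The weight m(x) comes from passing to unweighted
  coordinates.\<close>

lemma R_delta_bound: "R (delta x) \<bullet> delta x \<le> B * m x"
proof (rule ccontr)
  let ?t = "R (delta x) \<bullet> delta x"
  assume "\<not> ?t \<le> B * m x"
  then have lt: "B * m x < ?t" by simp
  have "0 \<le> B * m x" using B_nonneg m[of x] by simp
  have "\<bar>?t\<bar> \<le> cmod (coord (R (delta x)) x)"
    by (subst inner_commute) (simp add: inner_delta abs_Re_le_cmod)
  then have "?t\<^sup>2 \<le> (cmod (coord (R (delta x)) x))\<^sup>2" using power_mono[of "\<bar>?t\<bar>" _ 2] by simp
  also have "\<dots> \<le> B * m x * ?t" by (rule coord_R_bound)
  also have "\<dots> < ?t * ?t" using lt \<open>0 \<le> B * m x\<close> by (intro mult_strict_right_mono) auto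
  finally show False by (simp add: power2_eq_square)
qed

lemma bounded_l2_linfty_represented:
  assumes k: "continuous_on {0..1} k" and T: "\<And>h. T (emb h) = emb (op_fun R (\<lambda>x. x * k x) h)"
  shows "bounded_l2_linfty m T"
  unfolding bounded_l2_linfty_def
proof (intro conjI ballI allI)
  have g: "continuous_on {0..1} (\<lambda>x. x * k x)" by (intro continuous_intros k)
  show "T (\<lambda>x. a * f x + b * h x) = (\<lambda>x. a * T f x + b * T h x)" if "f \<in> l2 m" "h \<in> l2 m" for f h a b
    by (rule complex_linear_represented[OF T R.op_fun_linear[OF g] op_fun_R_cscale[OF g] that])
  obtain M where M: "\<And>x. x \<in> {0..1} \<Longrightarrow> \<bar>k x\<bar> \<le> M" using continuous_on_unit_bounded[OF k] by metis
  have M0: "M \<ge> 0" using M[of 0] by simp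
  show "\<exists>C. \<forall>f\<in>l2 m. \<forall>x. cmod (T f x) \<le> C * l2norm m f"
  proof (intro exI[of _ "sqrt B * M"] ballI allI)
    fix f x assume "f \<in> l2 m"
    then obtain h where h: "f = emb h" using l2_emb by blast
    let ?y = "op_fun R k h"
    have "(cmod (T f x))\<^sup>2 \<le> B * (R ?y \<bullet> ?y)" unfolding h T op_fun_R_mult[OF k] by (rule emb_R_bound)
    also have "\<dots> \<le> B * (norm ?y)\<^sup>2" using R.le_id[of ?y] B_nonneg by (intro mult_left_mono) (auto simp: power2_norm_eq_inner)
    also have "\<dots> \<le> B * (M * norm h)\<^sup>2"
      using B_nonneg by (intro mult_left_mono power_mono R.op_fun_norm_le k M) auto
    also have "\<dots> = (sqrt B * M * norm h)\<^sup>2" using B_nonneg by (simp add: power_mult_distrib)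
    finally show "cmod (T f x) \<le> sqrt B * M * l2norm m f"
      using B_nonneg M0 by (simp add: h power2_le_iff_abs_le)
  qed
qed

text \<open>If M bounds k, then 0 \<le> R k(R) \<le> M R. The operator is its own absolute value, so
  its diagonal entry at \<open>onb m x\<close> is at most M B m(x).\<close>

lemma trace_class_represented:
  assumes k: "continuous_on {0..1} k" and k0: "\<And>x. x \<in> {0..1} \<Longrightarrow> 0 \<le> k x"
    and T: "\<And>h. T (emb h) = emb (op_fun R (\<lambda>x. x * k x) h)"
    and sm: "m summable_on UNIV"
  shows "trace_class m T"
proof -
  have g: "continuous_on {0..1} (\<lambda>x. x * k x)" by (intro continuous_intros k)
  let ?G = "op_fun R (\<lambda>x. x * k x)"
  have nn: "0 \<le> ?G f \<bullet> f" for f by (rule R.op_fun_nonneg[OF g]) (use k0 in auto)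
  obtain M where M: "\<And>x. x \<in> {0..1} \<Longrightarrow> \<bar>k x\<bar> \<le> M" using continuous_on_unit_bounded[OF k] by metis
  have M0: "M \<ge> 0" using M[of 0] by simp
  have le: "?G f \<bullet> f \<le> M * (R f \<bullet> f)" for f
  proof -
    have cM: "continuous_on {0..1} (\<lambda>x :: real. M * x)" by (intro continuous_intros)
    have "0 \<le> op_fun R (\<lambda>x. M * x - x * k x) f \<bullet> f"
    proof (rule R.op_fun_nonneg)
      show "continuous_on {0..1} (\<lambda>x. M * x - x * k x)" by (intro continuous_intros k)
      show "0 \<le> M * x - x * k x" if x: "x \<in> {0..1}" for x
        using mult_left_mono[of "k x" M x] M[OF x] x by (simp add: mult.commute)
    qed
    also have "op_fun R (\<lambda>x. M * x - x * k x) f = M *\<^sub>R R f - ?G f"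
      unfolding R.op_fun_diff[OF cM g] using R.op_fun_scale[OF continuous_on_id, of M f] by (simp add: R.op_fun_id)
    finally show ?thesis by (simp add: inner_diff_left)
  qed
  have abs: "abs_op m T (emb h) = emb (?G h)" for h
    by (rule abs_op_represented[OF T op_fun_bounded_linear[OF g] op_fun_R_cscale[OF g] R.op_fun_sym[OF g] nn])
  have "(\<lambda>x. Re (l2inner m (onb m x) (abs_op m T (onb m x)))) summable_on UNIV"
  proof (rule summable_on_le)
    show "(\<lambda>x. M * B * m x) summable_on UNIV" by (intro summable_on_cmult_right sm)
    fix x
    have "Re (l2inner m (onb m x) (abs_op m T (onb m x))) = ?G (delta x) \<bullet> delta x"
      unfolding emb_delta[symmetric] abs l2inner_emb by (simp add: inner_commute)
    moreover have "?G (delta x) \<bullet> delta x \<le> M * (B * m x)"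
      using le[of "delta x"] mult_left_mono[OF R_delta_bound M0, of x] by linarith
    ultimately show "\<bar>Re (l2inner m (onb m x) (abs_op m T (onb m x)))\<bar> \<le> M * B * m x"
      using nn[of "delta x"] by simp
  qed
  then show ?thesis
    unfolding trace_class_def
    using bounded_op_represented[OF T op_fun_bounded_linear[OF g] op_fun_R_cscale[OF g]] by blast
qed

end

section \<open>Discreteness of the spectrum\<close>

text \<open>Domination leaves little mass outside a finite set F, and on F pointwise convergence is
  uniform. Turns vertexwise limits into norm limits for the compactness of R.\<close>

lemma lsq_dominated_convergence:
  fixes X :: "nat \<Rightarrow> 'a lsq"
  assumes w: "w summable_on UNIV" and dom: "\<And>n x. (cmod (coord (X n) x))\<^sup>2 \<le> w x"
    and lim: "\<And>x. (\<lambda>n. coord (X n) x) \<longlonglongrightarrow> l x"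
  shows "\<exists>g. X \<longlonglongrightarrow> g"
proof -
  have l: "(cmod (l x))\<^sup>2 \<le> w x" for x
    by (rule tendsto_upperbound[where F = sequentially and f = "\<lambda>n. (cmod (coord (X n) x))\<^sup>2"])
       (use dom in \<open>auto intro!: tendsto_intros lim\<close>)
  have "square_summable l"
    unfolding square_summable_def by (rule summable_on_le[OF w]) (use l in auto)
  then have cl: "coord (Abs_lsq l) = l" by simp
  have w0: "0 \<le> w x" for x using l[of x] zero_le_power2 order_trans by blast
  have diff: "(cmod (coord (X n) x - l x))\<^sup>2 \<le> 4 * w x" for n x
  proof -
    have "(cmod (coord (X n) x - l x))\<^sup>2 \<le> (cmod (coord (X n) x) + cmod (l x))\<^sup>2"
      by (intro power_mono norm_triangle_ineq4) auto
    also have "\<dots> \<le> 2 * (cmod (coord (X n) x))\<^sup>2 + 2 * (cmod (l x))\<^sup>2"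
      using sum_squares_bound[of "cmod (coord (X n) x)" "cmod (l x)"] by (simp add: power2_sum)
    also have "\<dots> \<le> 4 * w x" using dom[of n x] l[of x] by linarith
    finally show ?thesis .
  qed
  have "X \<longlonglongrightarrow> Abs_lsq l"
  proof (rule LIMSEQ_I)
    fix e :: real assume e: "e > 0"
    define d where "d = (e / 2)\<^sup>2"
    have d: "d > 0" using e by (simp add: d_def)
    \<comment> \<open>The budget d = (e/2)^2 splits into 4 * d / 8 for the tail, by
      \<open>diff\<close>, and d / 2 for F.\<close>
    obtain F where F: "finite F" "dist (sum w F) (infsum w UNIV) \<le> d / 8"
      using infsum_finite_approximation[OF w, of "d / 8"] d by auto
    have tail: "sum w (A - F) \<le> d / 8" if "finite A" for A
    proof -
      have "sum w (A - F) + sum w F = sum w (A \<union> F)"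
        by (subst sum.union_disjoint[symmetric]) (use that F(1) in \<open>auto simp: Un_Diff_cancel2\<close>)
      also have "\<dots> \<le> infsum w UNIV"
        by (rule finite_sum_le_infsum[OF w]) (use that F(1) w0 in auto)
      finally show ?thesis using F(2) unfolding dist_real_def by linarith
    qed
    have "(\<lambda>n. \<Sum>x\<in>F. (cmod (coord (X n) x - l x))\<^sup>2) \<longlonglongrightarrow> (\<Sum>x\<in>F. (cmod (l x - l x))\<^sup>2)"
      by (intro tendsto_intros lim)
    then have "eventually (\<lambda>n. (\<Sum>x\<in>F. (cmod (coord (X n) x - l x))\<^sup>2) < d / 2) sequentially"
      using d by (intro order_tendstoD) auto
    then obtain N where N: "\<And>n. n \<ge> N \<Longrightarrow> (\<Sum>x\<in>F. (cmod (coord (X n) x - l x))\<^sup>2) < d / 2"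
      unfolding eventually_sequentially by blast
    have "norm (X n - Abs_lsq l) \<le> e / 2" if n: "n \<ge> N" for n
    proof (rule norm_lsq_leI)
      fix A :: "'a set" assume A: "finite A"
      let ?f = "\<lambda>x. (cmod (coord (X n) x - l x))\<^sup>2"
      have "sum ?f A \<le> sum ?f ((A - F) \<union> F)" using A F(1) by (intro sum_mono2) auto
      also have "\<dots> = sum ?f (A - F) + sum ?f F" using A F(1) by (intro sum.union_disjoint) auto
      also have "sum ?f (A - F) \<le> (\<Sum>x\<in>A - F. 4 * w x)" by (intro sum_mono diff)
      also have "\<dots> = 4 * sum w (A - F)" by (simp add: sum_distrib_left)
      also have "4 * sum w (A - F) + sum ?f F \<le> d" using tail[OF A] N[OF n] by linarith
      finally show "(\<Sum>x\<in>A. (cmod (coord (X n - Abs_lsq l) x))\<^sup>2) \<le> (e / 2)\<^sup>2"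
        by (simp add: d_def cl)
    qed (use e in simp)
    then show "\<exists>N. \<forall>n\<ge>N. norm (X n - Abs_lsq l) < e" using e by (intro exI[of _ N]) force
  qed
  then show ?thesis by blast
qed

locale finite_sup_bounded_form = sup_bounded_form m D Q B
  for m :: "'a::countable \<Rightarrow> real" and D Q B +
  assumes m_summable: "m summable_on UNIV"
begin

text \<open>Countability of X allows a diagonal subsequence that converges at every vertex; in
  coordinates |(R h)(x)|^2 \<le> B m(x) <R h, h> \<le> B m(x), a majorant that is summable when m(X)
  is finite.\<close>

lemma R_compact:
  assumes "\<And>n. norm (h n) \<le> 1"
  obtains r :: "nat \<Rightarrow> nat" and g where "strict_mono r" "(\<lambda>n. R (h (r n))) \<longlonglongrightarrow> g"
proof -
  have n1: "norm (coord (R (h n)) x) \<le> 1" for n x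
    using coord_le[of "R (h n)" x] R.norm_le[of "h n"] assms[of n] by linarith
  have "countable (UNIV :: 'a set)" by simp
  then obtain r where r: "strict_mono (r :: nat \<Rightarrow> nat)" "\<And>x. x \<in> UNIV \<Longrightarrow> \<exists>l. (\<lambda>n. coord (R (h (r n))) x) \<longlonglongrightarrow> l"
    using function_convergent_subsequence[of UNIV "\<lambda>n x. coord (R (h n)) x" 1] n1 by metis
  then obtain l where l: "\<And>x. (\<lambda>n. coord (R (h (r n))) x) \<longlonglongrightarrow> l x" by (metis UNIV_I)
  have "\<exists>g. (\<lambda>n. R (h (r n))) \<longlonglongrightarrow> g"
  proof (rule lsq_dominated_convergence[OF _ _ l])
    show "(\<lambda>x. B * m x) summable_on UNIV" by (intro summable_on_cmult_right m_summable)
    fix n x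
    have "R (h (r n)) \<bullet> h (r n) \<le> 1"
      using R.le_id[of "h (r n)"] assms[of "r n"] power_mono[of "norm (h (r n))" 1 2]
      by (simp add: power2_norm_eq_inner)
    then have "B * m x * (R (h (r n)) \<bullet> h (r n)) \<le> B * m x * 1"
      using B_nonneg m[of x] by (intro mult_left_mono) auto
    then show "(cmod (coord (R (h (r n))) x))\<^sup>2 \<le> B * m x"
      using coord_R_bound[of "h (r n)" x] by simp
  qed
  then show thesis using that r(1) by blast
qed

text \<open>At each x the sum over V of |v(x)|^2 is at most 2 B m(x) / \<rho>; summing over x gives
  the cardinality. The vectors are orthonormal for the real inner product only, so real and
  imaginary parts of v(x) are treated separately, whence the factor 2.\<close>

lemma orthonormal_eigenvectors_card:
  assumes V: "finite V" "\<And>v. v \<in> V \<Longrightarrow> norm v = 1" "\<And>v w. v \<in> V \<Longrightarrow> w \<in> V \<Longrightarrow> v \<noteq> w \<Longrightarrow> v \<bullet> w = 0"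
    and \<rho>: "\<rho> > 0" and eig: "\<And>v. v \<in> V \<Longrightarrow> \<rho> \<le> ev v \<and> R v = ev v *\<^sub>R v"
  shows "real (card V) \<le> 2 * B / \<rho> * infsum m UNIV"
proof -
  have comb: "(cmod (\<Sum>v\<in>V. complex_of_real (a v) * coord v x))\<^sup>2 \<le> B * m x / \<rho> * (\<Sum>v\<in>V. (a v)\<^sup>2)" for a x
  proof -
    define u where "u = (\<Sum>v\<in>V. a v *\<^sub>R v)"
    \<comment> \<open>A preimage of \<open>u\<close> under R, so that the sup bound applies to u = R
      h; here <u, h> is at most the sum of the a(v)^2, divided by \<rho>.\<close>
    define h where "h = (\<Sum>v\<in>V. (a v / ev v) *\<^sub>R v)"
    have ev: "ev v > 0" if "v \<in> V" for v using eig[OF that] \<rho> by linarith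
    have Rh: "R h = u"
      unfolding h_def u_def linear_sum[OF R_linear]
      by (rule sum.cong) (use eig ev in \<open>force simp: linear_scale[OF R_linear]\<close>)+
    have cu: "coord u x = (\<Sum>v\<in>V. complex_of_real (a v) * coord v x)"
    proof -
      have "coord (\<Sum>v\<in>A. a v *\<^sub>R v) x = (\<Sum>v\<in>A. complex_of_real (a v) * coord v x)" for A :: "'a lsq set"
        by (induction A rule: infinite_finite_induct) auto
      then show ?thesis by (simp add: u_def)
    qed
    have "u \<bullet> h = (\<Sum>v\<in>V. \<Sum>w\<in>V. a v * (a w / ev w) * (v \<bullet> w))"
      unfolding u_def inner_sum_left unfolding h_def inner_sum_right by (simp add: mult_ac)
    also have "\<dots> = (\<Sum>v\<in>V. (a v)\<^sup>2 / ev v)"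
    proof (rule sum.cong[OF refl])
      fix v assume v: "v \<in> V"
      have "(\<Sum>w\<in>V. a v * (a w / ev w) * (v \<bullet> w)) = (\<Sum>w\<in>{v}. a v * (a w / ev w) * (v \<bullet> w))"
        using V v by (intro sum.mono_neutral_right) auto
      also have "\<dots> = (a v)\<^sup>2 / ev v" using V(2)[OF v] by (simp add: dot_square_norm power2_eq_square)
      finally show "(\<Sum>w\<in>V. a v * (a w / ev w) * (v \<bullet> w)) = (a v)\<^sup>2 / ev v" .
    qed
    also have "\<dots> \<le> (\<Sum>v\<in>V. (a v)\<^sup>2 / \<rho>)" using eig \<rho> ev by (intro sum_mono divide_left_mono) auto
    finally have uh: "u \<bullet> h \<le> (\<Sum>v\<in>V. (a v)\<^sup>2) / \<rho>" by (simp add: sum_divide_distrib)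
    have "(cmod (coord u x))\<^sup>2 \<le> B * m x * (u \<bullet> h)" using coord_R_bound[of h x] by (simp add: Rh)
    also have "\<dots> \<le> B * m x * ((\<Sum>v\<in>V. (a v)\<^sup>2) / \<rho>)"
      using uh B_nonneg m[of x] by (intro mult_left_mono) auto
    finally show ?thesis by (simp add: cu)
  qed
  \<comment> \<open>Cancels t in t^2 \<le> |z|^2 \<le> c t, covering t = 0 as well.\<close>
  have part: "t \<le> c" if "t \<ge> 0" "c \<ge> 0" "\<bar>t\<bar> \<le> cmod z" "(cmod z)\<^sup>2 \<le> c * t" for t c z
  proof (rule ccontr)
    assume "\<not> t \<le> c"
    then have "c * t < t * t" using that by (intro mult_strict_right_mono) auto
    moreover have "\<bar>t\<bar>\<^sup>2 \<le> (cmod z)\<^sup>2" using that by (intro power_mono) auto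
    ultimately show False using that by (simp add: power2_eq_square)
  qed
  have c0: "B * m x / \<rho> \<ge> 0" for x using B_nonneg m[of x] \<rho> by simp
  have "(\<Sum>v\<in>V. (Re (coord v x))\<^sup>2) \<le> B * m x / \<rho>" for x
  \<comment> \<open>The extremal coefficients: with them the combination, evaluated at x, has the
    sum of squares itself as its real part.\<close>
  proof (rule part[OF _ c0 _ comb[of "\<lambda>v. Re (coord v x)" x]])
    have "Re (\<Sum>v\<in>V. complex_of_real (Re (coord v x)) * coord v x) = (\<Sum>v\<in>V. (Re (coord v x))\<^sup>2)"
      by (simp add: power2_eq_square)
    then show "\<bar>\<Sum>v\<in>V. (Re (coord v x))\<^sup>2\<bar> \<le> cmod (\<Sum>v\<in>V. complex_of_real (Re (coord v x)) * coord v x)"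
      by (metis abs_Re_le_cmod)
  qed (auto intro: sum_nonneg)
  moreover have "(\<Sum>v\<in>V. (Im (coord v x))\<^sup>2) \<le> B * m x / \<rho>" for x
  proof (rule part[OF _ c0 _ comb[of "\<lambda>v. Im (coord v x)" x]])
    have "Im (\<Sum>v\<in>V. complex_of_real (Im (coord v x)) * coord v x) = (\<Sum>v\<in>V. (Im (coord v x))\<^sup>2)"
      by (simp add: power2_eq_square)
    then show "\<bar>\<Sum>v\<in>V. (Im (coord v x))\<^sup>2\<bar> \<le> cmod (\<Sum>v\<in>V. complex_of_real (Im (coord v x)) * coord v x)"
      by (metis abs_Im_le_cmod)
  qed (auto intro: sum_nonneg)
  ultimately have parts: "(\<Sum>v\<in>V. (Re (coord v x))\<^sup>2) + (\<Sum>v\<in>V. (Im (coord v x))\<^sup>2) \<le> B * m x / \<rho> + B * m x / \<rho>" for x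
    by (intro add_mono)
  have le: "(\<Sum>v\<in>V. (cmod (coord v x))\<^sup>2) \<le> 2 * B / \<rho> * m x" for x
    using parts[of x] unfolding cmod_power2 sum.distrib by simp
  have "((\<lambda>x. \<Sum>v\<in>V. (cmod (coord v x))\<^sup>2) has_sum (\<Sum>v\<in>V. (norm v)\<^sup>2)) UNIV"
    unfolding norm_lsq_sq
    by (intro has_sum_sum_finite V has_sum_infsum coord_summable[unfolded square_summable_def])
  moreover have "(\<Sum>v\<in>V. (norm v)\<^sup>2) = real (card V)" using V(2) by simp
  ultimately have hs: "((\<lambda>x. \<Sum>v\<in>V. (cmod (coord v x))\<^sup>2) has_sum real (card V)) UNIV" by simp
  have "((\<lambda>x. 2 * B / \<rho> * m x) has_sum (2 * B / \<rho> * infsum m UNIV)) UNIV"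
    by (intro has_sum_cmult_right has_sum_infsum m_summable)
  then show ?thesis by (rule has_sum_mono[OF hs]) (rule le)
qed

text \<open>\<open>orthonormal_eigenvectors_card\<close> bounds the size of orthonormal sets in the
  eigenspace, so a largest one exists; an eigenvector outside its span would leave a residue that,
  normalised, enlarges it.\<close>

lemma eigenspace_finite_basis:
  assumes r: "r > 0"
  obtains V where "finite V" "\<And>v. R v = r *\<^sub>R v \<Longrightarrow> v = (\<Sum>w\<in>V. (v \<bullet> w) *\<^sub>R w)"
proof -
  define P where "P V \<longleftrightarrow> finite V \<and> (\<forall>v\<in>V. norm v = 1 \<and> R v = r *\<^sub>R v) \<and> (\<forall>v\<in>V. \<forall>w\<in>V. v \<noteq> w \<longrightarrow> v \<bullet> w = 0)" for V
  define K where "K = nat \<lceil>2 * B / r * infsum m UNIV\<rceil>"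
  have card: "card V \<le> K" if "P V" for V
  proof -
    have "real (card V) \<le> 2 * B / r * infsum m UNIV"
      using that r by (intro orthonormal_eigenvectors_card[where ev = "\<lambda>_. r"]) (auto simp: P_def)
    then show ?thesis unfolding K_def by linarith
  qed
  have "P {}" by (simp add: P_def)
  then obtain V where V: "P V" "\<And>W. P W \<Longrightarrow> card W \<le> card V"
    using ex_has_greatest_nat[of P "{}" card "Suc K"] card by (metis le_imp_less_Suc)
  have "v = (\<Sum>w\<in>V. (v \<bullet> w) *\<^sub>R w)" if v: "R v = r *\<^sub>R v" for v
  proof (rule ccontr)
    define z where "z = v - (\<Sum>w\<in>V. (v \<bullet> w) *\<^sub>R w)"
    assume "\<not> ?thesis"
    then have z: "z \<noteq> 0" by (simp add: z_def)
    have "R (\<Sum>w\<in>V. (v \<bullet> w) *\<^sub>R w) = r *\<^sub>R (\<Sum>w\<in>V. (v \<bullet> w) *\<^sub>R w)"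
      unfolding linear_sum[OF R_linear] scaleR_sum_right
      by (rule sum.cong) (use V(1) in \<open>auto simp: P_def linear_scale[OF R_linear]\<close>)
    then have Rz: "R z = r *\<^sub>R z" by (simp add: z_def linear_diff[OF R_linear] v scaleR_diff_right)
    have orth: "z \<bullet> w = 0" if w: "w \<in> V" for w
    proof -
      have "(\<Sum>u\<in>V. (v \<bullet> u) *\<^sub>R u) \<bullet> w = (\<Sum>u\<in>V. (v \<bullet> u) * (u \<bullet> w))" by (simp add: inner_sum_left)
      also have "\<dots> = (\<Sum>u\<in>{w}. (v \<bullet> u) * (u \<bullet> w))"
        using V(1) w by (intro sum.mono_neutral_right) (auto simp: P_def)
      also have "\<dots> = v \<bullet> w" using V(1) w by (simp add: P_def dot_square_norm)
      finally show ?thesis by (simp add: z_def inner_diff_left)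
    qed
    define e where "e = (1 / norm z) *\<^sub>R z"
    have e: "norm e = 1" "R e = r *\<^sub>R e" "\<And>w. w \<in> V \<Longrightarrow> e \<bullet> w = 0" "\<And>w. w \<in> V \<Longrightarrow> w \<bullet> e = 0"
      using z Rz orth by (simp_all add: e_def linear_scale[OF R_linear] inner_commute[of _ z])
    have "e \<notin> V"
    proof
      assume "e \<in> V"
      then have "e \<bullet> e = 0" by (rule e(3))
      then show False using e(1) by simp
    qed
    then have "card (insert e V) = Suc (card V)" using V(1) by (simp add: P_def)
    moreover have "P (insert e V)" using V(1) e unfolding P_def by auto
    ultimately show False using V(2)[of "insert e V"] by simp
  qed
  then show thesis using that V(1) by (auto simp: P_def)
qed

text \<open>Comparing <R v, \<i> v> with <v, \<i> R v> makes \<zeta> real; nonnegativity and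
  injectivity of R make it positive.\<close>

lemma R_complex_eigenvalue:
  assumes v: "v \<noteq> 0" "R v = cscale \<zeta> v"
  obtains r where "r > 0" "\<zeta> = complex_of_real r" "R v = r *\<^sub>R v"
proof -
  have "R v \<bullet> cscale \<i> v = v \<bullet> cscale \<i> (R v)" unfolding R.sym R_cscale ..
  then have "cscale \<zeta> v \<bullet> cscale \<i> v = v \<bullet> cscale (\<i> * \<zeta>) v" unfolding v(2) by simp
  then have "Im \<zeta> = 0" using v(1) by (simp add: inner_cscale inner_cscale_self)
  then have \<zeta>: "\<zeta> = complex_of_real (Re \<zeta>)" by (simp add: complex_eq_iff)
  have Rv: "R v = Re \<zeta> *\<^sub>R v" using v(2) \<zeta> by (metis cscale_of_real)
  have "0 \<le> Re \<zeta> * (v \<bullet> v)" using R.nonneg[of v] unfolding Rv by simp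
  moreover have "0 < v \<bullet> v" using v(1) by simp
  ultimately have "0 \<le> Re \<zeta>" using zero_le_mult_iff[of "Re \<zeta>" "v \<bullet> v"] by linarith
  moreover have "Re \<zeta> \<noteq> 0"
  proof
    assume "Re \<zeta> = 0"
    then have "R v = 0" using Rv by simp
    then show False using R_inj v(1) by blast
  qed
  ultimately have "Re \<zeta> > 0" by simp
  then show thesis by (rule that[OF _ \<zeta> Rv])
qed

lemma op_L_shift: "(\<lambda>x. op_L m D Q (emb (R h)) x - z * emb (R h) x) = emb (h - cscale (1 + z) (R h))"
proof -
  have "h - cscale (1 + z) (R h) = (h - R h) - cscale z (R h)" by (rule lsq_eqI) (simp add: algebra_simps)
  then show ?thesis by (simp only: op_L_R emb_diff emb_cscale)
qed

text \<open>If \<open>h - (1 + z) R h\<close> is not bounded below, compactness of \<open>R\<close> turns an almost-kernel sequence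
  into an eigenvector.\<close>

lemma spectrum_eigenvector:
  assumes z: "z \<in> op_spectrum m D Q"
  obtains r v where "r > 0" "norm v = 1" "R v = r *\<^sub>R v" "z = complex_of_real (1 / r - 1)"
proof -
  define s where "s = 1 + z"
  define T where "T a h = h - cscale a (R h)" for a h
  have TL: "(\<lambda>x. op_L m D Q (emb (R h)) x - z * emb (R h) x) = emb (T s h)" for h
    unfolding op_L_shift T_def s_def ..
  have bT: "bounded_linear (T a)" for a
    unfolding T_def[abs_def]
    by (intro bounded_linear_sub bounded_linear_ident bounded_linear_compose[OF bounded_linear_cscale R.bounded_linear])
  have "\<not> (\<exists>c>0. \<forall>h. c * norm h \<le> norm (T s h))"
  proof
    assume "\<exists>c>0. \<forall>h. c * norm h \<le> norm (T s h)"
    then obtain c where c: "c > 0" "\<And>h. c * norm h \<le> norm (T s h)" by blast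
    \<comment> \<open>T s is normal with adjoint T (cnj s), because R is symmetric and commutes with
      complex scalars.\<close>
    have "surj (T s)"
    proof (rule normal_bounded_below_surj[OF bT bT[of "cnj s"] _ _ c])
      show "T s f \<bullet> g = f \<bullet> T (cnj s) g" for f g
        by (simp add: T_def inner_diff_left inner_diff_right inner_cscale R_cscale R.sym)
      show "T s (T (cnj s) f) = T (cnj s) (T s f)" for f
        by (simp add: T_def linear_diff[OF R_linear] R_cscale[symmetric] algebra_simps)
    qed
    then have "z \<in> op_resolvent_set m D Q"
      unfolding op_resolvent_set_def
    proof (intro CollectI conjI ballI exI[of _ "1 / c"])
      fix f assume "f \<in> l2 m"
      then obtain k where k: "f = emb k" using l2_emb by blast
      obtain h where "T s h = k" using \<open>surj (T s)\<close> by (metis surj_def)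
      then show "\<exists>u\<in>op_dom m D Q. (\<lambda>x. op_L m D Q u x - z * u x) = f"
        using op_dom_R[of h] TL[of h] k by blast
    next
      fix u assume "u \<in> op_dom m D Q"
      then obtain h where h: "u = emb (R h)" using op_dom_imp_R by blast
      have "norm (R h) \<le> 1 / c * norm (T s h)"
        using R.norm_le[of h] c(2)[of h] c(1) by (simp add: field_simps) (smt (verit) mult_left_mono)
      then show "l2norm m u \<le> 1 / c * l2norm m (\<lambda>x. op_L m D Q u x - z * u x)"
        unfolding h TL l2norm_emb .
    qed
    then show False using z by (simp add: op_spectrum_def)
  qed
  then have small: "\<exists>h. norm (T s h) < c * norm h" if "c > 0" for c using that by (meson not_le)
  have "\<exists>h. norm (T s h) < 1 / real (Suc n) * norm h" for n by (rule small) simp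
  then obtain k where k: "\<And>n. norm (T s (k n)) < 1 / real (Suc n) * norm (k n)" by metis
  define h where "h n = (1 / norm (k n)) *\<^sub>R k n" for n
  have k0: "norm (k n) > 0" for n
    using k[of n] by (metis mult_zero_right norm_ge_zero norm_zero not_less zero_less_norm_iff)
  have h: "norm (h n) = 1" for n using k0[of n] by (simp add: h_def)
  have Th: "norm (T s (h n)) \<le> 1 / real (Suc n)" for n
    using k[of n] k0[of n] linear_scale[OF bounded_linear.linear[OF bT], of s "1 / norm (k n)" "k n"]
    by (simp add: h_def field_simps del: of_nat_Suc)
  obtain r :: "nat \<Rightarrow> nat" and g where r: "strict_mono r" "(\<lambda>n. R (h (r n))) \<longlonglongrightarrow> g"
    using R_compact[of h] h by (metis order_refl)
  have "(\<lambda>n. T s (h n)) \<longlonglongrightarrow> 0"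
    by (rule Lim_null_comparison[OF _ LIMSEQ_inverse_real_of_nat[unfolded inverse_eq_divide]])
       (use Th in auto)
  then have "(\<lambda>n. T s (h (r n))) \<longlonglongrightarrow> 0" using LIMSEQ_subseq_LIMSEQ[OF _ r(1)] by (simp add: o_def)
  then have "(\<lambda>n. T s (h (r n)) + cscale s (R (h (r n)))) \<longlonglongrightarrow> 0 + cscale s g"
    by (intro tendsto_add bounded_linear.tendsto[OF bounded_linear_cscale] r)
  \<comment> \<open>Not only R h but h itself converges along the subsequence, since h = T s h + s R
    h and T s h tends to 0.\<close>
  then have hl: "(\<lambda>n. h (r n)) \<longlonglongrightarrow> cscale s g" by (simp add: T_def)
  define v where "v = cscale s g"
  have v1: "norm v = 1"
    using tendsto_norm[OF hl] unfolding h v_def[symmetric] by (rule LIMSEQ_unique[OF _ tendsto_const])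
  have "g = R v" using LIMSEQ_unique[OF r(2) bounded_linear.tendsto[OF R.bounded_linear hl]] by (simp add: v_def)
  then have v: "v = cscale s (R v)" by (simp add: v_def)
  have s: "s \<noteq> 0" using v v1 by auto
  have "cscale (1 / s) v = R v" using arg_cong[OF v, of "cscale (1 / s)"] s by simp
  then obtain \<rho> where \<rho>: "\<rho> > 0" "1 / s = complex_of_real \<rho>" "R v = \<rho> *\<^sub>R v"
    using R_complex_eigenvalue[of v "1 / s"] v1 by (metis norm_zero zero_neq_one)
  have "z = complex_of_real (1 / \<rho> - 1)" using \<rho>(1,2) s by (simp add: s_def field_simps)
  then show thesis using that \<rho> v1 by blast
qed

text \<open>Isolation: distinct spectral points have orthogonal eigenvectors of R, and those within
  distance 1 of z have R-eigenvalues bounded away from 0, so there are only finitely many.\<close>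

lemma purely_discrete: "purely_discrete_spectrum m D Q"
  unfolding purely_discrete_spectrum_def
proof (intro ballI conjI)
  fix z assume z: "z \<in> op_spectrum m D Q"
  obtain r v where rv: "r > 0" "norm v = 1" "R v = r *\<^sub>R v" "z = complex_of_real (1 / r - 1)"
    using spectrum_eigenvector[OF z] .
  show "\<exists>u\<in>op_dom m D Q. u \<noteq> (\<lambda>x. 0) \<and> op_L m D Q u = (\<lambda>x. z * u x)"
  proof -
    have v: "v = R ((1 / r) *\<^sub>R v)" using rv(1,3) by (simp add: linear_scale[OF R_linear])
    have "op_L m D Q (emb v) = emb ((1 / r) *\<^sub>R v - v)" using op_L_R[of "(1 / r) *\<^sub>R v"] v by simp
    also have "(1 / r) *\<^sub>R v - v = cscale z v" unfolding rv(4) cscale_of_real by (simp add: scaleR_diff_left)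
    finally have "op_L m D Q (emb v) = (\<lambda>x. z * emb v x)" unfolding emb_cscale .
    moreover have "emb v \<in> op_dom m D Q" by (subst v) (rule op_dom_R)
    moreover have "emb v \<noteq> (\<lambda>x. 0)" using rv(2) emb_inj[of v 0] by auto
    ultimately show ?thesis by blast
  qed
  show "\<exists>B. finite B \<and> (\<forall>u\<in>op_dom m D Q. op_L m D Q u = (\<lambda>x. z * u x) \<longrightarrow> (\<exists>k. u = (\<lambda>x. \<Sum>v\<in>B. k v * v x)))"
  proof -
    obtain V where V: "finite V" "\<And>v. R v = r *\<^sub>R v \<Longrightarrow> v = (\<Sum>w\<in>V. (v \<bullet> w) *\<^sub>R w)"
      using eigenspace_finite_basis[OF rv(1)] by blast
    show ?thesis
    proof (intro exI[of _ "emb ` V"] conjI ballI impI)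
      show "finite (emb ` V)" using V(1) by simp
      fix u assume u: "u \<in> op_dom m D Q" "op_L m D Q u = (\<lambda>x. z * u x)"
      obtain h where h: "u = emb (R h)" using op_dom_imp_R[OF u(1)] .
      have "emb (h - R h) = emb (cscale z (R h))" using u(2) unfolding h op_L_R emb_cscale .
      then have "h = R h + (1 / r - 1) *\<^sub>R R h" unfolding emb_inj rv(4) cscale_of_real by (simp add: algebra_simps)
      then have "h = (1 / r) *\<^sub>R R h" by (simp add: scaleR_diff_left)
      then have "R h = (1 / r) *\<^sub>R R (R h)" by (metis linear_scale[OF R_linear])
      then have "R (R h) = r *\<^sub>R R h" using rv(1) by (metis divide_self_if less_irrefl scaleR_one scaleR_scaleR times_divide_eq_right mult.right_neutral)
      then have e: "R h = (\<Sum>w\<in>V. (R h \<bullet> w) *\<^sub>R w)" by (rule V(2))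
      have sum: "emb (\<Sum>w\<in>W. c w *\<^sub>R w) = (\<lambda>x. \<Sum>w\<in>W. complex_of_real (c w) * emb w x)" for c and W :: "'a lsq set"
        by (induction W rule: infinite_finite_induct) (simp_all add: emb_add emb_scaleR)
      have inj: "inj_on emb V" by (auto simp: inj_on_def emb_inj)
      have "u = (\<lambda>x. \<Sum>w\<in>V. complex_of_real (R h \<bullet> w) * emb w x)" unfolding h by (subst e) (rule sum)
      \<comment> \<open>The coefficients must be indexed by functions, so each basis function is
        traced back to its coordinate vector by injectivity of \<open>emb\<close>.\<close>
      also have "\<dots> = (\<lambda>x. \<Sum>v\<in>emb ` V. complex_of_real (R h \<bullet> the_inv_into V emb v) * v x)"
        by (simp add: sum.reindex[OF inj] the_inv_into_f_f[OF inj])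
      finally show "\<exists>k. u = (\<lambda>x. \<Sum>v\<in>emb ` V. k v * v x)" by (rule exI[of _ "\<lambda>v. complex_of_real (R h \<bullet> the_inv_into V emb v)"])
    qed
  qed
  show "\<exists>e>0. \<forall>\<mu>\<in>op_spectrum m D Q. cmod (\<mu> - z) < e \<longrightarrow> \<mu> = z"
  proof -
    define A where "A = {\<mu> \<in> op_spectrum m D Q. cmod (\<mu> - z) < 1}"
    have "\<forall>\<mu>. \<exists>r v. \<mu> \<in> op_spectrum m D Q \<longrightarrow> r > 0 \<and> norm v = 1 \<and> R v = r *\<^sub>R v \<and> \<mu> = complex_of_real (1 / r - 1)"
      using spectrum_eigenvector by metis
    then obtain l w where lw: "\<And>\<mu>. \<mu> \<in> op_spectrum m D Q \<Longrightarrow>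
        l \<mu> > 0 \<and> norm (w \<mu>) = 1 \<and> R (w \<mu>) = l \<mu> *\<^sub>R w \<mu> \<and> \<mu> = complex_of_real (1 / l \<mu> - 1)"
      by metis
    \<comment> \<open>For the R-eigenvalue l of \<mu>, the bound |\<mu>| \<le> |z| + 1 forces 1 / l
      - 1 \<le> |z| + 1.\<close>
    define \<rho> where "\<rho> = 1 / (cmod z + 2)"
    have \<rho>: "\<rho> > 0" by (simp add: \<rho>_def add_nonneg_pos)
    have l_ge: "\<rho> \<le> l \<mu>" if "\<mu> \<in> A" for \<mu>
    proof -
      have \<mu>: "\<mu> \<in> op_spectrum m D Q" "cmod (\<mu> - z) < 1" using that by (auto simp: A_def)
      have "\<bar>1 / l \<mu> - 1\<bar> = cmod \<mu>" using lw[OF \<mu>(1)] by (metis norm_of_real)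
      also have "\<dots> \<le> cmod z + 1" using norm_triangle_sub[of \<mu> z] \<mu>(2) by linarith
      finally have "1 / l \<mu> \<le> cmod z + 2" by linarith
      then show ?thesis using lw[OF \<mu>(1)] by (simp add: \<rho>_def field_simps add_nonneg_pos)
    qed
    have orth: "w \<mu> \<bullet> w \<nu> = 0" if "\<mu> \<in> A" "\<nu> \<in> A" "\<mu> \<noteq> \<nu>" for \<mu> \<nu>
    proof -
      have m: "\<mu> \<in> op_spectrum m D Q" "\<nu> \<in> op_spectrum m D Q" using that by (auto simp: A_def)
      have "l \<mu> \<noteq> l \<nu>" using lw[OF m(1)] lw[OF m(2)] that(3) by metis
      moreover have "l \<mu> * (w \<mu> \<bullet> w \<nu>) = l \<nu> * (w \<mu> \<bullet> w \<nu>)"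
        using R.sym[of "w \<mu>" "w \<nu>"] lw[OF m(1)] lw[OF m(2)] by simp
      ultimately show ?thesis by simp
    qed
    have inj: "inj_on w A"
    proof (rule inj_onI, rule ccontr)
      fix \<mu> \<nu> assume *: "\<mu> \<in> A" "\<nu> \<in> A" "w \<mu> = w \<nu>" "\<mu> \<noteq> \<nu>"
      then have "w \<mu> \<bullet> w \<mu> = 0" using orth[of \<mu> \<nu>] by simp
      then show False using lw[of \<mu>] *(1) by (auto simp: A_def)
    qed
    define K where "K = nat \<lceil>2 * B / \<rho> * infsum m UNIV\<rceil>"
    have "card G \<le> K" if G: "G \<subseteq> A" "finite G" for G
    proof -
      have injG: "inj_on w G" using inj G(1) by (rule inj_on_subset)
      have "real (card (w ` G)) \<le> 2 * B / \<rho> * infsum m UNIV"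
      proof (rule orthonormal_eigenvectors_card[where ev = "\<lambda>v. l (the_inv_into G w v)"])
        show "norm v = 1" if "v \<in> w ` G" for v using that lw G by (auto simp: A_def)
        show "v \<bullet> v' = 0" if "v \<in> w ` G" "v' \<in> w ` G" "v \<noteq> v'" for v v' using that orth G(1) by blast
        show "\<rho> \<le> l (the_inv_into G w v) \<and> R v = l (the_inv_into G w v) *\<^sub>R v" if "v \<in> w ` G" for v
          using that l_ge lw G(1) by (auto simp: the_inv_into_f_f[OF injG] A_def)
      qed (use G \<rho> in auto)
      then have "real (card G) \<le> 2 * B / \<rho> * infsum m UNIV" using card_image[OF injG] by simp
      then show ?thesis unfolding K_def by linarith
    qed
    then have "finite A" using finite_if_finite_subsets_card_bdd[of A K] by blast
    then obtain d where d: "d > 0" "\<forall>\<mu>\<in>A. \<mu> \<noteq> z \<longrightarrow> d \<le> dist z \<mu>" using finite_set_avoid by blast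
    show ?thesis
    proof (intro exI[of _ "min 1 d"] conjI ballI impI)
      show "min 1 d > 0" using d(1) by simp
      fix \<mu> assume "\<mu> \<in> op_spectrum m D Q" "cmod (\<mu> - z) < min 1 d"
      then show "\<mu> = z" using d(2) by (force simp: A_def dist_norm norm_minus_commute)
    qed
  qed
qed

end

theorem mainTheorem14:
  fixes b :: "'a::countable \<Rightarrow> 'a \<Rightarrow> real" and c :: "'a \<Rightarrow> real" and m :: "'a \<Rightarrow> real"
    and D :: "('a \<Rightarrow> complex) set" and Q :: "('a \<Rightarrow> complex) \<Rightarrow> real"
  assumes "infinite (UNIV :: 'a set)"
    and "weighted_graph b c" and "graph_connected b" and "canonically_compactifiable b c"
    and "\<forall>x. m x > 0"
    and "closed_form m D Q"
    and "Cc \<subseteq> D" and "D \<subseteq> Dtilde b c \<inter> l2 m"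
    and "\<forall>u\<in>D. Q u = Qtilde b c u"
  shows "(\<forall>t>0. bounded_l2_linfty m (heat_op m D Q t)) \<and>
         (\<forall>\<alpha>>0. bounded_l2_linfty m (resolvent_op m D Q \<alpha>)) \<and>
         (m summable_on UNIV \<longrightarrow>
            (\<forall>t>0. trace_class m (heat_op m D Q t)) \<and>
            (\<forall>\<alpha>>0. trace_class m (resolvent_op m D Q \<alpha>)) \<and>
            purely_discrete_spectrum m D Q)"
proof -
  have m: "m x > 0" for x using assms(5) by blast
  define a where "a = (undefined :: 'a)"
  obtain C where C: "\<forall>f\<in>Dtilde b c. \<forall>x. (cmod (f x))\<^sup>2 \<le> C * (Qtilde b c f + (cmod (f a))\<^sup>2)"
    using canonically_compactifiable_sup_bound[OF assms(2-4)] by blast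
  \<comment> \<open>The inequality |u(a)|^2 \<le> |u|^2 / m(a) trades the base point term for the
    norm, whence 1 + 1 / m(a); the absolute value is there because the sign of C is not
    known.\<close>
  define B where "B = \<bar>C\<bar> * (1 + 1 / m a)"
  have bound: "(cmod (u x))\<^sup>2 \<le> B * (Q u + (l2norm m u)\<^sup>2)" if u: "u \<in> D" for u x
  proof -
    have uD: "u \<in> Dtilde b c" "u \<in> l2 m" using assms(8) u by auto
    have Q: "Q u = Qtilde b c u" "0 \<le> Q u" using assms(9) u Dtilde_energy_bounds(1)[OF assms(2) uD(1)] by auto
    obtain h where h: "u = of_lsq m h" using l2_imp_of_lsq[where m = m, OF m uD(2)] .
    have "(cmod (u a))\<^sup>2 * m a = (cmod (coord h a))\<^sup>2" unfolding h by (rule of_lsq_norm_term[where m = m, OF m])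
    also have "\<dots> \<le> (norm h)\<^sup>2" by (intro power_mono coord_le) auto
    also have "norm h = l2norm m u" unfolding h by (rule l2norm_of_lsq[where m = m, OF m, symmetric])
    finally have ua: "(cmod (u a))\<^sup>2 \<le> 1 / m a * (l2norm m u)\<^sup>2" using m[of a] by (simp add: field_simps)
    have "(cmod (u x))\<^sup>2 \<le> C * (Q u + (cmod (u a))\<^sup>2)" using C uD(1) Q(1) by simp
    also have "\<dots> \<le> \<bar>C\<bar> * (Q u + (cmod (u a))\<^sup>2)" using Q(2) by (intro mult_right_mono) auto
    also have "\<dots> \<le> \<bar>C\<bar> * ((1 + 1 / m a) * (Q u + (l2norm m u)\<^sup>2))"
    proof (rule mult_left_mono)
      have "0 \<le> 1 / m a * Q u" using m[of a] Q(2) by simp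
      then show "Q u + (cmod (u a))\<^sup>2 \<le> (1 + 1 / m a) * (Q u + (l2norm m u)\<^sup>2)"
        using ua zero_le_power2[of "l2norm m u"] unfolding distrib_left distrib_right by linarith
    qed simp
    finally show ?thesis by (simp add: B_def mult.assoc)
  qed
  interpret sup_bounded_form m D Q B
    by unfold_locales (use m assms(6,7) bound in \<open>auto simp: B_def less_imp_le\<close>)
  note rk = continuous_resolvent_kernel
  show ?thesis
  proof (intro conjI impI allI)
    show "bounded_l2_linfty m (heat_op m D Q t)" if "t > 0" for t
      by (rule bounded_l2_linfty_represented[OF continuous_heat_kernel[OF that] heat_op_eq[OF that]])
    show "bounded_l2_linfty m (resolvent_op m D Q \<alpha>)" if "\<alpha> > 0" for \<alpha>
      by (rule bounded_l2_linfty_represented[OF rk(1)[OF that] resolvent_op_eq[OF that]])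
    assume sm: "m summable_on UNIV"
    show "trace_class m (heat_op m D Q t)" if "t > 0" for t
      by (rule trace_class_represented[OF continuous_heat_kernel[OF that] _ heat_op_eq[OF that] sm])
         (simp add: heat_kernel_nonneg)
    show "trace_class m (resolvent_op m D Q \<alpha>)" if "\<alpha> > 0" for \<alpha>
      by (rule trace_class_represented[OF rk(1)[OF that] _ resolvent_op_eq[OF that] sm])
         (use rk(2)[OF that] in \<open>simp add: less_imp_le\<close>)
    interpret finite_sup_bounded_form m D Q B by unfold_locales (rule sm)
    show "purely_discrete_spectrum m D Q" by (rule purely_discrete)
  qed
qed

end
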